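(* Let $\Lambda$ be an Artin algebra and let $P$ be an indecomposable projective $\Lambda$-module. Let $P_1\xrightarrow{g}P_0\xrightarrow{\sigma}\nu P\to 0$ be a minimal projective presentation of $\nu P$, and let $e:P\to P_0$ be a lifting of the morphism $\alpha_P:P\to\nu P$ through $\sigma$ (that is, $\sigma e=\alpha_P$). Then the following sequence is an almost split sequence in $\mathcal{P}(\Lambda)$: $$0\to\left(P_1\xrightarrow{g}P_0\right)\xrightarrow{\left([1\ 0]^t,\,1\right)}\left(P_1\oplus P\xrightarrow{[g\ e]}P_0\right)\xrightarrow{\left([0\ 1],\,0\right)}\left(P\to 0\right)\to 0.$$
   Context: $\mathrm{mod}\text{-}\Lambda$ is the category of finitely generated $\Lambda$-modules. $\mathcal{H}(\Lambda)$ is the morphism category of $\mathrm{mod}\text{-}\Lambda$: objects are morphisms $f:X\to Y$ in $\mathrm{mod}\text{-}\Lambda$, and a morphism from $(X\xrightarrow{f}Y)$ to $(X'\xrightarrow{f'}Y')$ is a pair $(\sigma_1,\sigma_2)$ with $\sigma_1:X\to X'$, $\sigma_2:Y\to Y'$ and $\sigma_2f=f'\sigma_1$. It is abelian, with exactness computed componentwise. $\mathcal{P}(\Lambda)$ is the full subcategory of $\mathcal{H}(\Lambda)$ of objects $(P\xrightarrow{f}Q)$ with $P,Q$ projective; it is extension-closed and carries the exact structure inherited from $\mathcal{H}(\Lambda)$, with respect to which almost split sequences in $\mathcal{P}(\Lambda)$ are taken. $\nu=D\,\mathrm{Hom}_\Lambda(-,\Lambda)$ is the Nakayama functor. For an indecomposable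 projective module $P$, $\alpha_P:P\to\nu P$ denotes the composite $P\xrightarrow{p}\mathrm{top}(P)\simeq\mathrm{soc}(\nu P)\xrightarrow{i}\nu P$ of the canonical epimorphism, an isomorphism, and the canonical inclusion; as an object of $\mathcal{H}(\Lambda)$, $(P\xrightarrow{\alpha_P}\nu P)$ is unique up to isomorphism, being the middle term of the almost split sequence $0\to(0\to\nu P)\to(P\xrightarrow{\alpha_P}\nu P)\to(P\to 0)\to 0$ in $\mathcal{H}(\Lambda)$. *)

theory Defs
  imports "HOL-Algebra.Module" "HOL-Algebra.QuotRing"
begin

section \<open>Modules over a not necessarily commutative ring\<close>

text \<open>
  The library locale \<^locale>\<open>module\<close> requires a commutative ring of scalars. Right modules over an
  arbitrary ring reuse its record type, with \<open>a \<odot>\<^bsub>M\<^esub> x\<close> denoting the right action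
  \<open>x \<cdot> a\<close>; hence the order of the factors in \<open>smult_assoc_right\<close>. The record fields
  \<open>mult\<close> and \<open>one\<close> of a module play no role and are left undefined in the constructions below.
\<close>

locale right_module = A?: ring A + M?: abelian_group M
  for A :: "('a, 'r) ring_scheme" (structure) and M :: "('a, 'm) module" (structure) +
  assumes smult_closed:
      "\<lbrakk>a \<in> carrier A; x \<in> carrier M\<rbrakk> \<Longrightarrow> a \<odot>\<^bsub>M\<^esub> x \<in> carrier M"
    and smult_distr_ring:
      "\<lbrakk>a \<in> carrier A; b \<in> carrier A; x \<in> carrier M\<rbrakk>
        \<Longrightarrow> (a \<oplus>\<^bsub>A\<^esub> b) \<odot>\<^bsub>M\<^esub> x = a \<odot>\<^bsub>M\<^esub> x \<oplus>\<^bsub>M\<^esub> b \<odot>\<^bsub>M\<^esub> x"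
    and smult_distr_module:
      "\<lbrakk>a \<in> carrier A; x \<in> carrier M; y \<in> carrier M\<rbrakk>
        \<Longrightarrow> a \<odot>\<^bsub>M\<^esub> (x \<oplus>\<^bsub>M\<^esub> y) = a \<odot>\<^bsub>M\<^esub> x \<oplus>\<^bsub>M\<^esub> a \<odot>\<^bsub>M\<^esub> y"
    and smult_assoc_right:
      "\<lbrakk>a \<in> carrier A; b \<in> carrier A; x \<in> carrier M\<rbrakk>
        \<Longrightarrow> (a \<otimes>\<^bsub>A\<^esub> b) \<odot>\<^bsub>M\<^esub> x = b \<odot>\<^bsub>M\<^esub> (a \<odot>\<^bsub>M\<^esub> x)"
    and smult_one:
      "x \<in> carrier M \<Longrightarrow> \<one>\<^bsub>A\<^esub> \<odot>\<^bsub>M\<^esub> x = x"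

lemma right_module_cring_iff:
  assumes "cring R"
  shows "right_module R M \<longleftrightarrow> module R M"
proof -
  interpret cring R by fact
  show ?thesis
    unfolding right_module_def right_module_axioms_def module_def module_axioms_def
    using assms ring_axioms by (auto, (metis m_comm)+)
qed

text \<open>Maps are only relevant on carriers; elements of \<open>mod_hom\<close> are arbitrary outside.\<close>

definition mod_hom ::
    "('a, 'r) ring_scheme \<Rightarrow> ('a, 'm) module \<Rightarrow> ('a, 'n) module \<Rightarrow> ('m \<Rightarrow> 'n) set" where
  "mod_hom A M N = {f. f \<in> carrier M \<rightarrow> carrier N
     \<and> (\<forall>x\<in>carrier M. \<forall>y\<in>carrier M. f (x \<oplus>\<^bsub>M\<^esub> y) = f x \<oplus>\<^bsub>N\<^esub> f y)
     \<and> (\<forall>a\<in>carrier A. \<forall>x\<in>carrier M. f (a \<odot>\<^bsub>M\<^esub> x) = a \<odot>\<^bsub>N\<^esub> f x)}"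

definition mod_ker :: "('a, 'm) module \<Rightarrow> ('a, 'n) module \<Rightarrow> ('m \<Rightarrow> 'n) \<Rightarrow> 'm set" where
  "mod_ker M N f = {x \<in> carrier M. f x = \<zero>\<^bsub>N\<^esub>}"

definition short_exact ::
    "('a, 'r) ring_scheme \<Rightarrow> ('a, 'l) module \<Rightarrow> ('l \<Rightarrow> 'm) \<Rightarrow> ('a, 'm) module \<Rightarrow> ('m \<Rightarrow> 'n)
      \<Rightarrow> ('a, 'n) module \<Rightarrow> bool" where
  "short_exact A L f M g N \<longleftrightarrow>
     f \<in> mod_hom A L M \<and> g \<in> mod_hom A M N \<and> inj_on f (carrier L)
     \<and> f ` carrier L = mod_ker M N g \<and> g ` carrier M = carrier N"

definition finitely_generated :: "('a, 'r) ring_scheme \<Rightarrow> ('a, 'm) module \<Rightarrow> bool" where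
  "finitely_generated A M \<longleftrightarrow>
     (\<exists>B. finite B \<and> B \<subseteq> carrier M \<and> (\<forall>N. submodule N A M \<and> B \<subseteq> N \<longrightarrow> N = carrier M))"

text \<open>Objects of \<open>mod-A\<close>.\<close>

definition fg_module :: "('a, 'r) ring_scheme \<Rightarrow> ('a, 'm) module \<Rightarrow> bool" where
  "fg_module A M \<longleftrightarrow> right_module A M \<and> finitely_generated A M"

definition indecomposable_module :: "('a, 'r) ring_scheme \<Rightarrow> ('a, 'm) module \<Rightarrow> bool" where
  "indecomposable_module A M \<longleftrightarrow> carrier M \<noteq> {\<zero>\<^bsub>M\<^esub>}
     \<and> (\<forall>U V. submodule U A M \<and> submodule V A M \<and> U \<inter> V = {\<zero>\<^bsub>M\<^esub>} \<and> U <+>\<^bsub>M\<^esub> V = carrier M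
           \<longrightarrow> U = {\<zero>\<^bsub>M\<^esub>} \<or> V = {\<zero>\<^bsub>M\<^esub>})"

text \<open>
  In the next two definitions the test modules live on the type \<open>(nat \<Rightarrow> 'a) set\<close>. It contains a copy
  of every finitely generated \<open>A\<close>-module: if \<open>b 0, \<dots>, b (n - 1)\<close> generate \<open>M\<close>, then sending \<open>x\<close> to
  its fibre, the set of coefficient families \<open>v\<close> with \<open>x = (\<Sum>i<n. b i \<cdot> v i)\<close>, is injective on \<open>M\<close>.
  This is enough for both notions: lifting against an epimorphism from a finitely generated module
  only involves finitely generated submodules, and by Baer's criterion injectivity can be tested
  on inclusions of right ideals into \<open>A\<close>.
\<close>

definition projective_module :: "('a, 'r) ring_scheme \<Rightarrow> ('a, 'm) module \<Rightarrow> bool" where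
  "projective_module A P \<longleftrightarrow> right_module A P
     \<and> (\<forall>(M :: ('a, (nat \<Rightarrow> 'a) set) module) (N :: ('a, (nat \<Rightarrow> 'a) set) module) p f.
          right_module A M \<and> right_module A N \<and> p \<in> mod_hom A M N \<and> p ` carrier M = carrier N
            \<and> f \<in> mod_hom A P N
          \<longrightarrow> (\<exists>f'\<in>mod_hom A P M. \<forall>x\<in>carrier P. p (f' x) = f x))"

definition injective_module :: "('a, 'r) ring_scheme \<Rightarrow> ('a, 'm) module \<Rightarrow> bool" where
  "injective_module A J \<longleftrightarrow> right_module A J
     \<and> (\<forall>(M :: ('a, (nat \<Rightarrow> 'a) set) module) (N :: ('a, (nat \<Rightarrow> 'a) set) module) i f.
          right_module A M \<and> right_module A N \<and> i \<in> mod_hom A M N \<and> inj_on i (carrier M)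
            \<and> f \<in> mod_hom A M J
          \<longrightarrow> (\<exists>f'\<in>mod_hom A N J. \<forall>x\<in>carrier M. f' (i x) = f x))"

definition injective_envelope ::
    "('a, 'r) ring_scheme \<Rightarrow> ('a, 'm) module \<Rightarrow> ('a, 'n) module \<Rightarrow> bool" where
  "injective_envelope A M J \<longleftrightarrow> right_module A M \<and> injective_module A J
     \<and> (\<exists>i\<in>mod_hom A M J. inj_on i (carrier M)
          \<and> (\<forall>N. submodule N A J \<and> N \<inter> i ` carrier M = {\<zero>\<^bsub>J\<^esub>} \<longrightarrow> N = {\<zero>\<^bsub>J\<^esub>}))"

definition superfluous_submodule :: "('a, 'r) ring_scheme \<Rightarrow> ('a, 'm) module \<Rightarrow> 'm set \<Rightarrow> bool" where
  "superfluous_submodule A M K \<longleftrightarrow> submodule K A M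
     \<and> (\<forall>N. submodule N A M \<and> N <+>\<^bsub>M\<^esub> K = carrier M \<longrightarrow> N = carrier M)"

definition projective_cover ::
    "('a, 'r) ring_scheme \<Rightarrow> ('a, 'm) module \<Rightarrow> ('m \<Rightarrow> 'n) \<Rightarrow> ('a, 'n) module \<Rightarrow> bool" where
  "projective_cover A P f M \<longleftrightarrow> fg_module A P \<and> projective_module A P
     \<and> f \<in> mod_hom A P M \<and> f ` carrier P = carrier M
     \<and> superfluous_submodule A P (mod_ker P M f)"

definition minimal_projective_presentation ::
    "('a, 'r) ring_scheme \<Rightarrow> ('a, 'l) module \<Rightarrow> ('l \<Rightarrow> 'm) \<Rightarrow> ('a, 'm) module \<Rightarrow> ('m \<Rightarrow> 'n)
      \<Rightarrow> ('a, 'n) module \<Rightarrow> bool" where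
  "minimal_projective_presentation A P\<^sub>1 g P\<^sub>0 \<sigma> M \<longleftrightarrow>
     projective_cover A P\<^sub>0 \<sigma> M \<and> projective_cover A P\<^sub>1 g (P\<^sub>0\<lparr>carrier := mod_ker P\<^sub>0 M \<sigma>\<rparr>)"

definition zero_module :: "('a, unit) module" where
  "zero_module = \<lparr>carrier = UNIV, mult = undefined, one = undefined,
     zero = (), add = (\<lambda>_ _. ()), smult = (\<lambda>_ _. ())\<rparr>"

definition direct_sum ::
    "('a, 'm) module \<Rightarrow> ('a, 'n) module \<Rightarrow> ('a, 'm \<times> 'n) module" where
  "direct_sum M N = \<lparr>carrier = carrier M \<times> carrier N, mult = undefined, one = undefined,
     zero = (\<zero>\<^bsub>M\<^esub>, \<zero>\<^bsub>N\<^esub>),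
     add = (\<lambda>(x, y) (x', y'). (x \<oplus>\<^bsub>M\<^esub> x', y \<oplus>\<^bsub>N\<^esub> y')),
     smult = (\<lambda>a (x, y). (a \<odot>\<^bsub>M\<^esub> x, a \<odot>\<^bsub>N\<^esub> y))\<rparr>"

definition regular_module :: "('a, 'r) ring_scheme \<Rightarrow> ('a, 'a) module" where
  "regular_module A = \<lparr>carrier = carrier A, mult = undefined, one = undefined,
     zero = \<zero>\<^bsub>A\<^esub>, add = add A, smult = (\<lambda>a x. x \<otimes>\<^bsub>A\<^esub> a)\<rparr>"

definition quotient_module :: "('a, 'm) module \<Rightarrow> 'm set \<Rightarrow> ('a, 'm set) module" where
  "quotient_module M N = \<lparr>carrier = a_rcosets\<^bsub>M\<^esub> N, mult = undefined, one = undefined,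
     zero = N, add = set_add M, smult = (\<lambda>a X. \<Union>x\<in>X. N +>\<^bsub>M\<^esub> (a \<odot>\<^bsub>M\<^esub> x))\<rparr>"

section \<open>Radical, top and socle\<close>

definition maximal_submodule :: "('a, 'r) ring_scheme \<Rightarrow> ('a, 'm) module \<Rightarrow> 'm set \<Rightarrow> bool" where
  "maximal_submodule A M U \<longleftrightarrow> submodule U A M \<and> U \<noteq> carrier M
     \<and> (\<forall>N. submodule N A M \<and> U \<subseteq> N \<longrightarrow> N = U \<or> N = carrier M)"

definition simple_submodule :: "('a, 'r) ring_scheme \<Rightarrow> ('a, 'm) module \<Rightarrow> 'm set \<Rightarrow> bool" where
  "simple_submodule A M S \<longleftrightarrow> submodule S A M \<and> S \<noteq> {\<zero>\<^bsub>M\<^esub>}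
     \<and> (\<forall>N. submodule N A M \<and> N \<subseteq> S \<longrightarrow> N = {\<zero>\<^bsub>M\<^esub>} \<or> N = S)"

definition module_rad :: "('a, 'r) ring_scheme \<Rightarrow> ('a, 'm) module \<Rightarrow> 'm set" where
  "module_rad A M = carrier M \<inter> \<Inter> {U. maximal_submodule A M U}"

definition module_top :: "('a, 'r) ring_scheme \<Rightarrow> ('a, 'm) module \<Rightarrow> ('a, 'm set) module" where
  "module_top A M = quotient_module M (module_rad A M)"

text \<open>The sum of all simple submodules, that is, the least submodule containing them.\<close>

definition module_soc :: "('a, 'r) ring_scheme \<Rightarrow> ('a, 'm) module \<Rightarrow> 'm set" where
  "module_soc A M = \<Inter> {N. submodule N A M \<and> (\<forall>S. simple_submodule A M S \<longrightarrow> S \<subseteq> N)}"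

section \<open>Artin algebras and the Nakayama functor\<close>

definition artinian_ring :: "('r, 's) ring_scheme \<Rightarrow> bool" where
  "artinian_ring R \<longleftrightarrow> ring R
     \<and> (\<forall>I :: nat \<Rightarrow> 'r set. (\<forall>n. ideal (I n) R) \<and> (\<forall>n. I (Suc n) \<subseteq> I n)
          \<longrightarrow> (\<exists>n. \<forall>m\<ge>n. I m = I n))"

text \<open>The \<open>R\<close>-algebra structure on \<open>\<Lambda>\<close> is carried by the \<open>smult\<close> field of \<open>\<Lambda>\<close>.\<close>

definition artin_algebra :: "('r, 's) ring_scheme \<Rightarrow> ('r, 'l) module \<Rightarrow> bool" where
  "artin_algebra R \<Lambda> \<longleftrightarrow> cring R \<and> artinian_ring R \<and> ring \<Lambda> \<and> module R \<Lambda>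
     \<and> (\<forall>r\<in>carrier R. \<forall>x\<in>carrier \<Lambda>. \<forall>y\<in>carrier \<Lambda>.
          (r \<odot>\<^bsub>\<Lambda>\<^esub> x) \<otimes>\<^bsub>\<Lambda>\<^esub> y = r \<odot>\<^bsub>\<Lambda>\<^esub> (x \<otimes>\<^bsub>\<Lambda>\<^esub> y)
          \<and> x \<otimes>\<^bsub>\<Lambda>\<^esub> (r \<odot>\<^bsub>\<Lambda>\<^esub> y) = r \<odot>\<^bsub>\<Lambda>\<^esub> (x \<otimes>\<^bsub>\<Lambda>\<^esub> y))
     \<and> finitely_generated R \<Lambda>"

text \<open>
  \<open>Hom\<^sub>A(M, A)\<close> for a right module \<open>M\<close>. It is a left \<open>A\<close>-module, and here \<open>a \<odot> \<phi>\<close> is the left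
  action \<open>(a \<phi>)(x) = a \<phi>(x)\<close>.
\<close>

definition hom_to_ring :: "('a, 'r) ring_scheme \<Rightarrow> ('a, 'm) module \<Rightarrow> ('a, 'm \<Rightarrow> 'a) module" where
  "hom_to_ring A M = \<lparr>carrier = mod_hom A M (regular_module A) \<inter> extensional (carrier M),
     mult = undefined, one = undefined,
     zero = (\<lambda>x\<in>carrier M. \<zero>\<^bsub>A\<^esub>),
     add = (\<lambda>\<phi> \<psi>. \<lambda>x\<in>carrier M. \<phi> x \<oplus>\<^bsub>A\<^esub> \<psi> x),
     smult = (\<lambda>a \<phi>. \<lambda>x\<in>carrier M. a \<otimes>\<^bsub>A\<^esub> \<phi> x)\<rparr>"

text \<open>The \<open>R\<close>-module underlying a \<open>\<Lambda>\<close>-module.\<close>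

definition restrict_scalars :: "('r, 'l) module \<Rightarrow> ('l, 'm) module \<Rightarrow> ('r, 'm) module" where
  "restrict_scalars \<Lambda> N = \<lparr>carrier = carrier N, mult = undefined, one = undefined,
     zero = \<zero>\<^bsub>N\<^esub>, add = add N, smult = (\<lambda>r x. (r \<odot>\<^bsub>\<Lambda>\<^esub> \<one>\<^bsub>\<Lambda>\<^esub>) \<odot>\<^bsub>N\<^esub> x)\<rparr>"

text \<open>
  \<open>D N = Hom\<^sub>R(N, J)\<close> for a left \<open>\<Lambda>\<close>-module \<open>N\<close>, as a right \<open>\<Lambda>\<close>-module: \<open>(\<psi> \<cdot> a)(x) = \<psi>(a x)\<close>.
  It is the standard duality when \<open>J\<close> is the injective envelope of \<open>R / rad R\<close>, see below.
\<close>

definition dual_module ::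
    "('r, 's) ring_scheme \<Rightarrow> ('r, 'j) module \<Rightarrow> ('r, 'l) module \<Rightarrow> ('l, 'm) module
      \<Rightarrow> ('l, 'm \<Rightarrow> 'j) module" where
  "dual_module R J \<Lambda> N = \<lparr>carrier = mod_hom R (restrict_scalars \<Lambda> N) J \<inter> extensional (carrier N),
     mult = undefined, one = undefined,
     zero = (\<lambda>x\<in>carrier N. \<zero>\<^bsub>J\<^esub>),
     add = (\<lambda>\<phi> \<psi>. \<lambda>x\<in>carrier N. \<phi> x \<oplus>\<^bsub>J\<^esub> \<psi> x),
     smult = (\<lambda>a \<psi>. \<lambda>x\<in>carrier N. \<psi> (a \<odot>\<^bsub>N\<^esub> x))\<rparr>"

text \<open>
  \<open>rad R\<close> is the intersection of the maximal ideals of \<open>R\<close>, so that \<open>R / rad R\<close> is the top of the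
  regular module.
\<close>

definition dualizing_module :: "('r, 's) ring_scheme \<Rightarrow> ('r, 'j) module \<Rightarrow> bool" where
  "dualizing_module R J \<longleftrightarrow> injective_envelope R (module_top R (regular_module R)) J"

definition nakayama ::
    "('r, 's) ring_scheme \<Rightarrow> ('r, 'j) module \<Rightarrow> ('r, 'l) module \<Rightarrow> ('l, 'm) module
      \<Rightarrow> ('l, ('m \<Rightarrow> 'l) \<Rightarrow> 'j) module" where
  "nakayama R J \<Lambda> M = dual_module R J \<Lambda> (hom_to_ring \<Lambda> M)"

text \<open>
  \<open>\<alpha>\<close> is the composite of the canonical epimorphism \<open>P \<rightarrow> top P\<close>, some isomorphism
  \<open>h : top P \<rightarrow> soc Q\<close>, and the inclusion \<open>soc Q \<rightarrow> Q\<close>; it is used with \<open>Q = \<nu> P\<close>.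
\<close>

definition top_to_socle_map ::
    "('a, 'r) ring_scheme \<Rightarrow> ('a, 'm) module \<Rightarrow> ('a, 'n) module \<Rightarrow> ('m \<Rightarrow> 'n) \<Rightarrow> bool" where
  "top_to_socle_map A P Q \<alpha> \<longleftrightarrow>
     (\<exists>h. h \<in> mod_hom A (module_top A P) (Q\<lparr>carrier := module_soc A Q\<rparr>)
        \<and> bij_betw h (carrier (module_top A P)) (module_soc A Q)
        \<and> (\<forall>x\<in>carrier P. \<alpha> x = h (module_rad A P +>\<^bsub>P\<^esub> x)))"

section \<open>The morphism category and its subcategory of morphisms between projectives\<close>

record ('a, 'x, 'y) arrow =
  src :: "('a, 'x) module"
  tgt :: "('a, 'y) module"
  arr :: "'x \<Rightarrow> 'y"

definition H_obj :: "('a, 'r) ring_scheme \<Rightarrow> ('a, 'x, 'y) arrow \<Rightarrow> bool" where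
  "H_obj A F \<longleftrightarrow> fg_module A (src F) \<and> fg_module A (tgt F) \<and> arr F \<in> mod_hom A (src F) (tgt F)"

definition H_hom ::
    "('a, 'r) ring_scheme \<Rightarrow> ('a, 'x, 'y) arrow \<Rightarrow> ('a, 'x', 'y') arrow
      \<Rightarrow> (('x \<Rightarrow> 'x') \<times> ('y \<Rightarrow> 'y')) set" where
  "H_hom A F G = {(\<sigma>\<^sub>1, \<sigma>\<^sub>2). \<sigma>\<^sub>1 \<in> mod_hom A (src F) (src G) \<and> \<sigma>\<^sub>2 \<in> mod_hom A (tgt F) (tgt G)
     \<and> (\<forall>x\<in>carrier (src F). \<sigma>\<^sub>2 (arr F x) = arr G (\<sigma>\<^sub>1 x))}"

definition H_comp ::
    "('x' \<Rightarrow> 'x'') \<times> ('y' \<Rightarrow> 'y'') \<Rightarrow> ('x \<Rightarrow> 'x') \<times> ('y \<Rightarrow> 'y')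
      \<Rightarrow> ('x \<Rightarrow> 'x'') \<times> ('y \<Rightarrow> 'y'')" where
  "H_comp \<tau> \<sigma> = (fst \<tau> \<circ> fst \<sigma>, snd \<tau> \<circ> snd \<sigma>)"

text \<open>Equality of morphisms with source \<open>F\<close>.\<close>

definition H_eq ::
    "('a, 'x, 'y) arrow \<Rightarrow> ('x \<Rightarrow> 'x') \<times> ('y \<Rightarrow> 'y') \<Rightarrow> ('x \<Rightarrow> 'x') \<times> ('y \<Rightarrow> 'y') \<Rightarrow> bool" where
  "H_eq F \<sigma> \<tau> \<longleftrightarrow> (\<forall>x\<in>carrier (src F). fst \<sigma> x = fst \<tau> x)
     \<and> (\<forall>y\<in>carrier (tgt F). snd \<sigma> y = snd \<tau> y)"

definition H_short_exact ::
    "('a, 'r) ring_scheme \<Rightarrow> ('a, 'x, 'y) arrow \<Rightarrow> ('x \<Rightarrow> 'x') \<times> ('y \<Rightarrow> 'y')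
      \<Rightarrow> ('a, 'x', 'y') arrow \<Rightarrow> ('x' \<Rightarrow> 'x'') \<times> ('y' \<Rightarrow> 'y'') \<Rightarrow> ('a, 'x'', 'y'') arrow \<Rightarrow> bool"
  where
  "H_short_exact A F \<phi> G \<psi> K \<longleftrightarrow> H_obj A F \<and> H_obj A G \<and> H_obj A K
     \<and> \<phi> \<in> H_hom A F G \<and> \<psi> \<in> H_hom A G K
     \<and> short_exact A (src F) (fst \<phi>) (src G) (fst \<psi>) (src K)
     \<and> short_exact A (tgt F) (snd \<phi>) (tgt G) (snd \<psi>) (tgt K)"

definition H_split_mono ::
    "('a, 'r) ring_scheme \<Rightarrow> ('a, 'x, 'y) arrow \<Rightarrow> ('a, 'x', 'y') arrow
      \<Rightarrow> ('x \<Rightarrow> 'x') \<times> ('y \<Rightarrow> 'y') \<Rightarrow> bool" where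
  "H_split_mono A F G \<phi> \<longleftrightarrow> \<phi> \<in> H_hom A F G \<and> (\<exists>\<rho>\<in>H_hom A G F. H_eq F (H_comp \<rho> \<phi>) (id, id))"

definition H_split_epi ::
    "('a, 'r) ring_scheme \<Rightarrow> ('a, 'x, 'y) arrow \<Rightarrow> ('a, 'x', 'y') arrow
      \<Rightarrow> ('x \<Rightarrow> 'x') \<times> ('y \<Rightarrow> 'y') \<Rightarrow> bool" where
  "H_split_epi A F G \<psi> \<longleftrightarrow> \<psi> \<in> H_hom A F G \<and> (\<exists>\<rho>\<in>H_hom A G F. H_eq G (H_comp \<psi> \<rho>) (id, id))"

text \<open>\<open>P_obj\<close> singles out the objects of the full subcategory \<open>\<P>(A)\<close>.\<close>

definition P_obj :: "('a, 'r) ring_scheme \<Rightarrow> ('a, 'x, 'y) arrow \<Rightarrow> bool" where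
  "P_obj A F \<longleftrightarrow> H_obj A F \<and> projective_module A (src F) \<and> projective_module A (tgt F)"

text \<open>
  A term cannot quantify over the objects of \<open>\<P>(A)\<close> on all types. The parameter of type
  \<open>('u \<times> 'v) itself\<close> fixes the types carrying the test objects \<open>X\<^sub>1 \<rightarrow> X\<^sub>2\<close>; in a theorem
  \<open>'u\<close> and \<open>'v\<close> are to be left as type variables, so that all test objects are covered.
\<close>

definition P_left_almost_split ::
    "('u \<times> 'v) itself \<Rightarrow> ('a, 'r) ring_scheme \<Rightarrow> ('a, 'x, 'y) arrow \<Rightarrow> ('a, 'x', 'y') arrow
      \<Rightarrow> ('x \<Rightarrow> 'x') \<times> ('y \<Rightarrow> 'y') \<Rightarrow> bool" where
  "P_left_almost_split _ A F G \<phi> \<longleftrightarrow> P_obj A F \<and> P_obj A G \<and> \<phi> \<in> H_hom A F G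
     \<and> \<not> H_split_mono A F G \<phi>
     \<and> (\<forall>(X :: ('a, 'u, 'v) arrow) \<theta>.
          P_obj A X \<and> \<theta> \<in> H_hom A F X \<and> \<not> H_split_mono A F X \<theta>
          \<longrightarrow> (\<exists>\<theta>'\<in>H_hom A G X. H_eq F (H_comp \<theta>' \<phi>) \<theta>))"

definition P_right_almost_split ::
    "('u \<times> 'v) itself \<Rightarrow> ('a, 'r) ring_scheme \<Rightarrow> ('a, 'x, 'y) arrow \<Rightarrow> ('a, 'x', 'y') arrow
      \<Rightarrow> ('x \<Rightarrow> 'x') \<times> ('y \<Rightarrow> 'y') \<Rightarrow> bool" where
  "P_right_almost_split _ A G K \<psi> \<longleftrightarrow> P_obj A G \<and> P_obj A K \<and> \<psi> \<in> H_hom A G K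
     \<and> \<not> H_split_epi A G K \<psi>
     \<and> (\<forall>(X :: ('a, 'u, 'v) arrow) \<theta>.
          P_obj A X \<and> \<theta> \<in> H_hom A X K \<and> \<not> H_split_epi A X K \<theta>
          \<longrightarrow> (\<exists>\<theta>'\<in>H_hom A X G. H_eq X (H_comp \<psi> \<theta>') \<theta>))"

definition P_almost_split_sequence ::
    "('u \<times> 'v) itself \<Rightarrow> ('a, 'r) ring_scheme
      \<Rightarrow> ('a, 'x, 'y) arrow \<Rightarrow> ('x \<Rightarrow> 'x') \<times> ('y \<Rightarrow> 'y')
      \<Rightarrow> ('a, 'x', 'y') arrow \<Rightarrow> ('x' \<Rightarrow> 'x'') \<times> ('y' \<Rightarrow> 'y'')
      \<Rightarrow> ('a, 'x'', 'y'') arrow \<Rightarrow> bool" where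
  "P_almost_split_sequence U A F \<phi> G \<psi> K \<longleftrightarrow>
     P_obj A F \<and> P_obj A G \<and> P_obj A K \<and> H_short_exact A F \<phi> G \<psi> K
     \<and> P_left_almost_split U A F G \<phi> \<and> P_right_almost_split U A G K \<psi>"

end

theory Submission
  imports Defs "HOL-Library.Nat_Bijection"
begin

text \<open>
  Fix a dual basis \<open>b, \<phi>\<^sub>b\<close> of \<open>P\<close>. A homomorphism \<open>\<beta> : X \<rightarrow> \<nu> P\<close> is determined by the functional
  \<open>t \<mapsto> \<Sum>\<^sub>b \<beta> (t b) \<phi>\<^sub>b\<close> on \<open>Hom(P, X)\<close>, so by injectivity of \<open>J\<close> it factors through \<open>x : X \<rightarrow> Y\<close> once
  this functional vanishes on the kernel of \<open>Hom(P, X) \<rightarrow> Hom(P, Y)\<close>. For \<open>\<beta> = \<alpha> u\<close> with \<open>u : X \<rightarrow> P\<close> this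
  holds exactly because \<open>(u, 0)\<close> is not a split epimorphism onto \<open>P \<rightarrow> 0\<close>: for \<open>x t = 0\<close> the endomorphism
  \<open>u t\<close> is not surjective, hence maps into \<open>rad P\<close>, which \<open>\<alpha>\<close> kills. Lifting the resulting
  \<open>Y \<rightarrow> \<nu> P\<close> through the projective presentation gives the right almost split property.
  The left almost split property follows by applying it to a pushout; the endomorphism of
  \<open>P\<^sub>1 \<rightarrow> P\<^sub>0\<close> that arises induces an endomorphism of \<open>\<nu> P\<close> that is the identity on the socle,
  so it is invertible.
\<close>

text \<open>The functional is the one attached to \<beta> by the isomorphism between Hom(X, \<nu> P)
  and D Hom(P, X), valid for finitely generated projective P. In the other direction a functional is
  evaluated at the maps sending p to the multiple of a fixed element by \<eta>(p), for \<eta> in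
  Hom(P, \<Lambda>).

  The obstacle is that injectivity of \<open>J\<close> is stated only for test modules on the type
  of sets of sequences in \<open>R\<close>. Sets of homomorphisms are not of that kind, but tuples
  in a finite power of a finitely generated module can be coded there. Hence the embeddings by
  coefficient families, and hence the recording of homomorphisms by their values on the dual basis.

  Indecomposability of P enters through one fact: every proper submodule lies in rad P. So an
  endomorphism of P is either onto, and then splits, or is killed by \<alpha>. The chain condition
  inherited from \<open>R\<close> supports this fact and the invertibility of the endomorphism of
  \<nu> P.

  That \<nu> P is a module is obtained from the surjection \<sigma>, along which the axioms are
  transported from \<open>P\<^sub>0\<close>.\<close>

section \<open>Submodules and homomorphisms\<close>

context right_module
begin

lemma smult_zero_right:
  assumes "a \<in> carrier A"
  shows "a \<odot>\<^bsub>M\<^esub> \<zero>\<^bsub>M\<^esub> = \<zero>\<^bsub>M\<^esub>"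
  using assms smult_closed[OF assms M.zero_closed] smult_distr_module[OF assms M.zero_closed M.zero_closed]
  by (metis M.add.r_cancel_one M.l_zero M.zero_closed)

lemma smult_zero_left:
  assumes "x \<in> carrier M"
  shows "\<zero>\<^bsub>A\<^esub> \<odot>\<^bsub>M\<^esub> x = \<zero>\<^bsub>M\<^esub>"
  using smult_closed[OF A.zero_closed assms] smult_distr_ring[OF A.zero_closed A.zero_closed assms]
  by (metis A.l_zero A.zero_closed M.add.r_cancel_one)

lemma smult_minus_one:
  assumes "x \<in> carrier M"
  shows "(\<ominus>\<^bsub>A\<^esub> \<one>\<^bsub>A\<^esub>) \<odot>\<^bsub>M\<^esub> x = \<ominus>\<^bsub>M\<^esub> x"
proof -
  have "(\<ominus>\<^bsub>A\<^esub> \<one>\<^bsub>A\<^esub>) \<odot>\<^bsub>M\<^esub> x \<oplus>\<^bsub>M\<^esub> x = \<zero>\<^bsub>M\<^esub>"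
    using smult_distr_ring[of "\<ominus>\<^bsub>A\<^esub> \<one>\<^bsub>A\<^esub>" "\<one>\<^bsub>A\<^esub>" x] assms
    by (simp add: smult_one smult_zero_left A.l_neg)
  then show ?thesis
    using assms smult_closed[of "\<ominus>\<^bsub>A\<^esub> \<one>\<^bsub>A\<^esub>" x] M.minus_equality by simp
qed

lemma smult_minus_right:
  assumes "a \<in> carrier A" "x \<in> carrier M"
  shows "a \<odot>\<^bsub>M\<^esub> (\<ominus>\<^bsub>M\<^esub> x) = \<ominus>\<^bsub>M\<^esub> (a \<odot>\<^bsub>M\<^esub> x)"
proof -
  have "a \<odot>\<^bsub>M\<^esub> (\<ominus>\<^bsub>M\<^esub> x) \<oplus>\<^bsub>M\<^esub> a \<odot>\<^bsub>M\<^esub> x = \<zero>\<^bsub>M\<^esub>"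
    using assms smult_distr_module[of a "\<ominus>\<^bsub>M\<^esub> x" x] by (simp add: M.l_neg smult_zero_right)
  then show ?thesis
    using assms smult_closed M.minus_equality by simp
qed

lemma add_minus_cancel:
  assumes "x \<in> carrier M" "y \<in> carrier M"
  shows "x \<oplus>\<^bsub>M\<^esub> (y \<ominus>\<^bsub>M\<^esub> x) = y" "(y \<ominus>\<^bsub>M\<^esub> x) \<oplus>\<^bsub>M\<^esub> x = y" "x \<ominus>\<^bsub>M\<^esub> x = \<zero>\<^bsub>M\<^esub>"
proof -
  show *: "(y \<ominus>\<^bsub>M\<^esub> x) \<oplus>\<^bsub>M\<^esub> x = y"
    using assms by (simp add: a_minus_def M.a_assoc M.l_neg)
  then show "x \<oplus>\<^bsub>M\<^esub> (y \<ominus>\<^bsub>M\<^esub> x) = y"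
    using assms M.a_comm[of x "y \<ominus>\<^bsub>M\<^esub> x"] by simp
  show "x \<ominus>\<^bsub>M\<^esub> x = \<zero>\<^bsub>M\<^esub>"
    using assms by (simp add: a_minus_def M.r_neg)
qed

lemma add_diff_cancel:
  assumes "x \<in> carrier M" "y \<in> carrier M"
  shows "(x \<oplus>\<^bsub>M\<^esub> y) \<ominus>\<^bsub>M\<^esub> y = x" "(x \<oplus>\<^bsub>M\<^esub> y) \<ominus>\<^bsub>M\<^esub> x = y"
proof -
  have *: "(x \<oplus>\<^bsub>M\<^esub> y) \<ominus>\<^bsub>M\<^esub> y = x" if "x \<in> carrier M" "y \<in> carrier M" for x y
    using that by (simp add: a_minus_def M.a_assoc M.r_neg)
  show "(x \<oplus>\<^bsub>M\<^esub> y) \<ominus>\<^bsub>M\<^esub> y = x" by (rule *[OF assms])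
  show "(x \<oplus>\<^bsub>M\<^esub> y) \<ominus>\<^bsub>M\<^esub> x = y"
    using *[OF assms(2,1)] M.a_comm[OF assms] by simp
qed

lemma minus_eq_zero_iff:
  assumes "x \<in> carrier M" "y \<in> carrier M"
  shows "x \<ominus>\<^bsub>M\<^esub> y = \<zero>\<^bsub>M\<^esub> \<longleftrightarrow> x = y"
  using add_minus_cancel[OF assms(2,1)] add_minus_cancel(3)[OF assms] assms by (metis M.l_zero)

text \<open>Negation is the action of minus one, so closure under negation comes from closure under
  scalars.\<close>

lemma submodule_intro:
  assumes "H \<subseteq> carrier M" "\<zero>\<^bsub>M\<^esub> \<in> H"
    and "\<And>x y. \<lbrakk>x \<in> H; y \<in> H\<rbrakk> \<Longrightarrow> x \<oplus>\<^bsub>M\<^esub> y \<in> H"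
    and "\<And>a x. \<lbrakk>a \<in> carrier A; x \<in> H\<rbrakk> \<Longrightarrow> a \<odot>\<^bsub>M\<^esub> x \<in> H"
  shows "submodule H A M"
proof -
  have "\<ominus>\<^bsub>M\<^esub> x \<in> H" if "x \<in> H" for x
    using assms(4)[of "\<ominus>\<^bsub>A\<^esub> \<one>\<^bsub>A\<^esub>" x] smult_minus_one[of x] that assms(1) by auto
  then show ?thesis
    using assms by unfold_locales (auto simp: a_inv_def[symmetric])
qed

lemma submodule_dest:
  assumes "submodule H A M"
  shows "H \<subseteq> carrier M" "\<zero>\<^bsub>M\<^esub> \<in> H"
    and "\<And>x y. \<lbrakk>x \<in> H; y \<in> H\<rbrakk> \<Longrightarrow> x \<oplus>\<^bsub>M\<^esub> y \<in> H"
    and "\<And>a x. \<lbrakk>a \<in> carrier A; x \<in> H\<rbrakk> \<Longrightarrow> a \<odot>\<^bsub>M\<^esub> x \<in> H"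
    and "\<And>x. x \<in> H \<Longrightarrow> \<ominus>\<^bsub>M\<^esub> x \<in> H"
    and "\<And>x y. \<lbrakk>x \<in> H; y \<in> H\<rbrakk> \<Longrightarrow> x \<ominus>\<^bsub>M\<^esub> y \<in> H"
proof -
  interpret H: submodule H A M by fact
  show "H \<subseteq> carrier M" using H.subset by simp
  show "\<zero>\<^bsub>M\<^esub> \<in> H" using H.one_closed by simp
  show add: "x \<oplus>\<^bsub>M\<^esub> y \<in> H" if "x \<in> H" "y \<in> H" for x y using H.m_closed that by simp
  show "a \<odot>\<^bsub>M\<^esub> x \<in> H" if "a \<in> carrier A" "x \<in> H" for a x using that by simp
  show inv: "\<ominus>\<^bsub>M\<^esub> x \<in> H" if "x \<in> H" for x
    using H.m_inv_closed[OF that] by (simp add: a_inv_def)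
  show "x \<ominus>\<^bsub>M\<^esub> y \<in> H" if "x \<in> H" "y \<in> H" for x y
    using add inv that by (simp add: a_minus_def)
qed

lemma submodule_carrier: "submodule (carrier M) A M"
  by (rule submodule_intro) (auto simp: smult_closed)

lemma submodule_zero: "submodule {\<zero>\<^bsub>M\<^esub>} A M"
  by (rule submodule_intro) (auto simp: smult_zero_right)

lemma submodule_Int:
  assumes "submodule U A M" "submodule V A M"
  shows "submodule (U \<inter> V) A M"
  using submodule_dest[OF assms(1)] submodule_dest[OF assms(2)]
  by (intro submodule_intro) auto

lemma set_add_iff: "x \<in> U <+>\<^bsub>M\<^esub> V \<longleftrightarrow> (\<exists>u\<in>U. \<exists>v\<in>V. x = u \<oplus>\<^bsub>M\<^esub> v)"
  by (auto simp: set_add_def')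

lemma set_add_commute:
  assumes "U \<subseteq> carrier M" "V \<subseteq> carrier M"
  shows "U <+>\<^bsub>M\<^esub> V = V <+>\<^bsub>M\<^esub> U"
  using assms M.a_comm unfolding set_eq_iff set_add_iff subset_iff by metis

lemma submodule_set_add:
  assumes "submodule U A M" "submodule V A M"
  shows "submodule (U <+>\<^bsub>M\<^esub> V) A M"
proof (rule submodule_intro)
  note U = submodule_dest[OF assms(1)] and V = submodule_dest[OF assms(2)]
  show "U <+>\<^bsub>M\<^esub> V \<subseteq> carrier M" using U(1) V(1) by (auto simp: set_add_iff subset_iff)
  show "\<zero>\<^bsub>M\<^esub> \<in> U <+>\<^bsub>M\<^esub> V" using U(2) V(2) by (auto simp: set_add_iff intro!: bexI)
  show "x \<oplus>\<^bsub>M\<^esub> y \<in> U <+>\<^bsub>M\<^esub> V" if xy: "x \<in> U <+>\<^bsub>M\<^esub> V" "y \<in> U <+>\<^bsub>M\<^esub> V" for x y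
  proof -
    obtain u v u' v' where *: "u \<in> U" "v \<in> V" "u' \<in> U" "v' \<in> V" "x = u \<oplus>\<^bsub>M\<^esub> v" "y = u' \<oplus>\<^bsub>M\<^esub> v'"
      using xy unfolding set_add_iff by auto
    have "x \<oplus>\<^bsub>M\<^esub> y = (u \<oplus>\<^bsub>M\<^esub> u') \<oplus>\<^bsub>M\<^esub> (v \<oplus>\<^bsub>M\<^esub> v')"
      using * U(1) V(1) by (simp add: subset_iff M.a_ac)
    then show ?thesis using * U(3) V(3) unfolding set_add_iff by blast
  qed
  show "a \<odot>\<^bsub>M\<^esub> x \<in> U <+>\<^bsub>M\<^esub> V" if "a \<in> carrier A" and x: "x \<in> U <+>\<^bsub>M\<^esub> V" for a x
  proof -
    obtain u v where *: "u \<in> U" "v \<in> V" "x = u \<oplus>\<^bsub>M\<^esub> v" using x unfolding set_add_iff by auto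
    then have "a \<odot>\<^bsub>M\<^esub> x = a \<odot>\<^bsub>M\<^esub> u \<oplus>\<^bsub>M\<^esub> a \<odot>\<^bsub>M\<^esub> v"
      using that U(1) V(1) by (simp add: subset_iff smult_distr_module)
    then show ?thesis using * that U(4) V(4) unfolding set_add_iff by blast
  qed
qed

lemma set_add_superset:
  assumes "submodule U A M" "submodule V A M"
  shows "U \<subseteq> U <+>\<^bsub>M\<^esub> V" "V \<subseteq> U <+>\<^bsub>M\<^esub> V"
proof -
  note U = submodule_dest[OF assms(1)] and V = submodule_dest[OF assms(2)]
  show "U \<subseteq> U <+>\<^bsub>M\<^esub> V"
  proof
    fix x assume "x \<in> U"
    moreover have "x = x \<oplus>\<^bsub>M\<^esub> \<zero>\<^bsub>M\<^esub>" using \<open>x \<in> U\<close> U(1) by auto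
    ultimately show "x \<in> U <+>\<^bsub>M\<^esub> V" using V(2) unfolding set_add_iff by blast
  qed
  show "V \<subseteq> U <+>\<^bsub>M\<^esub> V"
  proof
    fix x assume "x \<in> V"
    moreover have "x = \<zero>\<^bsub>M\<^esub> \<oplus>\<^bsub>M\<^esub> x" using \<open>x \<in> V\<close> V(1) by auto
    ultimately show "x \<in> U <+>\<^bsub>M\<^esub> V" using U(2) unfolding set_add_iff by blast
  qed
qed

lemma set_add_le:
  assumes "submodule W A M" "U \<subseteq> W" "V \<subseteq> W"
  shows "U <+>\<^bsub>M\<^esub> V \<subseteq> W"
  using submodule_dest(3)[OF assms(1)] assms(2,3) unfolding set_add_iff subset_iff by blast

lemma right_module_submodule:
  assumes "submodule H A M"
  shows "right_module A (M\<lparr>carrier := H\<rparr>)"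
proof -
  note H = submodule_dest[OF assms]
  have "abelian_group (M\<lparr>carrier := H\<rparr>)"
  proof (rule abelian_groupI, goal_cases)
    case (6 x)
    then show ?case using H(1,5) M.l_neg by (auto intro!: bexI[of _ "\<ominus>\<^bsub>M\<^esub> x"])
  qed (use H in \<open>auto simp: subset_iff M.a_ac\<close>)
  then show ?thesis
    using H A.ring_axioms
    by (intro right_module.intro right_module_axioms.intro)
      (auto simp: subset_iff smult_distr_ring smult_distr_module smult_assoc_right smult_one)
qed

end

section \<open>Homomorphisms, kernels and images\<close>

lemma mod_homI:
  assumes "\<And>x. x \<in> carrier M \<Longrightarrow> f x \<in> carrier N"
    and "\<And>x y. \<lbrakk>x \<in> carrier M; y \<in> carrier M\<rbrakk> \<Longrightarrow> f (x \<oplus>\<^bsub>M\<^esub> y) = f x \<oplus>\<^bsub>N\<^esub> f y"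
    and "\<And>a x. \<lbrakk>a \<in> carrier A; x \<in> carrier M\<rbrakk> \<Longrightarrow> f (a \<odot>\<^bsub>M\<^esub> x) = a \<odot>\<^bsub>N\<^esub> f x"
  shows "f \<in> mod_hom A M N"
  using assms by (auto simp: mod_hom_def)

lemma mod_homD:
  assumes "f \<in> mod_hom A M N"
  shows mod_hom_closed: "x \<in> carrier M \<Longrightarrow> f x \<in> carrier N"
    and mod_hom_add: "\<lbrakk>x \<in> carrier M; y \<in> carrier M\<rbrakk> \<Longrightarrow> f (x \<oplus>\<^bsub>M\<^esub> y) = f x \<oplus>\<^bsub>N\<^esub> f y"
    and mod_hom_smult: "\<lbrakk>a \<in> carrier A; x \<in> carrier M\<rbrakk> \<Longrightarrow> f (a \<odot>\<^bsub>M\<^esub> x) = a \<odot>\<^bsub>N\<^esub> f x"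
  using assms by (auto simp: mod_hom_def)

lemma mod_hom_comp:
  assumes "f \<in> mod_hom A L M" "g \<in> mod_hom A M N"
  shows "(\<lambda>x. g (f x)) \<in> mod_hom A L N"
  using mod_homD[OF assms(1)] mod_homD[OF assms(2)] by (intro mod_homI) auto

lemma mod_hom_id: "(\<lambda>x. x) \<in> mod_hom A M M"
  by (auto simp: mod_hom_def)

text \<open>Agreement on the carrier is enough because the carrier of a module is closed under its
  operations.\<close>

lemma mod_hom_cong:
  assumes "right_module A M" "f \<in> mod_hom A M N" "\<And>x. x \<in> carrier M \<Longrightarrow> f x = h x"
  shows "h \<in> mod_hom A M N"
proof -
  interpret right_module A M by fact
  show ?thesis
    using assms(2,3) smult_closed unfolding mod_hom_def by (auto simp: Pi_def)
qed

context
  fixes A M N f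
  assumes M: "right_module A M" and N: "right_module A N" and f: "f \<in> mod_hom A M N"
begin

interpretation M: right_module A M by (rule M)
interpretation N: right_module A N by (rule N)

lemma mod_hom_zero: "f \<zero>\<^bsub>M\<^esub> = \<zero>\<^bsub>N\<^esub>"
  using mod_hom_smult[OF f, of "\<zero>\<^bsub>A\<^esub>" "\<zero>\<^bsub>M\<^esub>"] mod_hom_closed[OF f, of "\<zero>\<^bsub>M\<^esub>"]
  by (simp add: M.smult_zero_left N.smult_zero_left)

lemma mod_hom_neg: "x \<in> carrier M \<Longrightarrow> f (\<ominus>\<^bsub>M\<^esub> x) = \<ominus>\<^bsub>N\<^esub> f x"
  using mod_hom_smult[OF f, of "\<ominus>\<^bsub>A\<^esub> \<one>\<^bsub>A\<^esub>" x] mod_hom_closed[OF f, of x]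
  by (simp add: M.smult_minus_one N.smult_minus_one)

lemma mod_hom_minus: "\<lbrakk>x \<in> carrier M; y \<in> carrier M\<rbrakk> \<Longrightarrow> f (x \<ominus>\<^bsub>M\<^esub> y) = f x \<ominus>\<^bsub>N\<^esub> f y"
  using mod_hom_add[OF f, of x "\<ominus>\<^bsub>M\<^esub> y"] mod_hom_neg by (simp add: a_minus_def)

lemma mod_hom_finsum:
  assumes "v \<in> I \<rightarrow> carrier M"
  shows "f (\<Oplus>\<^bsub>M\<^esub>i\<in>I. v i) = (\<Oplus>\<^bsub>N\<^esub>i\<in>I. f (v i))"
  using assms
proof (induction I rule: infinite_finite_induct)
  case (insert i I)
  then show ?case
    using mod_homD[OF f] by (simp add: M.M.finsum_insert N.M.finsum_insert Pi_def)
qed (simp_all add: mod_hom_zero)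

lemma submodule_image:
  assumes "submodule U A M"
  shows "submodule (f ` U) A N"
proof (rule N.submodule_intro)
  note U = M.submodule_dest[OF assms]
  show "f ` U \<subseteq> carrier N" using U(1) mod_hom_closed[OF f] by auto
  show "\<zero>\<^bsub>N\<^esub> \<in> f ` U" using U(2) mod_hom_zero by force
  show "x \<oplus>\<^bsub>N\<^esub> y \<in> f ` U" if xy: "x \<in> f ` U" "y \<in> f ` U" for x y
  proof -
    obtain u v where "u \<in> U" "v \<in> U" "x = f u" "y = f v" using xy by auto
    then have "x \<oplus>\<^bsub>N\<^esub> y = f (u \<oplus>\<^bsub>M\<^esub> v)" using mod_hom_add[OF f, of u v] U(1) by (simp add: subset_iff)
    then show ?thesis using U(3) \<open>u \<in> U\<close> \<open>v \<in> U\<close> by auto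
  qed
  show "a \<odot>\<^bsub>N\<^esub> x \<in> f ` U" if "a \<in> carrier A" and x: "x \<in> f ` U" for a x
  proof -
    obtain u where "u \<in> U" "x = f u" using x by auto
    then have "a \<odot>\<^bsub>N\<^esub> x = f (a \<odot>\<^bsub>M\<^esub> u)" using mod_hom_smult[OF f \<open>a \<in> carrier A\<close>] U(1) by auto
    then show ?thesis using U(4) \<open>u \<in> U\<close> that by auto
  qed
qed

lemma submodule_vimage:
  assumes "submodule U A N"
  shows "submodule {x \<in> carrier M. f x \<in> U} A M"
  using N.submodule_dest[OF assms] mod_homD[OF f]
  by (intro M.submodule_intro) (auto simp: mod_hom_zero M.smult_closed)

lemma submodule_mod_ker: "submodule (mod_ker M N f) A M"
  using submodule_vimage[OF N.submodule_zero] by (simp add: mod_ker_def)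

lemma inj_on_mod_homI:
  assumes "mod_ker M N f \<subseteq> {\<zero>\<^bsub>M\<^esub>}"
  shows "inj_on f (carrier M)"
proof (rule inj_onI)
  fix x y assume xy: "x \<in> carrier M" "y \<in> carrier M" "f x = f y"
  then have "f (x \<ominus>\<^bsub>M\<^esub> y) = \<zero>\<^bsub>N\<^esub>"
    using mod_hom_minus mod_hom_closed[OF f] by (simp add: a_minus_def N.M.r_neg)
  then have "x \<ominus>\<^bsub>M\<^esub> y = \<zero>\<^bsub>M\<^esub>" using assms xy by (auto simp: mod_ker_def)
  then show "x = y" using xy M.minus_eq_zero_iff by simp
qed

text \<open>Every element of \<open>M\<close> differs from an element of \<open>U\<close> by an
  element of the kernel, so \<open>U\<close> and the kernel span \<open>M\<close>. Surjectivity of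
  endomorphisms of a projective cover is detected in this way.\<close>

lemma superfluous_surj:
  assumes "superfluous_submodule A M (mod_ker M N f)" "submodule U A M" "f ` U = f ` carrier M"
  shows "U = carrier M"
proof -
  note U = M.submodule_dest[OF assms(2)] and K = M.submodule_dest[OF submodule_mod_ker]
  have "carrier M \<subseteq> U <+>\<^bsub>M\<^esub> mod_ker M N f"
  proof
    fix x assume x: "x \<in> carrier M"
    then obtain u where u: "u \<in> U" "f u = f x" using assms(3) by (metis imageE imageI)
    then have u': "u \<in> carrier M" using U(1) by auto
    have "f (x \<ominus>\<^bsub>M\<^esub> u) = \<zero>\<^bsub>N\<^esub>"
      using mod_hom_minus[OF x u'] u mod_hom_closed[OF f x] by (simp add: a_minus_def N.M.r_neg)
    then have "x \<ominus>\<^bsub>M\<^esub> u \<in> mod_ker M N f" using x u' by (simp add: mod_ker_def)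
    moreover have "x = u \<oplus>\<^bsub>M\<^esub> (x \<ominus>\<^bsub>M\<^esub> u)"
      using x u' by (simp add: M.add_minus_cancel)
    ultimately show "x \<in> U <+>\<^bsub>M\<^esub> mod_ker M N f" using u M.set_add_iff by blast
  qed
  then have "U <+>\<^bsub>M\<^esub> mod_ker M N f = carrier M"
    using M.set_add_le[OF M.submodule_carrier U(1) K(1)] by auto
  then show ?thesis using assms(1,2) unfolding superfluous_submodule_def by blast
qed

end

lemma mod_hom_zero_map:
  assumes "right_module A N"
  shows "(\<lambda>x. \<zero>\<^bsub>N\<^esub>) \<in> mod_hom A M N"
proof -
  interpret right_module A N by fact
  show ?thesis by (rule mod_homI) (auto simp: smult_zero_right)
qed

lemma mod_hom_pointwise_add:
  assumes "right_module A N" "f \<in> mod_hom A M N" "h \<in> mod_hom A M N"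
  shows "(\<lambda>x. f x \<oplus>\<^bsub>N\<^esub> h x) \<in> mod_hom A M N"
proof -
  interpret right_module A N by fact
  show ?thesis using mod_homD[OF assms(2)] mod_homD[OF assms(3)]
    by (intro mod_homI) (auto simp: M.a_ac smult_distr_module)
qed

lemma mod_hom_pointwise_minus:
  assumes "right_module A M" "right_module A N" "f \<in> mod_hom A M N" "h \<in> mod_hom A M N"
  shows "(\<lambda>x. f x \<ominus>\<^bsub>N\<^esub> h x) \<in> mod_hom A M N"
proof -
  interpret M: right_module A M by fact
  interpret N: right_module A N by fact
  show ?thesis using mod_homD[OF assms(3)] mod_homD[OF assms(4)]
    by (intro mod_homI)
      (auto simp: a_minus_def N.M.a_ac N.M.minus_add N.smult_distr_module N.smult_minus_right)
qed

text \<open>The equalizer of \<open>f\<close> and \<open>h\<close> is a submodule containing the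
  generators.\<close>

lemma mod_hom_eqI:
  assumes "right_module A M" "right_module A N" "f \<in> mod_hom A M N" "h \<in> mod_hom A M N"
    and B: "\<forall>N. submodule N A M \<and> B \<subseteq> N \<longrightarrow> N = carrier M" "B \<subseteq> carrier M"
    and eq: "\<And>b. b \<in> B \<Longrightarrow> f b = h b" and x: "x \<in> carrier M"
  shows "f x = h x"
proof -
  interpret M: right_module A M by fact
  interpret N: right_module A N by fact
  have "submodule {x \<in> carrier M. f x = h x} A M"
    using mod_homD[OF assms(3)] mod_homD[OF assms(4)]
      mod_hom_zero[OF assms(1-3)] mod_hom_zero[OF assms(1,2,4)]
    by (intro M.submodule_intro) (auto simp: M.smult_closed)
  then have "{x \<in> carrier M. f x = h x} = carrier M" using B eq by blast
  then show ?thesis using x by blast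
qed

lemma mod_hom_inverse:
  assumes "f \<in> mod_hom A M N" "bij_betw f (carrier M) (carrier N)" "right_module A M"
  shows "the_inv_into (carrier M) f \<in> mod_hom A N M"
proof -
  interpret M: right_module A M by fact
  let ?h = "the_inv_into (carrier M) f"
  have inj: "inj_on f (carrier M)" and im: "f ` carrier M = carrier N"
    using assms(2) by (auto simp: bij_betw_def)
  have h: "?h y \<in> carrier M" "f (?h y) = y" if "y \<in> carrier N" for y
    using that the_inv_into_into[OF inj, of y "carrier M"] f_the_inv_into_f[OF inj, of y] im by auto
  have hf: "?h (f x) = x" if "x \<in> carrier M" for x using the_inv_into_f_f[OF inj that] .
  show ?thesis
  proof (rule mod_homI)
    show "?h (x \<oplus>\<^bsub>N\<^esub> y) = ?h x \<oplus>\<^bsub>M\<^esub> ?h y" if "x \<in> carrier N" "y \<in> carrier N" for x y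
      using hf[of "?h x \<oplus>\<^bsub>M\<^esub> ?h y"] mod_hom_add[OF assms(1), of "?h x" "?h y"] h that by simp
    show "?h (a \<odot>\<^bsub>N\<^esub> x) = a \<odot>\<^bsub>M\<^esub> ?h x" if "a \<in> carrier A" "x \<in> carrier N" for a x
      using hf[of "a \<odot>\<^bsub>M\<^esub> ?h x"] mod_hom_smult[OF assms(1), of a "?h x"] h that
      by (simp add: M.smult_closed)
  qed (use h in auto)
qed

text \<open>The \<open>zero\<close> field of \<open>N\<close> is a priori unrelated to its addition, hence the last hypothesis.\<close>

lemma right_module_image:
  assumes "right_module A M" "f \<in> mod_hom A M N" "f ` carrier M = carrier N" "f \<zero>\<^bsub>M\<^esub> = \<zero>\<^bsub>N\<^esub>"
  shows "right_module A N"
proof -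
  interpret M: right_module A M by fact
  note f = mod_homD[OF assms(2)]
  have add: "f x \<oplus>\<^bsub>N\<^esub> f y = f (x \<oplus>\<^bsub>M\<^esub> y)" if "x \<in> carrier M" "y \<in> carrier M" for x y
    using f(2) that by simp
  have smult: "a \<odot>\<^bsub>N\<^esub> f x = f (a \<odot>\<^bsub>M\<^esub> x)" if "a \<in> carrier A" "x \<in> carrier M" for a x
    using f(3) that by simp
  have neg: "\<exists>y\<in>f ` carrier M. y \<oplus>\<^bsub>N\<^esub> x = f \<zero>\<^bsub>M\<^esub>" if x: "x \<in> f ` carrier M" for x
  proof -
    obtain u where u: "u \<in> carrier M" "x = f u" using x by auto
    then have "f (\<ominus>\<^bsub>M\<^esub> u) \<oplus>\<^bsub>N\<^esub> x = f \<zero>\<^bsub>M\<^esub>" by (simp add: add M.M.l_neg)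
    then show ?thesis using u by blast
  qed
  have "abelian_group N"
    by (rule abelian_groupI, unfold assms(3,4)[symmetric])
      (use neg in \<open>auto simp: add M.M.a_ac\<close>)
  moreover have "right_module_axioms A N"
    unfolding right_module_axioms_def assms(3)[symmetric]
    by (auto simp: add smult M.smult_closed M.smult_distr_ring M.smult_distr_module
        M.smult_assoc_right M.smult_one)
  ultimately show ?thesis using M.A.ring_axioms by (simp add: right_module_def)
qed

section \<open>Generators\<close>

lemma (in right_module) smult_finsum:
  assumes "a \<in> carrier A" "v \<in> I \<rightarrow> carrier M"
  shows "a \<odot>\<^bsub>M\<^esub> (\<Oplus>\<^bsub>M\<^esub>i\<in>I. v i) = (\<Oplus>\<^bsub>M\<^esub>i\<in>I. a \<odot>\<^bsub>M\<^esub> v i)"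
  using assms(2)
proof (induction I rule: infinite_finite_induct)
  case (insert i I)
  then show ?case
    using assms(1) by (simp add: M.finsum_insert Pi_def smult_closed smult_distr_module)
qed (simp_all add: smult_zero_right assms(1))

definition generates :: "('a, 'r) ring_scheme \<Rightarrow> ('a, 'm) module \<Rightarrow> 'm set \<Rightarrow> bool" where
  "generates A M B \<longleftrightarrow> B \<subseteq> carrier M \<and> (\<forall>N. submodule N A M \<and> B \<subseteq> N \<longrightarrow> N = carrier M)"

lemma generatesD:
  assumes "generates A M B" "submodule N A M" "B \<subseteq> N"
  shows "N = carrier M"
  using assms by (simp add: generates_def)

text \<open>The combinations of elements of \<open>B\<close> form a submodule containing
  \<open>B\<close>.\<close>

lemma generates_coefficients:
  assumes "right_module A M" "generates A M B" "finite B" "x \<in> carrier M"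
  shows "\<exists>v\<in>B \<rightarrow> carrier A. x = (\<Oplus>\<^bsub>M\<^esub>b\<in>B. v b \<odot>\<^bsub>M\<^esub> b)"
proof -
  interpret right_module A M by fact
  have B: "B \<subseteq> carrier M" using assms(2) by (simp add: generates_def)
  let ?s = "\<lambda>v. \<Oplus>\<^bsub>M\<^esub>b\<in>B. v b \<odot>\<^bsub>M\<^esub> b"
  have summand: "(\<lambda>b. v b \<odot>\<^bsub>M\<^esub> b) \<in> B \<rightarrow> carrier M" if "v \<in> B \<rightarrow> carrier A" for v
    using that B by (auto simp: smult_closed Pi_def subset_iff)
  let ?S = "?s ` (B \<rightarrow> carrier A)"
  have "submodule ?S A M"
  proof (rule submodule_intro)
    show "?S \<subseteq> carrier M" using summand by (auto intro!: M.finsum_closed)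
    have "?s (\<lambda>_. \<zero>\<^bsub>A\<^esub>) = (\<Oplus>\<^bsub>M\<^esub>b\<in>B. \<zero>\<^bsub>M\<^esub>)"
      using B by (intro M.finsum_cong') (auto simp: smult_zero_left)
    then show "\<zero>\<^bsub>M\<^esub> \<in> ?S" by (intro image_eqI[of _ _ "\<lambda>_. \<zero>\<^bsub>A\<^esub>"]) auto
    show "x \<oplus>\<^bsub>M\<^esub> y \<in> ?S" if xy: "x \<in> ?S" "y \<in> ?S" for x y
    proof -
      obtain v w where vw: "v \<in> B \<rightarrow> carrier A" "w \<in> B \<rightarrow> carrier A" "x = ?s v" "y = ?s w" using xy by auto
      have "?s (\<lambda>b. v b \<oplus>\<^bsub>A\<^esub> w b) = (\<Oplus>\<^bsub>M\<^esub>b\<in>B. v b \<odot>\<^bsub>M\<^esub> b \<oplus>\<^bsub>M\<^esub> w b \<odot>\<^bsub>M\<^esub> b)"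
        using B summand vw(1,2)
        by (intro M.finsum_cong') (auto simp: smult_distr_ring Pi_def subset_iff smult_closed)
      also have "\<dots> = x \<oplus>\<^bsub>M\<^esub> y" using summand vw by (simp add: M.finsum_addf)
      finally show ?thesis using vw(1,2) by (intro image_eqI[of _ _ "\<lambda>b. v b \<oplus>\<^bsub>A\<^esub> w b"]) auto
    qed
    show "a \<odot>\<^bsub>M\<^esub> x \<in> ?S" if a: "a \<in> carrier A" and x: "x \<in> ?S" for a x
    proof -
      obtain v where v: "v \<in> B \<rightarrow> carrier A" "x = ?s v" using x by auto
      have "a \<odot>\<^bsub>M\<^esub> x = (\<Oplus>\<^bsub>M\<^esub>b\<in>B. a \<odot>\<^bsub>M\<^esub> (v b \<odot>\<^bsub>M\<^esub> b))"
        using v summand a by (simp add: smult_finsum)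
      also have "\<dots> = ?s (\<lambda>b. v b \<otimes>\<^bsub>A\<^esub> a)"
        using v(1) a B by (intro M.finsum_cong') (auto simp: smult_assoc_right smult_closed Pi_def subset_iff)
      finally show ?thesis using v(1) a by (intro image_eqI[of _ _ "\<lambda>b. v b \<otimes>\<^bsub>A\<^esub> a"]) auto
    qed
  qed
  moreover have "B \<subseteq> ?S"
  proof
    fix c assume c: "c \<in> B"
    \<comment> \<open>The Kronecker family at \<open>c\<close> exhibits the generator
      \<open>c\<close> as a combination.\<close>
    have "?s (\<lambda>b. if c = b then \<one>\<^bsub>A\<^esub> else \<zero>\<^bsub>A\<^esub>) = (\<Oplus>\<^bsub>M\<^esub>b\<in>B. if c = b then b else \<zero>\<^bsub>M\<^esub>)"
      using B by (intro M.finsum_cong') (auto simp: smult_zero_left smult_one)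
    also have "\<dots> = c" using M.finsum_singleton[OF c assms(3), of "\<lambda>b. b"] B by auto
    finally show "c \<in> ?S" by (intro image_eqI[of _ _ "\<lambda>b. if c = b then \<one>\<^bsub>A\<^esub> else \<zero>\<^bsub>A\<^esub>"]) auto
  qed
  ultimately have "?S = carrier M" using assms(2) by (simp add: generates_def)
  then show ?thesis using assms(4) by blast
qed

lemma fg_moduleE:
  assumes "fg_module A M"
  obtains B where "right_module A M" "finite B" "generates A M B"
  using assms unfolding fg_module_def finitely_generated_def generates_def by blast

lemma fg_moduleI:
  assumes "right_module A M" "finite B" "generates A M B"
  shows "fg_module A M"
  using assms unfolding fg_module_def finitely_generated_def generates_def by blast

text \<open>A chosen coefficient family determines its element, and an enumeration of the finite
  generating set turns families into sequences. Through such codes a finitely generated module on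
  any type can play the role of a test module.\<close>

lemma fg_module_embedding:
  fixes A :: "('a, 'r) ring_scheme" and M :: "('a, 'm) module"
  assumes "fg_module A M"
  shows "\<exists>c :: 'm \<Rightarrow> nat \<Rightarrow> 'a. inj_on c (carrier M)"
proof -
  obtain B where B: "right_module A M" "finite B" "generates A M B"
    using fg_moduleE[OF assms] .
  interpret right_module A M by fact
  obtain v where v: "\<And>x. x \<in> carrier M \<Longrightarrow> v x \<in> B \<rightarrow> carrier A"
    "\<And>x. x \<in> carrier M \<Longrightarrow> x = (\<Oplus>\<^bsub>M\<^esub>b\<in>B. v x b \<odot>\<^bsub>M\<^esub> b)"
    using generates_coefficients[OF B(1,3,2)] by metis
  obtain h where h: "bij_betw h {0..<card B} B" using ex_bij_betw_nat_finite[OF B(2)] ..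
  have "inj_on (\<lambda>x k. v x (h k)) (carrier M)"
  proof (rule inj_onI)
    fix x y assume xy: "x \<in> carrier M" "y \<in> carrier M" "(\<lambda>k. v x (h k)) = (\<lambda>k. v y (h k))"
    have "v x b = v y b" if "b \<in> B" for b
      using that h xy(3) unfolding bij_betw_def by (metis imageE)
    then have "(\<Oplus>\<^bsub>M\<^esub>b\<in>B. v x b \<odot>\<^bsub>M\<^esub> b) = (\<Oplus>\<^bsub>M\<^esub>b\<in>B. v y b \<odot>\<^bsub>M\<^esub> b)"
      using v(1)[OF xy(2)] B(3)
      by (intro M.finsum_cong') (auto simp: generates_def smult_closed Pi_def subset_iff)
    then show "x = y" using v(2)[OF xy(1)] v(2)[OF xy(2)] by simp
  qed
  then show ?thesis by blast
qed

section \<open>Transport of structure\<close>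

text \<open>Transport of structure along an injection \<open>c\<close>, which moves a module into
  the type of the test modules. The \<open>zero\<close> field is the image of zero, as
  \<open>right_module_image\<close> requires.\<close>

definition module_copy :: "('m \<Rightarrow> 'n) \<Rightarrow> ('a, 'm) module \<Rightarrow> ('a, 'n) module" where
  "module_copy c M = \<lparr>carrier = c ` carrier M, mult = undefined, one = undefined, zero = c \<zero>\<^bsub>M\<^esub>,
     add = (\<lambda>x y. c (inv_into (carrier M) c x \<oplus>\<^bsub>M\<^esub> inv_into (carrier M) c y)),
     smult = (\<lambda>a x. c (a \<odot>\<^bsub>M\<^esub> inv_into (carrier M) c x))\<rparr>"

lemma module_copy:
  assumes "right_module A M" "inj_on c (carrier M)"
  shows "c \<in> mod_hom A M (module_copy c M)"
    and "inv_into (carrier M) c \<in> mod_hom A (module_copy c M) M"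
    and "right_module A (module_copy c M)"
proof -
  interpret right_module A M by fact
  show c: "c \<in> mod_hom A M (module_copy c M)"
    using assms(2) by (auto intro!: mod_homI simp: module_copy_def)
  show "inv_into (carrier M) c \<in> mod_hom A (module_copy c M) M"
    using assms(2) by (auto intro!: mod_homI simp: module_copy_def smult_closed)
  show "right_module A (module_copy c M)"
    by (rule right_module_image[OF assms(1) c]) (auto simp: module_copy_def)
qed

lemma projective_moduleD:
  fixes M N :: "('a, (nat \<Rightarrow> 'a) set) module"
  assumes "projective_module A P" "right_module A M" "right_module A N"
    and "p \<in> mod_hom A M N" "p ` carrier M = carrier N" "f \<in> mod_hom A P N"
  shows "\<exists>f'\<in>mod_hom A P M. \<forall>x\<in>carrier P. p (f' x) = f x"
  using assms unfolding projective_module_def by blast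

lemma injective_moduleD:
  fixes M N :: "('a, (nat \<Rightarrow> 'a) set) module"
  assumes "injective_module A J" "right_module A M" "right_module A N"
    and "i \<in> mod_hom A M N" "inj_on i (carrier M)" "f \<in> mod_hom A M J"
  shows "\<exists>f'\<in>mod_hom A N J. \<forall>x\<in>carrier M. f' (i x) = f x"
  using assms unfolding injective_module_def by blast

lemma projective_lift_embedded:
  fixes M :: "('a, 'm) module" and N :: "('a, 'n) module"
    and c :: "'m \<Rightarrow> nat \<Rightarrow> 'a" and d :: "'n \<Rightarrow> nat \<Rightarrow> 'a"
  assumes "projective_module A P" "right_module A M" "right_module A N"
    and "inj_on c (carrier M)" "inj_on d (carrier N)"
    and p: "p \<in> mod_hom A M N" "p ` carrier M = carrier N" and f: "f \<in> mod_hom A P N"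
  shows "\<exists>f'\<in>mod_hom A P M. \<forall>x\<in>carrier P. p (f' x) = f x"
proof -
  \<comment> \<open>Singletons turn the codes into elements of the type on which test modules
    live.\<close>
  let ?c = "\<lambda>x. {c x}" and ?d = "\<lambda>x. {d x}"
  have c: "inj_on ?c (carrier M)" and d: "inj_on ?d (carrier N)"
    using assms(4,5) by (auto simp: inj_on_def)
  note C = module_copy[OF assms(2) c] and D = module_copy[OF assms(3) d]
  let ?p = "\<lambda>z. ?d (p (inv_into (carrier M) ?c z))"
  have p': "?p \<in> mod_hom A (module_copy ?c M) (module_copy ?d N)"
    using mod_hom_comp[OF mod_hom_comp[OF C(2) p(1)] D(1)] .
  have f': "(\<lambda>x. ?d (f x)) \<in> mod_hom A P (module_copy ?d N)"
    using mod_hom_comp[OF f D(1)] .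
  have "?p (?c x) = ?d (p x)" if "x \<in> carrier M" for x
    using inv_into_f_f[OF c that] by simp
  then have im: "?p ` carrier (module_copy ?c M) = carrier (module_copy ?d N)"
    using p(2)[symmetric] by (auto simp: module_copy_def image_image image_iff)
  obtain h where h: "h \<in> mod_hom A P (module_copy ?c M)"
    "\<And>x. x \<in> carrier P \<Longrightarrow> ?p (h x) = ?d (f x)"
    using projective_moduleD[OF assms(1) C(3) D(3) p' im f'] by blast
  have "(\<lambda>x. inv_into (carrier M) ?c (h x)) \<in> mod_hom A P M"
    using mod_hom_comp[OF h(1) C(2)] .
  moreover have "p (inv_into (carrier M) ?c (h x)) = f x" if "x \<in> carrier P" for x
    using h(2)[OF that] inj_onD[OF assms(5)] mod_hom_closed[OF p(1)] mod_hom_closed[OF calculation that]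
      mod_hom_closed[OF f that] by auto
  ultimately show ?thesis by (intro bexI) auto
qed

text \<open>The inclusion of \<open>U\<close> is transported to copies on the test type, where
  injectivity of \<open>J\<close> applies; composing with the code of \<open>N\<close> brings the
  extension back.\<close>

lemma injective_extend_embedded:
  fixes N :: "('a, 'n) module" and c :: "'n \<Rightarrow> nat \<Rightarrow> 'a"
  assumes "injective_module A J" "right_module A N" "inj_on c (carrier N)"
    and "submodule U A N" and f: "f \<in> mod_hom A (N\<lparr>carrier := U\<rparr>) J"
  shows "\<exists>F\<in>mod_hom A N J. \<forall>x\<in>U. F x = f x"
proof -
  interpret N: right_module A N by fact
  let ?c = "\<lambda>x. {c x}" and ?U = "N\<lparr>carrier := U\<rparr>"
  have U: "U \<subseteq> carrier N" using N.submodule_dest(1)[OF assms(4)] .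
  have c: "inj_on ?c (carrier N)" using assms(3) by (auto simp: inj_on_def)
  then have cU: "inj_on ?c (carrier ?U)" using inj_on_subset[OF c U] by simp
  note C = module_copy[OF assms(2) c]
  note D = module_copy[OF N.right_module_submodule[OF assms(4)] cU]
  have incl: "(\<lambda>x. x) \<in> mod_hom A ?U N" using U by (auto simp: mod_hom_def)
  let ?i = "\<lambda>z. ?c (inv_into U ?c z)" and ?f = "\<lambda>z. f (inv_into U ?c z)"
  have i: "?i \<in> mod_hom A (module_copy ?c ?U) (module_copy ?c N)"
    using mod_hom_comp[OF mod_hom_comp[OF D(2) incl] C(1)] by simp
  have f': "?f \<in> mod_hom A (module_copy ?c ?U) J" using mod_hom_comp[OF D(2) f] by simp
  have inv: "inv_into U ?c (?c x) = x" if "x \<in> U" for x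
    using inv_into_f_f[OF cU] that by simp
  have inj: "inj_on ?i (carrier (module_copy ?c ?U))"
    by (rule inj_onI) (auto simp: module_copy_def inv)
  obtain h where h: "h \<in> mod_hom A (module_copy ?c N) J"
    "\<And>x. x \<in> carrier (module_copy ?c ?U) \<Longrightarrow> h (?i x) = ?f x"
    using injective_moduleD[OF assms(1) D(3) C(3) i inj f'] by blast
  have "(\<lambda>x. h (?c x)) \<in> mod_hom A N J" using mod_hom_comp[OF C(1) h(1)] .
  moreover have "h (?c x) = f x" if "x \<in> U" for x
    using h(2)[of "?c x"] that by (simp add: module_copy_def inv)
  ultimately show ?thesis by (intro bexI) auto
qed

section \<open>Powers of a module and the dual basis lemma\<close>

definition power_module :: "'i set \<Rightarrow> ('a, 'm) module \<Rightarrow> ('a, 'i \<Rightarrow> 'm) module" where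
  "power_module I M = \<lparr>carrier = I \<rightarrow>\<^sub>E carrier M, mult = undefined, one = undefined,
     zero = (\<lambda>i\<in>I. \<zero>\<^bsub>M\<^esub>), add = (\<lambda>v w. \<lambda>i\<in>I. v i \<oplus>\<^bsub>M\<^esub> w i),
     smult = (\<lambda>a v. \<lambda>i\<in>I. a \<odot>\<^bsub>M\<^esub> v i)\<rparr>"

lemma power_module_simps [simp]:
  "carrier (power_module I M) = I \<rightarrow>\<^sub>E carrier M"
  "\<zero>\<^bsub>power_module I M\<^esub> = (\<lambda>i\<in>I. \<zero>\<^bsub>M\<^esub>)"
  "v \<oplus>\<^bsub>power_module I M\<^esub> w = (\<lambda>i\<in>I. v i \<oplus>\<^bsub>M\<^esub> w i)"
  "a \<odot>\<^bsub>power_module I M\<^esub> v = (\<lambda>i\<in>I. a \<odot>\<^bsub>M\<^esub> v i)"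
  by (simp_all add: power_module_def)

lemma right_module_power:
  assumes "right_module A M"
  shows "right_module A (power_module I M)"
proof -
  interpret right_module A M by fact
  have "abelian_group (power_module I M)"
  proof (rule abelian_groupI, goal_cases)
    case (6 v)
    then show ?case
      by (intro bexI[of _ "\<lambda>i\<in>I. \<ominus>\<^bsub>M\<^esub> v i"]) (auto simp: M.l_neg PiE_def Pi_def intro!: restrict_ext)
  qed (auto simp: M.a_ac PiE_def Pi_def intro!: restrict_ext extensionalityI[of _ I])
  moreover have "right_module_axioms A (power_module I M)"
    unfolding right_module_axioms_def
    by (auto simp: PiE_def Pi_def smult_closed smult_distr_ring smult_distr_module smult_assoc_right smult_one
        intro!: restrict_ext extensionalityI[of _ I])
  ultimately show ?thesis using A.ring_axioms by (simp add: right_module_def)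
qed

lemma power_module_embedding:
  fixes c :: "'m \<Rightarrow> nat \<Rightarrow> 'a"
  assumes "finite I" "inj_on c (carrier M)"
  shows "\<exists>d :: _ \<Rightarrow> nat \<Rightarrow> 'a. inj_on d (carrier (power_module I M))"
proof -
  obtain h where h: "bij_betw h {0..<card I} I" using ex_bij_betw_nat_finite[OF assms(1)] ..
  \<comment> \<open>A natural number encodes a pair: the number of a coordinate and a place in the
    code of that coordinate.\<close>
  let ?d = "\<lambda>v k. c (v (h (fst (prod_decode k)))) (snd (prod_decode k))"
  have "inj_on ?d (carrier (power_module I M))"
  proof (rule inj_onI)
    fix v w assume vw: "v \<in> carrier (power_module I M)" "w \<in> carrier (power_module I M)" "?d v = ?d w"
    show "v = w"
    proof (rule extensionalityI[of _ I])
      fix i assume i: "i \<in> I"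
      then obtain k where k: "i = h k" using h unfolding bij_betw_def by blast
      have "c (v i) = c (w i)"
      proof
        fix n
        show "c (v i) n = c (w i) n" using fun_cong[OF vw(3), of "prod_encode (k, n)"] k by simp
      qed
      then show "v i = w i" using inj_onD[OF assms(2)] vw(1,2) i by (auto simp: PiE_mem)
    qed (use vw in \<open>auto simp: PiE_def\<close>)
  qed
  then show ?thesis by blast
qed

lemma regular_module_simps [simp]:
  "carrier (regular_module A) = carrier A"
  "\<zero>\<^bsub>regular_module A\<^esub> = \<zero>\<^bsub>A\<^esub>"
  "x \<oplus>\<^bsub>regular_module A\<^esub> y = x \<oplus>\<^bsub>A\<^esub> y"
  "a \<odot>\<^bsub>regular_module A\<^esub> x = x \<otimes>\<^bsub>A\<^esub> a"
  by (simp_all add: regular_module_def)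

lemma right_module_regular:
  assumes "ring A"
  shows "right_module A (regular_module A)"
proof -
  interpret ring A by fact
  have "abelian_group (regular_module A)"
  proof (rule abelian_groupI, goal_cases)
    case (6 x)
    then show ?case by (intro bexI[of _ "\<ominus>\<^bsub>A\<^esub> x"]) (auto simp: l_neg)
  qed (auto simp: a_ac)
  then show ?thesis
    using assms by (intro right_module.intro right_module_axioms.intro) (auto simp: m_assoc l_distr r_distr)
qed

text \<open>The coefficient map \<open>A\<^bsup>B\<^esup> \<rightarrow> P\<close> of a finite generating set splits.\<close>

lemma dual_basis:
  assumes "fg_module A P" "projective_module A P"
  shows "\<exists>B \<phi>. finite B \<and> generates A P B \<and> (\<forall>b\<in>B. \<phi> b \<in> mod_hom A P (regular_module A))
    \<and> (\<forall>x\<in>carrier P. x = (\<Oplus>\<^bsub>P\<^esub>b\<in>B. \<phi> b x \<odot>\<^bsub>P\<^esub> b))"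
proof -
  obtain B where B: "right_module A P" "finite B" "generates A P B"
    using fg_moduleE[OF assms(1)] .
  interpret P: right_module A P by fact
  have BP: "B \<subseteq> carrier P" using B(3) by (simp add: generates_def)
  let ?F = "power_module B (regular_module A)"
  have F: "right_module A ?F" using right_module_power[OF right_module_regular[OF P.A.ring_axioms]] .
  let ?p = "\<lambda>v. \<Oplus>\<^bsub>P\<^esub>b\<in>B. v b \<odot>\<^bsub>P\<^esub> b"
  have summand: "(\<lambda>b. v b \<odot>\<^bsub>P\<^esub> b) \<in> B \<rightarrow> carrier P" if "v \<in> B \<rightarrow> carrier A" for v
    using that BP by (auto simp: P.smult_closed Pi_def subset_iff)
  have p: "?p \<in> mod_hom A ?F P"
  proof (rule mod_homI)
    show "?p v \<in> carrier P" if "v \<in> carrier ?F" for v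
      using that summand[of v] by (auto intro!: P.M.finsum_closed simp: PiE_def)
    show "?p (v \<oplus>\<^bsub>?F\<^esub> w) = ?p v \<oplus>\<^bsub>P\<^esub> ?p w" if "v \<in> carrier ?F" "w \<in> carrier ?F" for v w
    proof -
      have vw: "v \<in> B \<rightarrow> carrier A" "w \<in> B \<rightarrow> carrier A" using that by (auto simp: PiE_def)
      have "?p (v \<oplus>\<^bsub>?F\<^esub> w) = (\<Oplus>\<^bsub>P\<^esub>b\<in>B. v b \<odot>\<^bsub>P\<^esub> b \<oplus>\<^bsub>P\<^esub> w b \<odot>\<^bsub>P\<^esub> b)"
        using vw BP
        by (intro P.M.finsum_cong') (auto simp: P.smult_distr_ring P.smult_closed Pi_def subset_iff)
      then show ?thesis using summand vw by (simp add: P.M.finsum_addf)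
    qed
    show "?p (a \<odot>\<^bsub>?F\<^esub> v) = a \<odot>\<^bsub>P\<^esub> ?p v" if "a \<in> carrier A" "v \<in> carrier ?F" for a v
    proof -
      have v: "v \<in> B \<rightarrow> carrier A" using that by (auto simp: PiE_def)
      have "?p (a \<odot>\<^bsub>?F\<^esub> v) = (\<Oplus>\<^bsub>P\<^esub>b\<in>B. a \<odot>\<^bsub>P\<^esub> (v b \<odot>\<^bsub>P\<^esub> b))"
        using v BP that(1)
        by (intro P.M.finsum_cong') (auto simp: P.smult_assoc_right P.smult_closed Pi_def subset_iff)
      then show ?thesis using summand[OF v] that(1) by (simp add: P.smult_finsum)
    qed
  qed
  have surj: "?p ` carrier ?F = carrier P"
  proof
    show "?p ` carrier ?F \<subseteq> carrier P" using mod_hom_closed[OF p] by auto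
    show "carrier P \<subseteq> ?p ` carrier ?F"
    proof
      fix x assume "x \<in> carrier P"
      then obtain v where v: "v \<in> B \<rightarrow> carrier A" "x = ?p v"
        using generates_coefficients[OF B(1,3,2)] by blast
      have "?p (restrict v B) = ?p v"
        using summand[OF v(1)] by (intro P.M.finsum_cong') auto
      then show "x \<in> ?p ` carrier ?F" using v by (intro image_eqI[of _ _ "restrict v B"]) auto
    qed
  qed
  \<comment> \<open>Constant sequences code the ring, and hence its finite powers.\<close>
  have "inj_on (\<lambda>a (_ :: nat). a) (carrier (regular_module A))" by (auto simp: inj_on_def fun_eq_iff)
  from power_module_embedding[OF B(2) this] obtain c :: "_ \<Rightarrow> nat \<Rightarrow> 'a" where c: "inj_on c (carrier ?F)" ..
  obtain d :: "_ \<Rightarrow> nat \<Rightarrow> 'a" where d: "inj_on d (carrier P)" using fg_module_embedding[OF assms(1)] ..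
  obtain f where f: "f \<in> mod_hom A P ?F" "\<And>x. x \<in> carrier P \<Longrightarrow> ?p (f x) = x"
    using projective_lift_embedded[OF assms(2) F B(1) c d p surj mod_hom_id] by blast
  \<comment> \<open>The coordinates of a section of the coefficient map are the dual
    functionals.\<close>
  have "(\<lambda>x. f x b) \<in> mod_hom A P (regular_module A)" if "b \<in> B" for b
    using mod_homD[OF f(1)] that by (intro mod_homI) (auto simp: PiE_mem)
  then show ?thesis
    using B f(2) by (intro exI[of _ B] exI[of _ "\<lambda>b x. f x b"]) simp
qed

text \<open>A dual basis gives the lift by an explicit formula from preimages of the values
  \<open>f b\<close>. It therefore works for modules on any type and for any \<open>p\<close> whose
  image contains that of \<open>f\<close>; the main arguments apply projectivity in this
  form.\<close>

lemma projective_lift: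
  assumes P: "fg_module A P" "projective_module A P" and M: "right_module A M" and N: "right_module A N"
    and p: "p \<in> mod_hom A M N" and f: "f \<in> mod_hom A P N" and im: "f ` carrier P \<subseteq> p ` carrier M"
  shows "\<exists>f'\<in>mod_hom A P M. \<forall>x\<in>carrier P. p (f' x) = f x"
proof -
  obtain B \<phi> where B: "finite B" "generates A P B"
    and \<phi>: "\<And>b. b \<in> B \<Longrightarrow> \<phi> b \<in> mod_hom A P (regular_module A)"
    and x: "\<And>x. x \<in> carrier P \<Longrightarrow> x = (\<Oplus>\<^bsub>P\<^esub>b\<in>B. \<phi> b x \<odot>\<^bsub>P\<^esub> b)"
    using dual_basis[OF P] by blast
  have "right_module A P" using P(1) by (simp add: fg_module_def)
  then interpret P: right_module A P .
  interpret M: right_module A M by fact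
  interpret N: right_module A N by fact
  have BP: "B \<subseteq> carrier P" using B(2) by (simp add: generates_def)
  have "\<forall>b\<in>B. \<exists>m\<in>carrier M. p m = f b" using im BP by (metis imageE imageI subsetD)
  then obtain m where m: "\<And>b. b \<in> B \<Longrightarrow> m b \<in> carrier M" "\<And>b. b \<in> B \<Longrightarrow> p (m b) = f b" by metis
  let ?f = "\<lambda>x. \<Oplus>\<^bsub>M\<^esub>b\<in>B. \<phi> b x \<odot>\<^bsub>M\<^esub> m b"
  have c: "\<phi> b x \<in> carrier A" if "b \<in> B" "x \<in> carrier P" for b x
    using mod_hom_closed[OF \<phi>[OF that(1)] that(2)] by simp
  have t: "(\<lambda>b. \<phi> b x \<odot>\<^bsub>M\<^esub> m b) \<in> B \<rightarrow> carrier M" if "x \<in> carrier P" for x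
    using that m c by (auto simp: M.smult_closed)
  have "?f \<in> mod_hom A P M"
  proof (rule mod_homI)
    show "?f x \<in> carrier M" if "x \<in> carrier P" for x
      using t[OF that] by (rule M.M.finsum_closed)
    show "?f (x \<oplus>\<^bsub>P\<^esub> y) = ?f x \<oplus>\<^bsub>M\<^esub> ?f y" if "x \<in> carrier P" "y \<in> carrier P" for x y
    proof -
      have "?f (x \<oplus>\<^bsub>P\<^esub> y) = (\<Oplus>\<^bsub>M\<^esub>b\<in>B. \<phi> b x \<odot>\<^bsub>M\<^esub> m b \<oplus>\<^bsub>M\<^esub> \<phi> b y \<odot>\<^bsub>M\<^esub> m b)"
        using that t mod_hom_add[OF \<phi>, of _ x y] c m
        by (intro M.M.finsum_cong') (auto simp: M.smult_distr_ring M.smult_closed)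
      then show ?thesis using t that by (simp add: M.M.finsum_addf)
    qed
    show "?f (a \<odot>\<^bsub>P\<^esub> x) = a \<odot>\<^bsub>M\<^esub> ?f x" if "a \<in> carrier A" "x \<in> carrier P" for a x
    proof -
      have "?f (a \<odot>\<^bsub>P\<^esub> x) = (\<Oplus>\<^bsub>M\<^esub>b\<in>B. a \<odot>\<^bsub>M\<^esub> (\<phi> b x \<odot>\<^bsub>M\<^esub> m b))"
        using that t mod_hom_smult[OF \<phi>, of _ a x] c m
        by (intro M.M.finsum_cong') (auto simp: M.smult_assoc_right M.smult_closed)
      then show ?thesis using t that by (simp add: M.smult_finsum)
    qed
  qed
  moreover have "p (?f x) = f x" if "x \<in> carrier P" for x
  proof -
    have "p (?f x) = (\<Oplus>\<^bsub>N\<^esub>b\<in>B. p (\<phi> b x \<odot>\<^bsub>M\<^esub> m b))"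
      by (rule mod_hom_finsum[OF M N p t[OF that]])
    also have "\<dots> = (\<Oplus>\<^bsub>N\<^esub>b\<in>B. f (\<phi> b x \<odot>\<^bsub>P\<^esub> b))"
      using mod_hom_smult[OF p] mod_hom_smult[OF f] mod_hom_closed[OF f] c that m BP
      by (intro N.M.finsum_cong') (auto simp: P.smult_closed subset_iff N.smult_closed)
    also have "\<dots> = f (\<Oplus>\<^bsub>P\<^esub>b\<in>B. \<phi> b x \<odot>\<^bsub>P\<^esub> b)"
      using c that BP
      by (intro mod_hom_finsum[OF \<open>right_module A P\<close> N f, symmetric]) (auto simp: P.smult_closed)
    also have "\<dots> = f x" using x[OF that] by simp
    finally show ?thesis .
  qed
  ultimately show ?thesis by (intro bexI) auto
qed

section \<open>Direct sums\<close>

lemma direct_sum_simps [simp]: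
  "carrier (direct_sum M N) = carrier M \<times> carrier N"
  "\<zero>\<^bsub>direct_sum M N\<^esub> = (\<zero>\<^bsub>M\<^esub>, \<zero>\<^bsub>N\<^esub>)"
  "(x, y) \<oplus>\<^bsub>direct_sum M N\<^esub> (x', y') = (x \<oplus>\<^bsub>M\<^esub> x', y \<oplus>\<^bsub>N\<^esub> y')"
  "a \<odot>\<^bsub>direct_sum M N\<^esub> (x, y) = (a \<odot>\<^bsub>M\<^esub> x, a \<odot>\<^bsub>N\<^esub> y)"
  by (simp_all add: direct_sum_def)

lemma right_module_direct_sum:
  assumes "right_module A M" "right_module A N"
  shows "right_module A (direct_sum M N)"
proof -
  interpret M: right_module A M by fact
  interpret N: right_module A N by fact
  have "abelian_group (direct_sum M N)"
  proof (rule abelian_groupI, goal_cases)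
    case (6 z)
    then show ?case
      by (intro bexI[of _ "(\<ominus>\<^bsub>M\<^esub> fst z, \<ominus>\<^bsub>N\<^esub> snd z)"]) (auto simp: M.M.l_neg N.M.l_neg)
  qed (auto simp: M.M.a_ac N.M.a_ac)
  moreover have "right_module_axioms A (direct_sum M N)"
    unfolding right_module_axioms_def
    by (auto simp: M.smult_closed M.smult_distr_ring M.smult_distr_module M.smult_assoc_right M.smult_one
        N.smult_closed N.smult_distr_ring N.smult_distr_module N.smult_assoc_right N.smult_one)
  ultimately show ?thesis using M.A.ring_axioms by (simp add: right_module_def)
qed

lemma direct_sum_homs:
  assumes "right_module A M" "right_module A N"
  shows "(\<lambda>x. (x, \<zero>\<^bsub>N\<^esub>)) \<in> mod_hom A M (direct_sum M N)"
    and "(\<lambda>y. (\<zero>\<^bsub>M\<^esub>, y)) \<in> mod_hom A N (direct_sum M N)"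
    and "fst \<in> mod_hom A (direct_sum M N) M" "snd \<in> mod_hom A (direct_sum M N) N"
proof -
  interpret M: right_module A M by fact
  interpret N: right_module A N by fact
  show "(\<lambda>x. (x, \<zero>\<^bsub>N\<^esub>)) \<in> mod_hom A M (direct_sum M N)"
    and "(\<lambda>y. (\<zero>\<^bsub>M\<^esub>, y)) \<in> mod_hom A N (direct_sum M N)"
    and "fst \<in> mod_hom A (direct_sum M N) M" "snd \<in> mod_hom A (direct_sum M N) N"
    by (auto intro!: mod_homI simp: M.smult_zero_right N.smult_zero_right)
qed

lemma mod_hom_pair:
  assumes "f \<in> mod_hom A L M" "h \<in> mod_hom A L N"
  shows "(\<lambda>x. (f x, h x)) \<in> mod_hom A L (direct_sum M N)"
  using mod_homD[OF assms(1)] mod_homD[OF assms(2)] by (intro mod_homI) auto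

lemma mod_hom_copair:
  assumes "right_module A M" "right_module A N" "right_module A L"
    and "f \<in> mod_hom A M L" "h \<in> mod_hom A N L"
  shows "(\<lambda>(x, y). f x \<oplus>\<^bsub>L\<^esub> h y) \<in> mod_hom A (direct_sum M N) L"
  using mod_hom_pointwise_add[OF assms(3) mod_hom_comp[OF direct_sum_homs(3)[OF assms(1,2)] assms(4)]
      mod_hom_comp[OF direct_sum_homs(4)[OF assms(1,2)] assms(5)]]
  by (simp add: case_prod_beta')

lemma generates_direct_sum:
  assumes "right_module A M" "right_module A N" "generates A M B" "generates A N C"
  shows "generates A (direct_sum M N) ((\<lambda>x. (x, \<zero>\<^bsub>N\<^esub>)) ` B \<union> (\<lambda>y. (\<zero>\<^bsub>M\<^esub>, y)) ` C)"
  unfolding generates_def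
proof (intro conjI allI impI)
  interpret M: right_module A M by fact
  interpret N: right_module A N by fact
  note S = right_module_direct_sum[OF assms(1,2)] and ij = direct_sum_homs[OF assms(1,2)]
  interpret S: right_module A "direct_sum M N" by (fact S)
  show "(\<lambda>x. (x, \<zero>\<^bsub>N\<^esub>)) ` B \<union> (\<lambda>y. (\<zero>\<^bsub>M\<^esub>, y)) ` C \<subseteq> carrier (direct_sum M N)"
    using assms(3,4) by (auto simp: generates_def)
  fix U assume "submodule U A (direct_sum M N) \<and> (\<lambda>x. (x, \<zero>\<^bsub>N\<^esub>)) ` B \<union> (\<lambda>y. (\<zero>\<^bsub>M\<^esub>, y)) ` C \<subseteq> U"
  then have U: "submodule U A (direct_sum M N)"
    and BC: "\<And>b. b \<in> B \<Longrightarrow> (b, \<zero>\<^bsub>N\<^esub>) \<in> U" "\<And>b. b \<in> C \<Longrightarrow> (\<zero>\<^bsub>M\<^esub>, b) \<in> U" by auto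
  have x: "(x, \<zero>\<^bsub>N\<^esub>) \<in> U" if "x \<in> carrier M" for x
  proof -
    have "{x \<in> carrier M. (x, \<zero>\<^bsub>N\<^esub>) \<in> U} = carrier M"
      using assms(3) submodule_vimage[OF assms(1) S ij(1) U] BC(1) unfolding generates_def by blast
    then show ?thesis using that by blast
  qed
  have y: "(\<zero>\<^bsub>M\<^esub>, y) \<in> U" if "y \<in> carrier N" for y
  proof -
    have "{x \<in> carrier N. (\<zero>\<^bsub>M\<^esub>, x) \<in> U} = carrier N"
      using assms(4) submodule_vimage[OF assms(2) S ij(2) U] BC(2) unfolding generates_def by blast
    then show ?thesis using that by blast
  qed
  show "U = carrier (direct_sum M N)"
  proof
    show "U \<subseteq> carrier (direct_sum M N)" using S.submodule_dest(1)[OF U] .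
    show "carrier (direct_sum M N) \<subseteq> U"
    proof
      fix z assume "z \<in> carrier (direct_sum M N)"
      then obtain a b where z: "z = (a, b)" "a \<in> carrier M" "b \<in> carrier N" by auto
      have "(a, \<zero>\<^bsub>N\<^esub>) \<oplus>\<^bsub>direct_sum M N\<^esub> (\<zero>\<^bsub>M\<^esub>, b) \<in> U"
        using S.submodule_dest(3)[OF U] x y z by blast
      then show "z \<in> U" using z by simp
    qed
  qed
qed

lemma fg_module_direct_sum:
  assumes "fg_module A M" "fg_module A N"
  shows "fg_module A (direct_sum M N)"
proof -
  obtain B where B: "right_module A M" "finite B" "generates A M B" using fg_moduleE[OF assms(1)] .
  obtain C where C: "right_module A N" "finite C" "generates A N C" using fg_moduleE[OF assms(2)] .
  show ?thesis
    using fg_moduleI[OF right_module_direct_sum[OF B(1) C(1)] _ generates_direct_sum[OF B(1) C(1) B(3) C(3)]] B C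
    by simp
qed

lemma projective_module_direct_sum:
  fixes A :: "('a, 'r) ring_scheme"
  assumes M: "projective_module A M" and N: "projective_module A N"
  shows "projective_module A (direct_sum M N)"
  unfolding projective_module_def
proof (intro conjI allI impI)
  have mn: "right_module A M" "right_module A N" using M N by (auto simp: projective_module_def)
  interpret M: right_module A M by (fact mn)
  interpret N: right_module A N by (fact mn)
  show "right_module A (direct_sum M N)" using right_module_direct_sum[OF mn] .
  fix K :: "('a, (nat \<Rightarrow> 'a) set) module" and L :: "('a, (nat \<Rightarrow> 'a) set) module" and p f
  assume *: "right_module A K \<and> right_module A L \<and> p \<in> mod_hom A K L \<and> p ` carrier K = carrier L
    \<and> f \<in> mod_hom A (direct_sum M N) L"
  note ij = direct_sum_homs[OF mn]
  have K: "right_module A K" and L: "right_module A L" and p: "p \<in> mod_hom A K L"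
    and f: "f \<in> mod_hom A (direct_sum M N) L" using * by auto
  have f1: "(\<lambda>x. f (x, \<zero>\<^bsub>N\<^esub>)) \<in> mod_hom A M L" by (rule mod_hom_comp[OF ij(1) f])
  have f2: "(\<lambda>y. f (\<zero>\<^bsub>M\<^esub>, y)) \<in> mod_hom A N L" by (rule mod_hom_comp[OF ij(2) f])
  have "\<exists>h\<in>mod_hom A M K. \<forall>x\<in>carrier M. p (h x) = f (x, \<zero>\<^bsub>N\<^esub>)"
    using projective_moduleD[OF M K L p _ f1] * by blast
  then obtain h where h: "h \<in> mod_hom A M K" "\<And>x. x \<in> carrier M \<Longrightarrow> p (h x) = f (x, \<zero>\<^bsub>N\<^esub>)" by auto
  have "\<exists>h\<in>mod_hom A N K. \<forall>x\<in>carrier N. p (h x) = f (\<zero>\<^bsub>M\<^esub>, x)"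
    using projective_moduleD[OF N K L p _ f2] * by blast
  then obtain k where k: "k \<in> mod_hom A N K" "\<And>x. x \<in> carrier N \<Longrightarrow> p (k x) = f (\<zero>\<^bsub>M\<^esub>, x)" by auto
  have "p (h x \<oplus>\<^bsub>K\<^esub> k y) = f (x, y)" if "x \<in> carrier M" "y \<in> carrier N" for x y
    using mod_hom_add[OF p] mod_hom_add[OF f, of "(x, \<zero>\<^bsub>N\<^esub>)" "(\<zero>\<^bsub>M\<^esub>, y)"]
      mod_hom_closed[OF h(1)] mod_hom_closed[OF k(1)] h(2) k(2) that by simp
  then show "\<exists>f'\<in>mod_hom A (direct_sum M N) K. \<forall>x\<in>carrier (direct_sum M N). p (f' x) = f x"
    using mod_hom_copair[OF mn K h(1) k(1)] by (intro bexI) auto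
qed

lemma zero_module_simps [simp]:
  "carrier zero_module = UNIV"
  by (simp add: zero_module_def)

lemma zero_module_props:
  assumes "ring A"
  shows "right_module A zero_module" "fg_module A zero_module" "projective_module A zero_module"
proof -
  interpret ring A by fact
  have "abelian_group zero_module" by (rule abelian_groupI) auto
  then show z: "right_module A zero_module"
    using assms by (intro right_module.intro right_module_axioms.intro) auto
  then interpret Z: right_module A zero_module .
  have "generates A zero_module {}"
    unfolding generates_def using Z.submodule_dest(2) by (auto simp: unit_eq)
  then show "fg_module A zero_module" using fg_moduleI[OF z] by blast
  show "projective_module A zero_module"
    unfolding projective_module_def
  proof (intro conjI allI impI, fact z)
    fix M :: "('a, (nat \<Rightarrow> 'a) set) module" and N :: "('a, (nat \<Rightarrow> 'a) set) module" and p f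
    assume *: "right_module A M \<and> right_module A N \<and> p \<in> mod_hom A M N \<and> p ` carrier M = carrier N
      \<and> f \<in> mod_hom A zero_module N"
    then have "f () = \<zero>\<^bsub>N\<^esub>" using mod_hom_zero[OF z, of N f] by (simp add: unit_eq)
    moreover have "p \<zero>\<^bsub>M\<^esub> = \<zero>\<^bsub>N\<^esub>" using * mod_hom_zero[of A M N p] by simp
    ultimately show "\<exists>f'\<in>mod_hom A zero_module M. \<forall>x\<in>carrier zero_module. p (f' x) = f x"
      using mod_hom_zero_map[of A M] * by (intro bexI[of _ "\<lambda>_. \<zero>\<^bsub>M\<^esub>"]) (auto simp: unit_eq)
  qed
qed

section \<open>Descending chain condition\<close>

definition dcc :: "('a, 'r) ring_scheme \<Rightarrow> ('a, 'm) module \<Rightarrow> bool" where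
  "dcc A M \<longleftrightarrow> (\<forall>N :: nat \<Rightarrow> 'm set. (\<forall>n. submodule (N n) A M) \<and> (\<forall>n. N (Suc n) \<subseteq> N n)
     \<longrightarrow> (\<exists>n. \<forall>m\<ge>n. N m = N n))"

lemma dccD:
  fixes N :: "nat \<Rightarrow> 'm set"
  assumes "dcc A M" "\<And>n. submodule (N n) A M" "\<And>n. N (Suc n) \<subseteq> N n"
  shows "\<exists>n. \<forall>m\<ge>n. N m = N n"
  using assms by (simp add: dcc_def)

lemma artinian_ringD:
  fixes I :: "nat \<Rightarrow> 'r set"
  assumes "artinian_ring R" "\<And>n. ideal (I n) R" "\<And>n. I (Suc n) \<subseteq> I n"
  shows "\<exists>n. \<forall>m\<ge>n. I m = I n"
  using assms by (simp add: artinian_ring_def)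

text \<open>Under the chain condition strict inclusion is well founded on a set of
  submodules.\<close>

lemma dcc_minimal:
  assumes "dcc A M" "\<And>U. U \<in> \<S> \<Longrightarrow> submodule U A M" "U \<in> \<S>"
  shows "\<exists>V\<in>\<S>. \<forall>W\<in>\<S>. W \<subseteq> V \<longrightarrow> W = V"
proof -
  let ?r = "{(V, U). V \<in> \<S> \<and> U \<in> \<S> \<and> V \<subset> U}"
  have "wf ?r"
    unfolding wf_iff_no_infinite_down_chain
  proof
    assume "\<exists>f. \<forall>i. (f (Suc i), f i) \<in> ?r"
    then obtain f where f: "\<And>i. (f (Suc i), f i) \<in> ?r" by blast
    then have "submodule (f n) A M" "f (Suc n) \<subseteq> f n" for n using f[of n] assms(2) by auto
    then obtain n where "\<forall>m\<ge>n. f m = f n" using dccD[OF assms(1), of f] by auto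
    then have "f (Suc n) = f n" using le_SucI by blast
    then show False using f[of n] by simp
  qed
  then obtain V where V: "V \<in> \<S>" "\<And>W. (W, V) \<in> ?r \<Longrightarrow> W \<notin> \<S>"
    using assms(3) by (rule wfE_min) blast
  have "W = V" if "W \<in> \<S>" "W \<subseteq> V" for W
  proof (rule ccontr)
    assume "W \<noteq> V"
    then have "(W, V) \<in> ?r" using that V(1) by simp
    then show False using V(2) that(1) by blast
  qed
  then show ?thesis using V(1) by blast
qed

text \<open>The images of the powers of \<open>f\<close> become stationary. An injective power with
  the same image on \<open>f M\<close> as on \<open>M\<close> can be cancelled, which leaves
  \<open>f M = M\<close>.\<close>

lemma dcc_injective_endo:
  assumes "right_module A M" "dcc A M" "f \<in> mod_hom A M M" "inj_on f (carrier M)"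
  shows "f ` carrier M = carrier M"
proof -
  interpret right_module A M by fact
  let ?N = "\<lambda>n. (f ^^ n) ` carrier M"
  have N: "submodule (?N n) A M" for n
  proof (induction n)
    case (Suc n)
    have "?N (Suc n) = f ` ?N n" by auto
    then show ?case using submodule_image[OF assms(1,1,3) Suc] by simp
  qed (simp add: submodule_carrier)
  have f: "f ` carrier M \<subseteq> carrier M" using mod_hom_closed[OF assms(3)] by auto
  have Suc: "?N (Suc n) = (f ^^ n) ` (f ` carrier M)" for n by (simp add: image_image funpow_swap1)
  have "?N (Suc n) \<subseteq> ?N n" for n unfolding Suc using f by blast
  then obtain n where "\<And>m. m \<ge> n \<Longrightarrow> ?N m = ?N n"
    using dccD[OF assms(2), of ?N, OF N] by blast
  then have *: "(f ^^ n) ` (f ` carrier M) = (f ^^ n) ` carrier M" using Suc by (metis le_SucI order_refl)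
  have inj: "inj_on (f ^^ n) (carrier M)" for n
  proof (induction n)
    case (Suc n)
    have "(f ^^ n) ` carrier M \<subseteq> carrier M" using submodule_dest(1)[OF N] .
    then show ?case using comp_inj_on[OF Suc inj_on_subset[OF assms(4)]] by (simp add: comp_def)
  qed simp
  show ?thesis using * inj_on_image_eq_iff[OF inj f order_refl] by simp
qed

lemma dcc_simple_submodule:
  assumes "right_module A M" "dcc A M" "submodule U A M" "U \<noteq> {\<zero>\<^bsub>M\<^esub>}"
  shows "\<exists>S\<subseteq>U. simple_submodule A M S"
proof -
  let ?S = "{V. submodule V A M \<and> V \<noteq> {\<zero>\<^bsub>M\<^esub>} \<and> V \<subseteq> U}"
  have sub: "\<And>V. V \<in> ?S \<Longrightarrow> submodule V A M" and U: "U \<in> ?S" using assms(3,4) by auto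
  obtain S where S: "S \<in> ?S" and min: "\<forall>W\<in>?S. W \<subseteq> S \<longrightarrow> W = S"
    using dcc_minimal[of A M ?S, OF assms(2) sub U] by (rule bexE)
  have "N = {\<zero>\<^bsub>M\<^esub>} \<or> N = S" if "submodule N A M" "N \<subseteq> S" for N
    using min[rule_format, of N] S that by auto
  then have "simple_submodule A M S" using S unfolding simple_submodule_def by blast
  then show ?thesis using S by blast
qed

text \<open>The socle is essential, since every nonzero submodule contains a simple one.\<close>

lemma dcc_inj_on_socle:
  assumes "right_module A M" "right_module A N" "dcc A M" "f \<in> mod_hom A M N"
    and soc: "\<And>x. \<lbrakk>x \<in> module_soc A M; f x = \<zero>\<^bsub>N\<^esub>\<rbrakk> \<Longrightarrow> x = \<zero>\<^bsub>M\<^esub>"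
  shows "inj_on f (carrier M)"
proof (rule inj_on_mod_homI[OF assms(1,2,4)], rule ccontr)
  interpret right_module A M by fact
  have K: "submodule (mod_ker M N f) A M" using submodule_mod_ker[OF assms(1,2,4)] .
  assume "\<not> mod_ker M N f \<subseteq> {\<zero>\<^bsub>M\<^esub>}"
  then obtain S where S: "simple_submodule A M S" "S \<subseteq> mod_ker M N f"
    using dcc_simple_submodule[OF assms(1,3) K] submodule_dest(2)[OF K] by blast
  have "S \<subseteq> module_soc A M" using S(1) by (auto simp: module_soc_def)
  then have "S \<subseteq> {\<zero>\<^bsub>M\<^esub>}" using S(2) soc by (auto simp: mod_ker_def)
  moreover have "submodule S A M" "S \<noteq> {\<zero>\<^bsub>M\<^esub>}" using S(1) by (simp_all add: simple_submodule_def)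
  ultimately show False using submodule_dest(2) by blast
qed

section \<open>Modules over an Artin algebra\<close>

text \<open>
  Adjoining one generator \<open>b\<close> to \<open>S\<close> preserves stabilization: for a chain \<open>N\<close>, both \<open>N n \<inter> S\<close> and the
  ideals \<open>{r. r b \<in> N n + S}\<close> become stationary.
\<close>

lemma fg_artinian_ring_dcc:
  assumes "cring R" "artinian_ring R" "fg_module R M"
  shows "dcc R M"
proof -
  obtain B where B: "right_module R M" "finite B" "generates R M B"
    using fg_moduleE[OF assms(3)] .
  interpret R: cring R by fact
  interpret M: right_module R M by fact
  \<comment> \<open>The chains live in the whole of \<open>M\<close> and are only intersected with
    \<open>S\<close>, so the same chain can be followed while \<open>S\<close> grows.\<close>
  define good where "good S \<longleftrightarrow> submodule S R M \<and>
    (\<forall>N. (\<forall>n. submodule (N n) R M) \<and> (\<forall>n. N (Suc n) \<subseteq> N n) \<longrightarrow> (\<exists>n::nat. \<forall>m\<ge>n. N m \<inter> S = N n \<inter> S))"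
    for S
  have step: "\<exists>T. good T \<and> S \<subseteq> T \<and> b \<in> T" if S: "good S" and b: "b \<in> carrier M" for S b
  proof -
    have Ssub: "submodule S R M" using S by (simp add: good_def)
    have "right_module R (regular_module R)" by (rule right_module_regular[OF R.ring_axioms])
    have hom: "(\<lambda>r. r \<odot>\<^bsub>M\<^esub> b) \<in> mod_hom R (regular_module R) M"
      using b by (intro mod_homI) (auto simp: M.smult_closed M.smult_distr_ring M.smult_assoc_right)
    have Rb: "submodule ((\<lambda>r. r \<odot>\<^bsub>M\<^esub> b) ` carrier R) R M" (is "submodule ?Rb R M")
      using submodule_image[OF \<open>right_module R (regular_module R)\<close> B(1) hom
          right_module.submodule_carrier[OF \<open>right_module R (regular_module R)\<close>]] by simp
    let ?T = "S <+>\<^bsub>M\<^esub> ?Rb"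
    have T: "submodule ?T R M" using M.submodule_set_add[OF Ssub Rb] .
    have "b = \<one>\<^bsub>R\<^esub> \<odot>\<^bsub>M\<^esub> b" using b by (simp add: M.smult_one)
    then have bT: "b \<in> ?T" using M.set_add_superset(2)[OF Ssub Rb] by blast
    have "\<exists>n. \<forall>m\<ge>n. N m \<inter> ?T = N n \<inter> ?T"
      if N: "\<And>n. submodule (N n) R M" "\<And>n. N (Suc n) \<subseteq> N n" for N :: "nat \<Rightarrow> _"
    proof -
      have anti: "N m \<subseteq> N n" if "n \<le> m" for n m using N(2) that by (rule lift_Suc_antimono_le)
      obtain n1 where n1: "\<And>m. m \<ge> n1 \<Longrightarrow> N m \<inter> S = N n1 \<inter> S"
        using S N unfolding good_def by blast
      let ?I = "\<lambda>n. {r \<in> carrier R. r \<odot>\<^bsub>M\<^esub> b \<in> N n <+>\<^bsub>M\<^esub> S}"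
      have "ideal (?I n) R" for n
      proof -
        have NS: "submodule (N n <+>\<^bsub>M\<^esub> S) R M" using M.submodule_set_add[OF N(1) Ssub] .
        note NS' = M.submodule_dest[OF NS]
        have mult: "a \<otimes>\<^bsub>R\<^esub> r \<in> ?I n" if "a \<in> carrier R" "r \<in> ?I n" for a r
          using that NS'(4)[of a "r \<odot>\<^bsub>M\<^esub> b"] b by (simp add: R.m_comm[of a r] M.smult_assoc_right)
        have neg: "\<ominus>\<^bsub>R\<^esub> r \<in> ?I n" if "r \<in> ?I n" for r
          using mult[of "\<ominus>\<^bsub>R\<^esub> \<one>\<^bsub>R\<^esub>" r] that by (simp add: R.l_minus)
        have "subgroup (?I n) (add_monoid R)"
          using NS'(2,3) neg b
          by (intro subgroup.intro) (auto simp: M.smult_zero_left M.smult_distr_ring simp flip: a_inv_def)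
        then show ?thesis
          using mult R.m_comm by (intro idealI[OF R.ring_axioms]) force+
      qed
      moreover have "?I (Suc n) \<subseteq> ?I n" for n
        using N(2)[of n] by (auto simp: M.set_add_iff)
      ultimately have "\<exists>n. \<forall>m\<ge>n. ?I m = ?I n" by (rule artinian_ringD[OF assms(2)])
      then obtain n2 where n2: "\<And>m. m \<ge> n2 \<Longrightarrow> ?I m = ?I n2" by blast
      let ?n = "max n1 n2"
      have "N m \<inter> ?T = N ?n \<inter> ?T" if m: "m \<ge> ?n" for m
      proof
        show "N m \<inter> ?T \<subseteq> N ?n \<inter> ?T" using anti[OF m] by blast
        show "N ?n \<inter> ?T \<subseteq> N m \<inter> ?T"
        proof
          fix x assume x: "x \<in> N ?n \<inter> ?T"
          then obtain s r where sr: "s \<in> S" "r \<in> carrier R" "x = s \<oplus>\<^bsub>M\<^esub> r \<odot>\<^bsub>M\<^esub> b"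
            by (auto simp: M.set_add_iff)
          note S' = M.submodule_dest[OF Ssub] and Nn = M.submodule_dest[OF N(1)[of ?n]]
            and Nm = M.submodule_dest[OF N(1)[of m]]
          have c: "s \<in> carrier M" "r \<odot>\<^bsub>M\<^esub> b \<in> carrier M" "x \<in> carrier M"
            using sr b S'(1) Nn(1) x by (auto simp: M.smult_closed)
          have "r \<odot>\<^bsub>M\<^esub> b = x \<oplus>\<^bsub>M\<^esub> \<ominus>\<^bsub>M\<^esub> s"
            using c by (simp add: sr(3) M.M.a_ac M.M.r_neg1 M.M.r_neg2)
          then have "r \<in> ?I ?n" using sr S'(5) x M.set_add_iff by blast
          then have "r \<in> ?I m" using n2[of m] n2[of ?n] m by simp
          then obtain y s' where y: "y \<in> N m" "s' \<in> S" "r \<odot>\<^bsub>M\<^esub> b = y \<oplus>\<^bsub>M\<^esub> s'"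
            by (auto simp: M.set_add_iff)
          have c': "y \<in> carrier M" "s' \<in> carrier M" using y S'(1) Nm(1) by auto
          \<comment> \<open>The element \<open>s + s'\<close> equals \<open>x - y\<close>, so it
            lies in \<open>N ?n\<close> and in \<open>S\<close>, hence in \<open>N m\<close> by the
            choice of \<open>n1\<close>; adding \<open>y\<close> puts \<open>x\<close> into
            \<open>N m\<close>.\<close>
          have "x = y \<oplus>\<^bsub>M\<^esub> (s \<oplus>\<^bsub>M\<^esub> s')" using c c' by (simp add: sr(3) y(3) M.M.a_ac)
          then have "s \<oplus>\<^bsub>M\<^esub> s' = x \<ominus>\<^bsub>M\<^esub> y"
            using c c' M.add_diff_cancel(2)[of y "s \<oplus>\<^bsub>M\<^esub> s'"] by simp
          moreover have "x \<ominus>\<^bsub>M\<^esub> y \<in> N ?n" using x y anti[OF m] Nn(6) by blast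
          ultimately have "s \<oplus>\<^bsub>M\<^esub> s' \<in> N ?n" by metis
          then have "s \<oplus>\<^bsub>M\<^esub> s' \<in> N ?n \<inter> S" using sr(1) y(2) S'(3) by blast
          then have "s \<oplus>\<^bsub>M\<^esub> s' \<in> N m" using n1[of m] n1[of ?n] m by auto
          then show "x \<in> N m \<inter> ?T"
            using \<open>x = y \<oplus>\<^bsub>M\<^esub> (s \<oplus>\<^bsub>M\<^esub> s')\<close> y Nm(3) x by simp
        qed
      qed
      then show ?thesis by blast
    qed
    then have "good ?T" using T by (simp add: good_def)
    then show ?thesis using bT M.set_add_superset(1)[OF Ssub Rb] by blast
  qed
  have BM: "B \<subseteq> carrier M" using B(3) by (simp add: generates_def)
  with B(2) have "\<exists>S. good S \<and> B \<subseteq> S"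
  proof (induction B rule: finite_induct)
    case empty
    have "good {\<zero>\<^bsub>M\<^esub>}"
      unfolding good_def
    proof (intro conjI allI impI)
      fix N :: "nat \<Rightarrow> _" assume "(\<forall>n. submodule (N n) R M) \<and> (\<forall>n. N (Suc n) \<subseteq> N n)"
      then have "\<zero>\<^bsub>M\<^esub> \<in> N n" for n using M.submodule_dest(2) by blast
      then show "\<exists>n::nat. \<forall>m\<ge>n. N m \<inter> {\<zero>\<^bsub>M\<^esub>} = N n \<inter> {\<zero>\<^bsub>M\<^esub>}" by simp
    qed (rule M.submodule_zero)
    then show ?case by blast
  next
    case (insert b B)
    then obtain S where S: "good S" "B \<subseteq> S" by auto
    obtain T where "good T" "S \<subseteq> T" "b \<in> T" using step[OF S(1), of b] insert.prems by auto
    then show ?case using S(2) by blast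
  qed
  then obtain S where S: "good S" "B \<subseteq> S" by blast
  then have "S = carrier M" using B(3) by (auto simp: good_def generates_def)
  then have "N m \<inter> S = N m" if "submodule (N m) R M" for N and m :: nat
    using M.submodule_dest(1)[OF that] by blast
  then show ?thesis
    using S(1) unfolding good_def dcc_def by metis
qed

locale artin_alg =
  fixes R :: "('r, 's) ring_scheme" and \<Lambda> :: "('r, 'l) module"
  assumes artin_algebra: "artin_algebra R \<Lambda>"
begin

sublocale R: cring R using artin_algebra by (simp add: artin_algebra_def)
sublocale L: ring \<Lambda> using artin_algebra by (simp add: artin_algebra_def)
sublocale RL: right_module R \<Lambda>
  using artin_algebra by (simp add: artin_algebra_def right_module_cring_iff)

text \<open>The structure map of the algebra; by \<open>scalar_mult\<close> its values are central
  in \<Lambda>.\<close>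

definition scalar :: "'r \<Rightarrow> 'l" where "scalar r = r \<odot>\<^bsub>\<Lambda>\<^esub> \<one>\<^bsub>\<Lambda>\<^esub>"

lemma scalar_closed [simp]: "r \<in> carrier R \<Longrightarrow> scalar r \<in> carrier \<Lambda>"
  by (simp add: scalar_def RL.smult_closed)

lemma scalar_mult:
  assumes "r \<in> carrier R" "a \<in> carrier \<Lambda>"
  shows "scalar r \<otimes>\<^bsub>\<Lambda>\<^esub> a = r \<odot>\<^bsub>\<Lambda>\<^esub> a" "a \<otimes>\<^bsub>\<Lambda>\<^esub> scalar r = r \<odot>\<^bsub>\<Lambda>\<^esub> a"
  using artin_algebra assms L.one_closed unfolding scalar_def artin_algebra_def
  by (metis L.l_one, metis L.r_one)

lemma scalar_simps:
  assumes "r \<in> carrier R" "s \<in> carrier R"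
  shows "scalar (r \<oplus>\<^bsub>R\<^esub> s) = scalar r \<oplus>\<^bsub>\<Lambda>\<^esub> scalar s"
    and "scalar (r \<otimes>\<^bsub>R\<^esub> s) = scalar r \<otimes>\<^bsub>\<Lambda>\<^esub> scalar s"
  using assms
  by (simp_all add: scalar_mult(2)) (simp_all add: scalar_def RL.smult_distr_ring RL.smult_assoc_right)

lemma scalar_one: "scalar \<one>\<^bsub>R\<^esub> = \<one>\<^bsub>\<Lambda>\<^esub>"
  by (simp add: scalar_def RL.smult_one)

lemma restrict_scalars_simps [simp]:
  "carrier (restrict_scalars \<Lambda> M) = carrier M"
  "\<zero>\<^bsub>restrict_scalars \<Lambda> M\<^esub> = \<zero>\<^bsub>M\<^esub>"
  "x \<oplus>\<^bsub>restrict_scalars \<Lambda> M\<^esub> y = x \<oplus>\<^bsub>M\<^esub> y"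
  "r \<odot>\<^bsub>restrict_scalars \<Lambda> M\<^esub> x = scalar r \<odot>\<^bsub>M\<^esub> x"
  by (simp_all add: restrict_scalars_def scalar_def)

lemma right_module_restrict_scalars:
  assumes "right_module \<Lambda> M"
  shows "right_module R (restrict_scalars \<Lambda> M)"
proof -
  interpret M: right_module \<Lambda> M by fact
  have "abelian_group (restrict_scalars \<Lambda> M)"
  proof (rule abelian_groupI, goal_cases)
    case (6 x)
    then show ?case by (intro bexI[of _ "\<ominus>\<^bsub>M\<^esub> x"]) (auto simp: M.M.l_neg)
  qed (auto simp: M.M.a_ac)
  then show ?thesis
    using R.ring_axioms
    by (intro right_module.intro right_module_axioms.intro)
      (auto simp: M.smult_closed M.smult_distr_ring M.smult_distr_module M.smult_assoc_right
        M.smult_one scalar_simps scalar_one)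
qed

lemma submodule_restrict_scalars:
  assumes "right_module \<Lambda> M" "submodule U \<Lambda> M"
  shows "submodule U R (restrict_scalars \<Lambda> M)"
proof -
  interpret M: right_module \<Lambda> M by fact
  interpret M': right_module R "restrict_scalars \<Lambda> M" by (rule right_module_restrict_scalars[OF assms(1)])
  show ?thesis using M.submodule_dest[OF assms(2)] by (intro M'.submodule_intro) auto
qed

text \<open>If \<open>C\<close> generates \<Lambda> over \<open>R\<close> and \<open>B\<close>
  generates \<open>M\<close> over \<Lambda>, the products of their elements generate
  \<open>M\<close> over \<open>R\<close>.\<close>

lemma fg_restrict_scalars:
  assumes "fg_module \<Lambda> M"
  shows "fg_module R (restrict_scalars \<Lambda> M)"
proof -
  obtain B where B: "right_module \<Lambda> M" "finite B" "generates \<Lambda> M B"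
    using fg_moduleE[OF assms] .
  interpret M: right_module \<Lambda> M by fact
  let ?M = "restrict_scalars \<Lambda> M"
  have M': "right_module R ?M" by (rule right_module_restrict_scalars[OF B(1)])
  interpret M': right_module R ?M by (rule M')
  have "fg_module R \<Lambda>"
    using artin_algebra RL.right_module_axioms by (simp add: fg_module_def artin_algebra_def)
  then obtain C where C: "finite C" "generates R \<Lambda> C" using fg_moduleE by blast
  have BM: "B \<subseteq> carrier M" and CL: "C \<subseteq> carrier \<Lambda>" using B C by (auto simp: generates_def)
  let ?D = "(\<lambda>(c, b). c \<odot>\<^bsub>M\<^esub> b) ` (C \<times> B)"
  have gen: "generates R ?M ?D"
    unfolding generates_def
  proof (intro conjI allI impI)
    show "?D \<subseteq> carrier ?M" using BM CL by (auto simp: M.smult_closed subset_iff)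
    fix U assume *: "submodule U R ?M \<and> ?D \<subseteq> U"
    note U = M'.submodule_dest[OF conjunct1[OF *], simplified]
    have b: "a \<odot>\<^bsub>M\<^esub> b \<in> U" if "b \<in> B" "a \<in> carrier \<Lambda>" for a b
    proof -
      have bM: "b \<in> carrier M" using that BM by auto
      have "submodule {a \<in> carrier \<Lambda>. a \<odot>\<^bsub>M\<^esub> b \<in> U} R \<Lambda>"
      proof (rule RL.submodule_intro)
        show "r \<odot>\<^bsub>\<Lambda>\<^esub> x \<in> {a \<in> carrier \<Lambda>. a \<odot>\<^bsub>M\<^esub> b \<in> U}"
          if "r \<in> carrier R" "x \<in> {a \<in> carrier \<Lambda>. a \<odot>\<^bsub>M\<^esub> b \<in> U}" for r x
          using that bM U(4)[of r "x \<odot>\<^bsub>M\<^esub> b"]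
          by (simp add: RL.smult_closed scalar_mult(2)[symmetric] M.smult_assoc_right)
      qed (use U bM in \<open>auto simp: M.smult_zero_left M.smult_distr_ring\<close>)
      moreover have "C \<subseteq> {a \<in> carrier \<Lambda>. a \<odot>\<^bsub>M\<^esub> b \<in> U}" using * that(1) CL by auto
      ultimately have "{a \<in> carrier \<Lambda>. a \<odot>\<^bsub>M\<^esub> b \<in> U} = carrier \<Lambda>" 
        by (rule generatesD[OF C(2)])
      then show ?thesis using that(2) by blast
    qed
    \<comment> \<open>\<open>U\<close> is stable under \<open>R\<close> only. The elements all of
      whose \<Lambda>-multiples lie in \<open>U\<close> form a \<Lambda>-submodule inside it, and to
      this one the generating property of \<open>B\<close> applies.\<close>
    let ?W = "{x \<in> carrier M. \<forall>a\<in>carrier \<Lambda>. a \<odot>\<^bsub>M\<^esub> x \<in> U}"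
    have "submodule ?W \<Lambda> M"
      using U by (intro M.submodule_intro)
        (auto simp: M.smult_zero_right M.smult_distr_module M.smult_closed M.smult_assoc_right[symmetric])
    moreover have "B \<subseteq> ?W" using b BM by auto
    ultimately have "?W = carrier M" by (rule generatesD[OF B(3)])
    then have "x \<in> U" if "x \<in> carrier M" for x
      using that M.smult_one[OF that] L.one_closed by (metis (mono_tags, lifting) mem_Collect_eq)
    then show "U = carrier ?M" using U(1) by auto
  qed
  show ?thesis by (rule fg_moduleI[OF M' _ gen]) (use B(2) C(1) in simp)
qed

text \<open>Submodules over \<Lambda> are in particular submodules over \<open>R\<close>, so the
  chain condition over \<open>R\<close> passes to \<Lambda>.\<close>

lemma fg_module_dcc:
  assumes "fg_module \<Lambda> M"
  shows "dcc \<Lambda> M"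
proof -
  have M: "right_module \<Lambda> M" using assms by (simp add: fg_module_def)
  have "dcc R (restrict_scalars \<Lambda> M)"
    using artin_algebra fg_artinian_ring_dcc[OF R.is_cring _ fg_restrict_scalars[OF assms]]
    by (simp add: artin_algebra_def)
  then show ?thesis
    using submodule_restrict_scalars[OF M] unfolding dcc_def by blast
qed

end

section \<open>Indecomposable projective modules and projective covers\<close>

text \<open>
  Choose \<open>X\<close> minimal with \<open>X + V = P\<close> and then \<open>Y \<subseteq> V\<close> minimal with \<open>Y + X = P\<close>. Then \<open>X \<inter> Y\<close> is
  superfluous in both \<open>X\<close> and \<open>Y\<close>, and projectivity of \<open>P\<close> forces \<open>X \<inter> Y = 0\<close>.
\<close>

lemma indecomposable_projective_superfluous:
  assumes P: "fg_module A P" "projective_module A P" "indecomposable_module A P" and "dcc A P"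
    and V: "submodule V A P" "V \<noteq> carrier P"
  shows "superfluous_submodule A P V"
proof -
  have PM: "right_module A P" using P(1) by (simp add: fg_module_def)
  interpret right_module A P by fact
  let ?SX = "{X. submodule X A P \<and> X <+>\<^bsub>P\<^esub> V = carrier P}"
  have carr: "U <+>\<^bsub>P\<^esub> W = carrier P \<longleftrightarrow> (\<forall>x\<in>carrier P. \<exists>u\<in>U. \<exists>w\<in>W. x = u \<oplus>\<^bsub>P\<^esub> w)"
    if "submodule U A P" "submodule W A P" for U W
    using submodule_dest(1)[OF submodule_set_add[OF that]] set_add_iff[of _ U W] by blast
  have "carrier P \<in> ?SX"
    using submodule_carrier set_add_superset(1)[OF submodule_carrier V(1)]
      submodule_dest(1)[OF submodule_set_add[OF submodule_carrier V(1)]] by blast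
  then have "\<exists>X\<in>?SX. \<forall>W\<in>?SX. W \<subseteq> X \<longrightarrow> W = X" by (intro dcc_minimal[OF assms(4)]) auto
  then obtain X where X: "submodule X A P" "X <+>\<^bsub>P\<^esub> V = carrier P"
    and Xmin: "\<And>X'. \<lbrakk>submodule X' A P; X' <+>\<^bsub>P\<^esub> V = carrier P; X' \<subseteq> X\<rbrakk> \<Longrightarrow> X' = X"
    by auto
  let ?SY = "{Y. submodule Y A P \<and> Y \<subseteq> V \<and> Y <+>\<^bsub>P\<^esub> X = carrier P}"
  note X' = submodule_dest[OF X(1)] and V' = submodule_dest[OF V(1)]
  have "V <+>\<^bsub>P\<^esub> X = carrier P"
    using X(2) set_add_commute[OF X'(1) V'(1)] by simp
  then have "V \<in> ?SY" using V by simp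
  then have "\<exists>Y\<in>?SY. \<forall>W\<in>?SY. W \<subseteq> Y \<longrightarrow> W = Y" by (intro dcc_minimal[OF assms(4)]) auto
  then obtain Y where Y: "submodule Y A P" "Y \<subseteq> V" "Y <+>\<^bsub>P\<^esub> X = carrier P"
    and Ymin: "\<And>Y'. \<lbrakk>submodule Y' A P; Y' \<subseteq> V; Y' <+>\<^bsub>P\<^esub> X = carrier P; Y' \<subseteq> Y\<rbrakk> \<Longrightarrow> Y' = Y"
    by auto
  note Y' = submodule_dest[OF Y(1)]
  let ?K = "X \<inter> Y"
  have K: "submodule ?K A P" using submodule_Int[OF X(1) Y(1)] .
  note K' = submodule_dest[OF K]
  \<comment> \<open>\<open>X \<inter> Y\<close> lies in \<open>V\<close>, so a \<open>U\<close> that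
    reaches \<open>X\<close> modulo \<open>X \<inter> Y\<close> still gives \<open>P\<close> when
    added to \<open>V\<close>, and minimality of \<open>X\<close> applies.\<close>
  have Xsup: "U = X" if U: "submodule U A P" "U \<subseteq> X" "\<And>x. x \<in> X \<Longrightarrow> \<exists>u\<in>U. \<exists>k\<in>?K. x = u \<oplus>\<^bsub>P\<^esub> k" for U
  proof (rule Xmin[OF U(1) _ U(2)], unfold carr[OF U(1) V(1)], rule ballI)
    fix x assume "x \<in> carrier P"
    then obtain y v where yv: "y \<in> X" "v \<in> V" "x = y \<oplus>\<^bsub>P\<^esub> v" using X(2) carr[OF X(1) V(1)] by blast
    obtain u k where uk: "u \<in> U" "k \<in> ?K" "y = u \<oplus>\<^bsub>P\<^esub> k" using U(3)[OF yv(1)] by blast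
    have "u \<in> carrier P" "k \<in> carrier P" "v \<in> carrier P" using uk U(2) X'(1) yv V'(1) by auto
    then have "x = u \<oplus>\<^bsub>P\<^esub> (k \<oplus>\<^bsub>P\<^esub> v)" using uk yv by (simp add: M.a_assoc)
    moreover have "k \<oplus>\<^bsub>P\<^esub> v \<in> V" using uk yv Y(2) V'(3) by auto
    ultimately show "\<exists>u\<in>U. \<exists>v\<in>V. x = u \<oplus>\<^bsub>P\<^esub> v" using uk(1) by blast
  qed
  \<comment> \<open>The same for \<open>Y\<close>, with \<open>X\<close> in the role of
    \<open>V\<close>, since \<open>X \<inter> Y\<close> lies in \<open>X\<close>.\<close>
  have Ysup: "U = Y" if U: "submodule U A P" "U \<subseteq> Y" "\<And>x. x \<in> Y \<Longrightarrow> \<exists>u\<in>U. \<exists>k\<in>?K. x = u \<oplus>\<^bsub>P\<^esub> k" for U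
  proof (rule Ymin[OF U(1) _ _ U(2)], use U Y in blast, unfold carr[OF U(1) X(1)], rule ballI)
    fix x assume "x \<in> carrier P"
    then obtain y v where yv: "y \<in> Y" "v \<in> X" "x = y \<oplus>\<^bsub>P\<^esub> v" using Y(3) carr[OF Y(1) X(1)] by blast
    obtain u k where uk: "u \<in> U" "k \<in> ?K" "y = u \<oplus>\<^bsub>P\<^esub> k" using U(3)[OF yv(1)] by blast
    have "u \<in> carrier P" "k \<in> carrier P" "v \<in> carrier P" using uk U(2) X'(1) Y'(1) yv by auto
    then have "x = u \<oplus>\<^bsub>P\<^esub> (k \<oplus>\<^bsub>P\<^esub> v)" using uk yv by (simp add: M.a_assoc)
    moreover have "k \<oplus>\<^bsub>P\<^esub> v \<in> X" using uk yv X'(3) by auto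
    ultimately show "\<exists>u\<in>U. \<exists>v\<in>X. x = u \<oplus>\<^bsub>P\<^esub> v" using uk(1) by blast
  qed
  let ?X = "P\<lparr>carrier := X\<rparr>" and ?Y = "P\<lparr>carrier := Y\<rparr>"
  have XM: "right_module A ?X" and YM: "right_module A ?Y"
    using right_module_submodule X(1) Y(1) by auto
  have iX: "(\<lambda>x. x) \<in> mod_hom A ?X P" "(\<lambda>x. x) \<in> mod_hom A ?Y P"
    using X'(1) Y'(1) by (auto simp: mod_hom_def)
  have q: "(\<lambda>(x, y). x \<oplus>\<^bsub>P\<^esub> y) \<in> mod_hom A (direct_sum ?X ?Y) P"
    using mod_hom_copair[OF XM YM PM iX] .
  have "(\<lambda>x. x) ` carrier P \<subseteq> (\<lambda>(x, y). x \<oplus>\<^bsub>P\<^esub> y) ` carrier (direct_sum ?X ?Y)"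
  proof
    fix x assume "x \<in> (\<lambda>x. x) ` carrier P"
    then obtain y v where yv: "y \<in> Y" "v \<in> X" "x = y \<oplus>\<^bsub>P\<^esub> v" using Y(3) carr[OF Y(1) X(1)] by blast
    then have "x = v \<oplus>\<^bsub>P\<^esub> y" using X'(1) Y'(1) M.a_comm by blast
    then show "x \<in> (\<lambda>(x, y). x \<oplus>\<^bsub>P\<^esub> y) ` carrier (direct_sum ?X ?Y)"
      using yv by (intro image_eqI[of _ _ "(v, y)"]) auto
  qed
  \<comment> \<open>Projectivity splits the addition map from the direct sum of \<open>X\<close> and
    \<open>Y\<close>. The components \<open>s1\<close> and \<open>s2\<close> of the section add up
    to the identity of \<open>P\<close>, so \<open>s2\<close> maps \<open>X\<close>, and
    \<open>s1\<close> maps \<open>Y\<close>, into \<open>X \<inter> Y\<close>.\<close>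
  from projective_lift[OF P(1,2) right_module_direct_sum[OF XM YM] PM q mod_hom_id this]
  obtain s where s: "s \<in> mod_hom A P (direct_sum ?X ?Y)"
    "\<And>x. x \<in> carrier P \<Longrightarrow> (case s x of (x, y) \<Rightarrow> x \<oplus>\<^bsub>P\<^esub> y) = x" by blast
  define s1 s2 where "s1 = (\<lambda>x. fst (s x))" and "s2 = (\<lambda>x. snd (s x))"
  have s1: "s1 \<in> mod_hom A P P"
    using mod_hom_comp[OF mod_hom_comp[OF s(1) direct_sum_homs(3)[OF XM YM]] iX(1)] by (simp add: s1_def)
  have s2: "s2 \<in> mod_hom A P P"
    using mod_hom_comp[OF mod_hom_comp[OF s(1) direct_sum_homs(4)[OF XM YM]] iX(2)] by (simp add: s2_def)
  have sX: "s1 x \<in> X" "s2 x \<in> Y" if "x \<in> carrier P" for x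
    using mod_hom_closed[OF s(1) that] by (auto simp: s1_def s2_def)
  have sum: "s1 x \<oplus>\<^bsub>P\<^esub> s2 x = x" if "x \<in> carrier P" for x
    using s(2)[OF that] by (simp add: s1_def s2_def split_beta)
  have sc: "s1 x \<in> carrier P" "s2 x \<in> carrier P" if "x \<in> carrier P" for x
    using sX[OF that] X'(1) Y'(1) by auto
  have s2X: "s2 x \<in> ?K" if "x \<in> X" for x
  proof -
    have x: "x \<in> carrier P" using that X'(1) by auto
    then have "s2 x = x \<ominus>\<^bsub>P\<^esub> s1 x"
      using add_diff_cancel(2)[OF sc[OF x]] sum[OF x] by simp
    then show ?thesis using sX[OF x] X'(6) that by auto
  qed
  have s1Y: "s1 x \<in> ?K" if "x \<in> Y" for x
  proof -
    have x: "x \<in> carrier P" using that Y'(1) by auto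
    then have "s1 x = x \<ominus>\<^bsub>P\<^esub> s2 x"
      using add_diff_cancel(1)[OF sc[OF x]] sum[OF x] by simp
    then show ?thesis using sX[OF x] Y'(6) that by auto
  qed
  \<comment> \<open>For \<open>y\<close> in \<open>Y\<close> the term \<open>s1 y\<close> of
    \<open>y = s2 y + s1 y\<close> lies in \<open>X \<inter> Y\<close>, so the image reaches
    \<open>Y\<close> modulo \<open>X \<inter> Y\<close>. The gain is that every element of
    \<open>Y\<close> is some \<open>s2 p\<close> with \<open>s1 p\<close> in
    \<open>X \<inter> Y\<close>.\<close>
  have Yeq: "s2 ` {p \<in> carrier P. s1 p \<in> ?K} = Y"
  proof (rule Ysup)
    show "submodule (s2 ` {p \<in> carrier P. s1 p \<in> ?K}) A P"
      using submodule_image[OF PM PM s2 submodule_vimage[OF PM PM s1 K]] .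
    show "s2 ` {p \<in> carrier P. s1 p \<in> ?K} \<subseteq> Y" using sX by auto
    fix y assume y: "y \<in> Y"
    then have yP: "y \<in> carrier P" using Y'(1) by auto
    then have "y = s2 y \<oplus>\<^bsub>P\<^esub> s1 y" using sum sc M.a_comm by metis
    then show "\<exists>u\<in>s2 ` {p \<in> carrier P. s1 p \<in> ?K}. \<exists>k\<in>?K. y = u \<oplus>\<^bsub>P\<^esub> k"
      using s1Y[OF y] yP by blast
  qed
  \<comment> \<open>An element \<open>x\<close> of \<open>X\<close> is corrected by some
    \<open>p\<close> with \<open>s2 p = s2 x\<close> and \<open>s1 p\<close> in
    \<open>X \<inter> Y\<close>: then \<open>s2\<close> kills \<open>x - p\<close>, and
    \<open>x\<close> is \<open>s1 (x - p)\<close> plus the element \<open>s1 p + s2 x\<close> of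
    \<open>X \<inter> Y\<close>.\<close>
  have Xeq: "s1 ` {p \<in> carrier P. s2 p \<in> {\<zero>\<^bsub>P\<^esub>}} = X"
  proof (rule Xsup)
    show "submodule (s1 ` {p \<in> carrier P. s2 p \<in> {\<zero>\<^bsub>P\<^esub>}}) A P"
      using submodule_image[OF PM PM s1 submodule_vimage[OF PM PM s2 submodule_zero]] .
    show "s1 ` {p \<in> carrier P. s2 p \<in> {\<zero>\<^bsub>P\<^esub>}} \<subseteq> X" using sX by auto
    fix x assume x: "x \<in> X"
    then have xP: "x \<in> carrier P" using X'(1) by auto
    have "s2 x \<in> s2 ` {p \<in> carrier P. s1 p \<in> ?K}" using Yeq s2X[OF x] by simp
    then obtain p where "s2 x = s2 p" "p \<in> {p \<in> carrier P. s1 p \<in> ?K}" by (rule imageE)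
    then have p: "p \<in> carrier P" "s1 p \<in> ?K" "s2 p = s2 x" by simp_all
    have "s2 (x \<ominus>\<^bsub>P\<^esub> p) = \<zero>\<^bsub>P\<^esub>"
      using mod_hom_minus[OF PM PM s2 xP p(1)] p(3) sc[OF xP] by (simp add: add_minus_cancel)
    then have "s1 (x \<ominus>\<^bsub>P\<^esub> p) \<in> s1 ` {p \<in> carrier P. s2 p \<in> {\<zero>\<^bsub>P\<^esub>}}" using xP p(1) by auto
    moreover have "x = s1 (x \<ominus>\<^bsub>P\<^esub> p) \<oplus>\<^bsub>P\<^esub> (s1 p \<oplus>\<^bsub>P\<^esub> s2 x)"
    proof -
      have "s1 (x \<ominus>\<^bsub>P\<^esub> p) \<oplus>\<^bsub>P\<^esub> (s1 p \<oplus>\<^bsub>P\<^esub> s2 x) = ((s1 x \<ominus>\<^bsub>P\<^esub> s1 p) \<oplus>\<^bsub>P\<^esub> s1 p) \<oplus>\<^bsub>P\<^esub> s2 x"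
        using mod_hom_minus[OF PM PM s1 xP p(1)] sc xP p(1) by (simp add: M.a_assoc)
      also have "\<dots> = x" using sc xP p(1) sum[OF xP] by (simp add: add_minus_cancel)
      finally show ?thesis by simp
    qed
    moreover have "s1 p \<oplus>\<^bsub>P\<^esub> s2 x \<in> ?K" using p(2) s2X[OF x] K'(3) by blast
    ultimately show "\<exists>u\<in>s1 ` {p \<in> carrier P. s2 p \<in> {\<zero>\<^bsub>P\<^esub>}}. \<exists>k\<in>?K. x = u \<oplus>\<^bsub>P\<^esub> k" by blast
  qed
  \<comment> \<open>If \<open>s2 p\<close> vanishes then \<open>p = s1 p\<close>, so by the previous
    equality \<open>s2\<close> vanishes on \<open>X\<close>. It will also be the identity on
    \<open>Y\<close>, which leaves only zero in \<open>X \<inter> Y\<close>.\<close>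
  have s2X0: "s2 x = \<zero>\<^bsub>P\<^esub>" if "x \<in> X" for x
  proof -
    have "x \<in> s1 ` {p \<in> carrier P. s2 p \<in> {\<zero>\<^bsub>P\<^esub>}}" using Xeq that by simp
    then obtain p where p: "p \<in> carrier P" "s2 p = \<zero>\<^bsub>P\<^esub>" "x = s1 p" by auto
    then have "x = p" using sum[OF p(1)] sc[OF p(1)] by simp
    then show ?thesis using p by simp
  qed
  have s2Y: "s2 y = y" if "y \<in> Y" for y
  proof -
    have "y \<in> s2 ` {p \<in> carrier P. s1 p \<in> ?K}" using Yeq that by simp
    then obtain p where "y = s2 p" "p \<in> {p \<in> carrier P. s1 p \<in> ?K}" by (rule imageE)
    then have p: "p \<in> carrier P" "s1 p \<in> ?K" "y = s2 p" by simp_all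
    have "s2 p = s2 (s1 p) \<oplus>\<^bsub>P\<^esub> s2 (s2 p)"
      using mod_hom_add[OF s2 sc[OF p(1)]] sum[OF p(1)] by simp
    then show ?thesis using s2X0[of "s1 p"] p sc[OF p(1)] sc(2)[OF sc(2)[OF p(1)]] by simp
  qed
  have "x = \<zero>\<^bsub>P\<^esub>" if "x \<in> X" "x \<in> Y" for x using s2X0[OF that(1)] s2Y[OF that(2)] by simp
  then have "X \<inter> Y = {\<zero>\<^bsub>P\<^esub>}" using X'(2) Y'(2) by blast
  moreover have "X <+>\<^bsub>P\<^esub> Y = carrier P"
    using Y(3) set_add_commute[OF X'(1) Y'(1)] by simp
  ultimately have "X = {\<zero>\<^bsub>P\<^esub>} \<or> Y = {\<zero>\<^bsub>P\<^esub>}"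
    using P(3) X(1) Y(1) unfolding indecomposable_module_def by blast
  moreover have "X \<noteq> {\<zero>\<^bsub>P\<^esub>}"
  proof
    assume "X = {\<zero>\<^bsub>P\<^esub>}"
    then have "carrier P \<subseteq> V" using X(2) set_add_le[OF V(1) _ order_refl, of X] V'(2) by auto
    then show False using V V'(1) by blast
  qed
  ultimately have "X = carrier P"
    using Y(3) set_add_le[OF X(1) _ order_refl, of Y] X'(1,2) by auto
  then show ?thesis
    using Xmin V(1) submodule_dest(1) unfolding superfluous_submodule_def by blast
qed

lemma indecomposable_projective_rad:
  assumes P: "fg_module A P" "projective_module A P" "indecomposable_module A P" and "dcc A P"
  shows "submodule (module_rad A P) A P" "module_rad A P \<noteq> carrier P"
    and "\<And>V. \<lbrakk>submodule V A P; V \<noteq> carrier P\<rbrakk> \<Longrightarrow> V \<subseteq> module_rad A P"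
proof -
  obtain B where B: "right_module A P" "finite B" "generates A P B"
    using fg_moduleE[OF P(1)] .
  interpret right_module A P by (fact B)
  let ?p = "\<lambda>V. submodule V A P \<and> V \<noteq> carrier P"
  let ?W = "\<Union> {V. ?p V}"
  have zero: "?p {\<zero>\<^bsub>P\<^esub>}" using submodule_zero P(3) by (auto simp: indecomposable_module_def)
  have sum: "?p (U <+>\<^bsub>P\<^esub> V)" if "?p U" "?p V" for U V
    using indecomposable_projective_superfluous[OF assms, of V] that submodule_set_add[of U V]
    unfolding superfluous_submodule_def by blast
  have W: "submodule ?W A P"
  proof (rule submodule_intro)
    show "?W \<subseteq> carrier P" using submodule_dest(1) by blast
    show "\<zero>\<^bsub>P\<^esub> \<in> ?W" using zero by blast
    show "a \<odot>\<^bsub>P\<^esub> x \<in> ?W" if "a \<in> carrier A" "x \<in> ?W" for a x using submodule_dest(4) that by blast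
    show "x \<oplus>\<^bsub>P\<^esub> y \<in> ?W" if xy: "x \<in> ?W" "y \<in> ?W" for x y
    proof -
      obtain U V where UV: "?p U" "?p V" "x \<in> U" "y \<in> V" using xy by blast
      then have "x \<oplus>\<^bsub>P\<^esub> y \<in> U <+>\<^bsub>P\<^esub> V" unfolding set_add_iff by blast
      then show ?thesis using sum[OF UV(1,2)] by blast
    qed
  qed
  \<comment> \<open>A finite subset of the union lies in a single proper submodule, so no finite
    generating set is contained in the union.\<close>
  have "\<exists>V. ?p V \<and> C \<subseteq> V" if "finite C" "C \<subseteq> ?W" for C
    using that
  proof (induction C rule: finite_induct)
    case (insert c C)
    then obtain V U where "?p V" "C \<subseteq> V" "?p U" "c \<in> U" by auto
    then have "?p (U <+>\<^bsub>P\<^esub> V)" "insert c C \<subseteq> U <+>\<^bsub>P\<^esub> V"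
      using sum set_add_superset[of U V] by blast+
    then show ?case by blast
  qed (use zero in blast)
  then have Wp: "?W \<noteq> carrier P" using B(2,3) unfolding generates_def by metis
  obtain W where le: "\<And>V. \<lbrakk>submodule V A P; V \<noteq> carrier P\<rbrakk> \<Longrightarrow> V \<subseteq> W"
    and W: "submodule W A P" "W \<noteq> carrier P"
    using W Wp by (intro that[of ?W]) blast+
  have "maximal_submodule A P V \<longleftrightarrow> V = W" for V
  proof
    assume V: "maximal_submodule A P V"
    then have "V \<subseteq> W" by (intro le) (auto simp: maximal_submodule_def)
    then show "V = W" using V W unfolding maximal_submodule_def by blast
  next
    assume V: "V = W"
    have "N = W \<or> N = carrier P" if "submodule N A P" "W \<subseteq> N" for N
      using le[OF that(1)] that(2) by blast
    then show "maximal_submodule A P V"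
      unfolding maximal_submodule_def V using W by blast
  qed
  then have "module_rad A P = W" using submodule_dest(1)[OF W(1)] by (auto simp: module_rad_def)
  then show "submodule (module_rad A P) A P" "module_rad A P \<noteq> carrier P"
    "\<And>V. \<lbrakk>submodule V A P; V \<noteq> carrier P\<rbrakk> \<Longrightarrow> V \<subseteq> module_rad A P"
    using W le by simp_all
qed

section \<open>Endomorphisms of projective covers\<close>

text \<open>Superfluity of the kernel makes \<open>t\<close> onto, hence split by some
  \<open>j\<close>. As \<open>j\<close> covers the inverse of \<eta> it is onto as well, and a
  surjective section makes \<open>t\<close> injective.\<close>

lemma projective_cover_lift_bij:
  assumes Q: "projective_cover A Q q M" and M: "right_module A M"
    and t: "t \<in> mod_hom A Q Q" and \<eta>: "bij_betw \<eta> (carrier M) (carrier M)"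
    and comm: "\<And>x. x \<in> carrier Q \<Longrightarrow> q (t x) = \<eta> (q x)"
  shows "bij_betw t (carrier Q) (carrier Q)"
proof -
  have fg: "fg_module A Q" and pr: "projective_module A Q" and q: "q \<in> mod_hom A Q M"
    and qs: "q ` carrier Q = carrier M" and sup: "superfluous_submodule A Q (mod_ker Q M q)"
    using Q by (auto simp: projective_cover_def)
  have QM: "right_module A Q" using fg by (simp add: fg_module_def)
  interpret Q: right_module A Q by fact
  have im: "h ` carrier Q = carrier Q"
    if "h \<in> mod_hom A Q Q" "q ` (h ` carrier Q) = carrier M" for h
    using superfluous_surj[OF QM M q sup submodule_image[OF QM QM that(1) Q.submodule_carrier]] that qs by simp
  have "q ` (t ` carrier Q) = \<eta> ` (q ` carrier Q)" using comm by (force simp: image_image)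
  then have ts: "t ` carrier Q = carrier Q" using im[OF t] \<eta> qs by (simp add: bij_betw_def)
  obtain j where j: "j \<in> mod_hom A Q Q" "\<And>x. x \<in> carrier Q \<Longrightarrow> t (j x) = x"
    using projective_lift[OF fg pr QM QM t mod_hom_id] ts by auto
  have "carrier M \<subseteq> q ` (j ` carrier Q)"
  proof
    fix y assume y: "y \<in> carrier M"
    then have "\<eta> y \<in> carrier M" using \<eta> by (auto simp: bij_betw_def)
    then obtain x where x: "x \<in> carrier Q" "q x = \<eta> y" using qs by (metis imageE)
    have jx: "j x \<in> carrier Q" using mod_hom_closed[OF j(1) x(1)] .
    have "\<eta> y = \<eta> (q (j x))" using comm[OF jx] j(2)[OF x(1)] x(2) by simp
    then have "y = q (j x)" using \<eta> y mod_hom_closed[OF q jx] by (auto simp: bij_betw_def inj_on_def)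
    then show "y \<in> q ` (j ` carrier Q)" using x(1) by blast
  qed
  moreover have "q ` (j ` carrier Q) \<subseteq> carrier M"
    using mod_hom_closed[OF q] mod_hom_closed[OF j(1)] by auto
  ultimately have js: "j ` carrier Q = carrier Q" using im[OF j(1)] by blast
  have "inj_on t (carrier Q)"
  proof (rule inj_onI)
    fix x y assume xy: "x \<in> carrier Q" "y \<in> carrier Q" "t x = t y"
    then have "x \<in> j ` carrier Q" "y \<in> j ` carrier Q" using js by simp_all
    then obtain a b where ab: "a \<in> carrier Q" "b \<in> carrier Q" "x = j a" "y = j b" by (elim imageE)
    then have "a = b" using j(2)[OF ab(1)] j(2)[OF ab(2)] xy(3) by simp
    then show "x = y" using ab by simp
  qed
  then show ?thesis using ts by (simp add: bij_betw_def)
qed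

section \<open>The Nakayama functor\<close>

lemma hom_to_ring_simps [simp]:
  "carrier (hom_to_ring A M) = mod_hom A M (regular_module A) \<inter> extensional (carrier M)"
  "\<zero>\<^bsub>hom_to_ring A M\<^esub> = (\<lambda>x\<in>carrier M. \<zero>\<^bsub>A\<^esub>)"
  "\<phi> \<oplus>\<^bsub>hom_to_ring A M\<^esub> \<psi> = (\<lambda>x\<in>carrier M. \<phi> x \<oplus>\<^bsub>A\<^esub> \<psi> x)"
  "a \<odot>\<^bsub>hom_to_ring A M\<^esub> \<phi> = (\<lambda>x\<in>carrier M. a \<otimes>\<^bsub>A\<^esub> \<phi> x)"
  by (simp_all add: hom_to_ring_def)

lemma hom_to_ring_restrict:
  assumes "right_module A M" "\<phi> \<in> mod_hom A M (regular_module A)"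
  shows "restrict \<phi> (carrier M) \<in> carrier (hom_to_ring A M)"
  using mod_hom_cong[OF assms, of "restrict \<phi> (carrier M)"] by simp

lemma hom_to_ring_closed:
  assumes M: "right_module A M" and \<phi>: "\<phi> \<in> carrier (hom_to_ring A M)"
  shows "\<psi> \<in> carrier (hom_to_ring A M) \<Longrightarrow> \<phi> \<oplus>\<^bsub>hom_to_ring A M\<^esub> \<psi> \<in> carrier (hom_to_ring A M)"
    and "a \<in> carrier A \<Longrightarrow> a \<odot>\<^bsub>hom_to_ring A M\<^esub> \<phi> \<in> carrier (hom_to_ring A M)"
proof -
  interpret right_module A M by fact
  have reg: "right_module A (regular_module A)" using right_module_regular[OF A.ring_axioms] .
  show "\<phi> \<oplus>\<^bsub>hom_to_ring A M\<^esub> \<psi> \<in> carrier (hom_to_ring A M)" if "\<psi> \<in> carrier (hom_to_ring A M)"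
    using hom_to_ring_restrict[OF M mod_hom_pointwise_add[OF reg, of \<phi> M \<psi>]] \<phi> that by simp
  show "a \<odot>\<^bsub>hom_to_ring A M\<^esub> \<phi> \<in> carrier (hom_to_ring A M)" if "a \<in> carrier A"
  proof -
    have "(\<lambda>x. a \<otimes>\<^bsub>A\<^esub> \<phi> x) \<in> mod_hom A M (regular_module A)"
      using \<phi> that mod_homD[of \<phi> A M "regular_module A"]
      by (intro mod_homI) (auto simp: A.r_distr A.m_assoc)
    from hom_to_ring_restrict[OF M this] show ?thesis by simp
  qed
qed

locale nakayama_functor = artin_alg R \<Lambda>
  for R :: "('r, 's) ring_scheme" and \<Lambda> :: "('r, 'l) module" +
  fixes J :: "('r, 'j) module" and P :: "('l, 'p) module"
  assumes J: "right_module R J" and P: "right_module \<Lambda> P"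
begin

sublocale J: right_module R J by (rule J)
sublocale P: right_module \<Lambda> P by (rule P)

abbreviation (input) "H \<equiv> hom_to_ring \<Lambda> P"
abbreviation (input) "N \<equiv> nakayama R J \<Lambda> P"

lemma nakayama_simps:
  "carrier N = mod_hom R (restrict_scalars \<Lambda> H) J \<inter> extensional (carrier H)"
  "\<zero>\<^bsub>N\<^esub> = (\<lambda>\<phi>\<in>carrier H. \<zero>\<^bsub>J\<^esub>)"
  "\<psi> \<oplus>\<^bsub>N\<^esub> \<psi>' = (\<lambda>\<phi>\<in>carrier H. \<psi> \<phi> \<oplus>\<^bsub>J\<^esub> \<psi>' \<phi>)"
  "a \<odot>\<^bsub>N\<^esub> \<psi> = (\<lambda>\<phi>\<in>carrier H. \<psi> (a \<odot>\<^bsub>H\<^esub> \<phi>))"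
  by (simp_all only: nakayama_def dual_module_def partial_object.simps monoid.simps ring.simps module.simps)

lemma nakayamaD:
  assumes "\<psi> \<in> carrier N"
  shows "\<phi> \<in> carrier H \<Longrightarrow> \<psi> \<phi> \<in> carrier J"
    and "\<lbrakk>\<phi> \<in> carrier H; \<phi>' \<in> carrier H\<rbrakk> \<Longrightarrow> \<psi> (\<phi> \<oplus>\<^bsub>H\<^esub> \<phi>') = \<psi> \<phi> \<oplus>\<^bsub>J\<^esub> \<psi> \<phi>'"
    and "\<lbrakk>r \<in> carrier R; \<phi> \<in> carrier H\<rbrakk> \<Longrightarrow> \<psi> (scalar r \<odot>\<^bsub>H\<^esub> \<phi>) = r \<odot>\<^bsub>J\<^esub> \<psi> \<phi>"
    and "\<psi> \<in> extensional (carrier H)"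
  using assms mod_homD[of \<psi> R "restrict_scalars \<Lambda> H" J]
  unfolding nakayama_simps restrict_scalars_simps by blast+

text \<open>The axioms are transported along \<open>q\<close>. What has to be shown is that
  \<open>q\<close> sends zero to the \<open>zero\<close> field: the value \<open>q 0\<close> equals
  its own double, and at each \<phi> this forces zero in \<open>J\<close>.\<close>

lemma right_module_nakayama:
  assumes Q: "right_module \<Lambda> Q" and q: "q \<in> mod_hom \<Lambda> Q N" "q ` carrier Q = carrier N"
  shows "right_module \<Lambda> N"
proof (rule right_module_image[OF Q q])
  interpret Q: right_module \<Lambda> Q by (rule Q)
  have z: "q \<zero>\<^bsub>Q\<^esub> \<in> carrier N" using mod_hom_closed[OF q(1)] by simp
  have "q \<zero>\<^bsub>Q\<^esub> = q \<zero>\<^bsub>Q\<^esub> \<oplus>\<^bsub>N\<^esub> q \<zero>\<^bsub>Q\<^esub>"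
    using mod_hom_add[OF q(1), of "\<zero>\<^bsub>Q\<^esub>" "\<zero>\<^bsub>Q\<^esub>"] by simp
  note eq = fun_cong[OF this]
  have *: "q \<zero>\<^bsub>Q\<^esub> \<phi> = q \<zero>\<^bsub>Q\<^esub> \<phi> \<oplus>\<^bsub>J\<^esub> q \<zero>\<^bsub>Q\<^esub> \<phi>" if "\<phi> \<in> carrier H" for \<phi>
    by (rule trans[OF eq]) (simp only: nakayama_simps(3) restrict_apply'[OF that])
  show "q \<zero>\<^bsub>Q\<^esub> = \<zero>\<^bsub>N\<^esub>"
    unfolding nakayama_simps(2)
  proof (rule extensionalityI[OF nakayamaD(4)[OF z] restrict_extensional])
    fix \<phi> assume \<phi>: "\<phi> \<in> carrier H"
    show "q \<zero>\<^bsub>Q\<^esub> \<phi> = (\<lambda>\<phi>\<in>carrier H. \<zero>\<^bsub>J\<^esub>) \<phi>"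
      unfolding restrict_apply'[OF \<phi>] using *[OF \<phi>] nakayamaD(1)[OF z \<phi>]
      by (metis J.M.add.r_cancel_one)
  qed
qed

text \<open>\<open>hom_to_ring\<close> carries a left action, so the combination is formed pointwise
  with values in the regular module. Membership is proved together with the formula because
  additivity of \<psi> in the induction step relies on it.\<close>

lemma nakayama_finsum:
  assumes \<psi>: "\<psi> \<in> carrier N" and "finite C"
    and c: "\<And>b. b \<in> C \<Longrightarrow> c b \<in> carrier \<Lambda>" and \<phi>: "\<And>b. b \<in> C \<Longrightarrow> \<phi> b \<in> carrier H"
  shows "(\<lambda>x\<in>carrier P. \<Oplus>\<^bsub>regular_module \<Lambda>\<^esub>b\<in>C. c b \<otimes>\<^bsub>\<Lambda>\<^esub> \<phi> b x) \<in> carrier H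
    \<and> \<psi> (\<lambda>x\<in>carrier P. \<Oplus>\<^bsub>regular_module \<Lambda>\<^esub>b\<in>C. c b \<otimes>\<^bsub>\<Lambda>\<^esub> \<phi> b x) = (\<Oplus>\<^bsub>J\<^esub>b\<in>C. \<psi> (c b \<odot>\<^bsub>H\<^esub> \<phi> b))"
  using assms(2) c \<phi>
proof (induction C rule: finite_induct)
  interpret reg: right_module \<Lambda> "regular_module \<Lambda>" by (rule right_module_regular[OF L.ring_axioms])
  case empty
  have "restrict (\<lambda>_. \<zero>\<^bsub>\<Lambda>\<^esub>) (carrier P) \<in> carrier H"
    by (rule hom_to_ring_restrict[OF P]) (use mod_hom_zero_map[OF reg.right_module_axioms] in simp)
  then have z: "\<zero>\<^bsub>H\<^esub> \<in> carrier H" by simp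
  have "\<zero>\<^bsub>H\<^esub> \<oplus>\<^bsub>H\<^esub> \<zero>\<^bsub>H\<^esub> = \<zero>\<^bsub>H\<^esub>" by (auto intro!: restrict_ext)
  then have "\<psi> \<zero>\<^bsub>H\<^esub> = \<psi> \<zero>\<^bsub>H\<^esub> \<oplus>\<^bsub>J\<^esub> \<psi> \<zero>\<^bsub>H\<^esub>" using nakayamaD(2)[OF \<psi> z z] by simp
  then have "\<psi> \<zero>\<^bsub>H\<^esub> = \<zero>\<^bsub>J\<^esub>" using nakayamaD(1)[OF \<psi> z] by (metis J.M.add.r_cancel_one)
  then show ?case
    using z unfolding hom_to_ring_simps reg.M.finsum_empty J.M.finsum_empty regular_module_simps by blast
next
  interpret reg: right_module \<Lambda> "regular_module \<Lambda>" by (rule right_module_regular[OF L.ring_axioms])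
  case (insert a C)
  let ?f = "\<lambda>C. \<lambda>x\<in>carrier P. \<Oplus>\<^bsub>regular_module \<Lambda>\<^esub>b\<in>C. c b \<otimes>\<^bsub>\<Lambda>\<^esub> \<phi> b x"
  have IH: "?f C \<in> carrier H" "\<psi> (?f C) = (\<Oplus>\<^bsub>J\<^esub>b\<in>C. \<psi> (c b \<odot>\<^bsub>H\<^esub> \<phi> b))"
    using insert.IH insert.prems by blast+
  have \<phi>x: "\<phi> b x \<in> carrier \<Lambda>" if "b \<in> insert a C" "x \<in> carrier P" for b x
    using insert.prems(2)[OF that(1)] that(2) mod_hom_closed[of "\<phi> b" \<Lambda> P "regular_module \<Lambda>" x] by simp
  have cl: "c b \<odot>\<^bsub>H\<^esub> \<phi> b \<in> carrier H" if "b \<in> insert a C" for b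
    using hom_to_ring_closed(2)[OF P insert.prems(2) insert.prems(1)] that by blast
  have eq: "?f (insert a C) = c a \<odot>\<^bsub>H\<^esub> \<phi> a \<oplus>\<^bsub>H\<^esub> ?f C"
    unfolding hom_to_ring_simps
  proof (rule restrict_ext)
    fix x assume x: "x \<in> carrier P"
    have "(\<Oplus>\<^bsub>regular_module \<Lambda>\<^esub>b\<in>insert a C. c b \<otimes>\<^bsub>\<Lambda>\<^esub> \<phi> b x)
      = c a \<otimes>\<^bsub>\<Lambda>\<^esub> \<phi> a x \<oplus>\<^bsub>regular_module \<Lambda>\<^esub> (\<Oplus>\<^bsub>regular_module \<Lambda>\<^esub>b\<in>C. c b \<otimes>\<^bsub>\<Lambda>\<^esub> \<phi> b x)"
      using insert.hyps insert.prems(1) \<phi>x x by (intro reg.M.finsum_insert) auto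
    then show "(\<Oplus>\<^bsub>regular_module \<Lambda>\<^esub>b\<in>insert a C. c b \<otimes>\<^bsub>\<Lambda>\<^esub> \<phi> b x)
      = (\<lambda>x\<in>carrier P. c a \<otimes>\<^bsub>\<Lambda>\<^esub> \<phi> a x) x \<oplus>\<^bsub>\<Lambda>\<^esub> ?f C x"
      using x by simp
  qed
  have "\<psi> (?f (insert a C)) = \<psi> (c a \<odot>\<^bsub>H\<^esub> \<phi> a) \<oplus>\<^bsub>J\<^esub> \<psi> (?f C)"
    unfolding eq using nakayamaD(2)[OF \<psi> cl IH(1)] by simp
  also have "\<dots> = (\<Oplus>\<^bsub>J\<^esub>b\<in>insert a C. \<psi> (c b \<odot>\<^bsub>H\<^esub> \<phi> b))"
    unfolding IH(2) using insert.hyps nakayamaD(1)[OF \<psi> cl]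
    by (intro J.M.finsum_insert[symmetric]) auto
  finally have "\<psi> (?f (insert a C)) = (\<Oplus>\<^bsub>J\<^esub>b\<in>insert a C. \<psi> (c b \<odot>\<^bsub>H\<^esub> \<phi> b))" .
  moreover have "?f (insert a C) \<in> carrier H"
    unfolding eq by (rule hom_to_ring_closed(1)[OF P cl IH(1)]) simp
  ultimately show ?case by blast
qed

text \<open>
  A homomorphism out of \<open>P\<close> is encoded by its values on the dual basis \<open>B\<close>. Thus the functional on
  \<open>Hom(P, Y)\<close> is extended inside \<open>Y\<^bsup>B\<^esup>\<close>, whose finite generation over \<open>R\<close> makes \<^const>\<open>injective_module\<close>
  applicable.
\<close>

lemma nakayama_factor:
  fixes Y :: "('l, 'y) module"
  assumes inj: "injective_module R J" and fgP: "fg_module \<Lambda> P" and prP: "projective_module \<Lambda> P"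
    and NM: "right_module \<Lambda> N" and X: "right_module \<Lambda> X" and Y: "fg_module \<Lambda> Y"
    and x: "x \<in> mod_hom \<Lambda> X Y" and \<beta>: "\<beta> \<in> mod_hom \<Lambda> X N"
    and van: "\<And>t p. \<lbrakk>t \<in> mod_hom \<Lambda> P X; \<And>p. p \<in> carrier P \<Longrightarrow> x (t p) = \<zero>\<^bsub>Y\<^esub>; p \<in> carrier P\<rbrakk>
      \<Longrightarrow> \<beta> (t p) = \<zero>\<^bsub>N\<^esub>"
  shows "\<exists>v\<in>mod_hom \<Lambda> Y N. \<forall>y\<in>carrier X. v (x y) = \<beta> y"
proof -
  have YM: "right_module \<Lambda> Y" using Y by (simp add: fg_module_def)
  interpret X: right_module \<Lambda> X by (rule X)
  interpret Y: right_module \<Lambda> Y by (rule YM)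
  interpret N: right_module \<Lambda> N by (rule NM)
  interpret reg: right_module \<Lambda> "regular_module \<Lambda>" by (rule right_module_regular[OF L.ring_axioms])
  obtain B \<phi>0 where B: "finite B" "generates \<Lambda> P B"
    and \<phi>0: "\<And>b. b \<in> B \<Longrightarrow> \<phi>0 b \<in> mod_hom \<Lambda> P (regular_module \<Lambda>)"
    and basis: "\<And>p. p \<in> carrier P \<Longrightarrow> p = (\<Oplus>\<^bsub>P\<^esub>b\<in>B. \<phi>0 b p \<odot>\<^bsub>P\<^esub> b)"
    using dual_basis[OF fgP prP] by blast
  have BP: "\<And>b. b \<in> B \<Longrightarrow> b \<in> carrier P" using B(2) by (auto simp: generates_def)
  define \<phi> where "\<phi> b = restrict (\<phi>0 b) (carrier P)" for b
  have \<phi>: "\<phi> b \<in> carrier H" if "b \<in> B" for b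
    unfolding \<phi>_def by (rule hom_to_ring_restrict[OF P \<phi>0[OF that]])
  have \<eta>A: "\<eta> p \<in> carrier \<Lambda>" if "\<eta> \<in> carrier H" "p \<in> carrier P" for \<eta> p
    using that mod_hom_closed[of \<eta> \<Lambda> P "regular_module \<Lambda>" p] by simp
  let ?Hom = "mod_hom \<Lambda> P X"
  let ?YR = "restrict_scalars \<Lambda> Y"
  let ?Q = "power_module B ?YR"
  have YR: "right_module R ?YR" by (rule right_module_restrict_scalars[OF YM])
  have Q: "right_module R ?Q" by (rule right_module_power[OF YR])
  interpret Q: right_module R ?Q by (rule Q)
  obtain c0 :: "'y \<Rightarrow> nat \<Rightarrow> 'r" where c0: "inj_on c0 (carrier ?YR)"
    using fg_module_embedding[OF fg_restrict_scalars[OF Y]] by blast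
  obtain c :: "_ \<Rightarrow> nat \<Rightarrow> 'r" where c: "inj_on c (carrier ?Q)"
    using power_module_embedding[OF B(1) c0] by blast
  \<comment> \<open>\<open>val t\<close> records the composite of \<open>t\<close> with
    \<open>x\<close> on the generators \<open>B\<close>, which determine it. In this form the image
    of Hom(P, X) in Hom(P, Y) becomes a subset of a power of \<open>Y\<close>.\<close>
  define val where "val t = (\<lambda>b\<in>B. x (t b))" for t
  define tr where "tr t = (\<Oplus>\<^bsub>J\<^esub>b\<in>B. \<beta> (t b) (\<phi> b))" for t
  have tX: "t b \<in> carrier X" "x (t b) \<in> carrier Y" "\<beta> (t b) \<in> carrier N" if "t \<in> ?Hom" "b \<in> B" for t b
    using mod_hom_closed[OF that(1) BP[OF that(2)]] mod_hom_closed[OF x] mod_hom_closed[OF \<beta>] by auto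
  have \<beta>J: "\<beta> (t b) (\<phi> b) \<in> carrier J" if "t \<in> ?Hom" "b \<in> B" for t b
    using nakayamaD(1)[OF tX(3)[OF that] \<phi>[OF that(2)]] .
  \<comment> \<open>If the values agree, \<open>x\<close> kills the difference \<open>t - t'\<close>
    on \<open>B\<close>, hence on all of \<open>P\<close>, and \<open>van\<close> makes \<beta>
    vanish on it. So the functional descends to the image of \<open>val\<close>.\<close>
  have tr_cong: "tr t = tr t'" if t: "t \<in> ?Hom" "t' \<in> ?Hom" and eq: "val t = val t'" for t t'
  proof -
    let ?d = "\<lambda>p. t p \<ominus>\<^bsub>X\<^esub> t' p"
    have d: "?d \<in> ?Hom" using mod_hom_pointwise_minus[OF P X t] .
    have "x (?d b) = \<zero>\<^bsub>Y\<^esub>" if "b \<in> B" for b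
    proof -
      have "x (t b) = x (t' b)" using fun_cong[OF eq, of b] that by (simp add: val_def)
      then show ?thesis
        using mod_hom_minus[OF X YM x tX(1)[OF t(1) that] tX(1)[OF t(2) that]] tX(2)[OF t(2) that]
        by (simp add: Y.add_minus_cancel)
    qed
    then have "x (?d p) = \<zero>\<^bsub>Y\<^esub>" if "p \<in> carrier P" for p
      using mod_hom_eqI[OF P YM mod_hom_comp[OF d x] mod_hom_zero_map[OF YM], of B] B(2) that
      by (auto simp: generates_def)
    then have "\<beta> (?d b) = \<zero>\<^bsub>N\<^esub>" if "b \<in> B" for b using van[OF d _ BP[OF that]] by blast
    then have "\<beta> (t b) = \<beta> (t' b)" if "b \<in> B" for b
      using mod_hom_minus[OF X NM \<beta> tX(1)[OF t(1) that] tX(1)[OF t(2) that]]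
        N.minus_eq_zero_iff tX(3) t that by metis
    then show ?thesis
      unfolding tr_def using \<beta>J[OF t(2)] by (intro J.M.finsum_cong') auto
  qed
  let ?U = "val ` ?Hom"
  have val_Q: "val t \<in> carrier ?Q" if "t \<in> ?Hom" for t
    using tX(2)[OF that] by (simp add: val_def)
  have add: "(\<lambda>p. t p \<oplus>\<^bsub>X\<^esub> t' p) \<in> ?Hom" "val (\<lambda>p. t p \<oplus>\<^bsub>X\<^esub> t' p) = val t \<oplus>\<^bsub>?Q\<^esub> val t'"
    "tr (\<lambda>p. t p \<oplus>\<^bsub>X\<^esub> t' p) = tr t \<oplus>\<^bsub>J\<^esub> tr t'" if t: "t \<in> ?Hom" "t' \<in> ?Hom" for t t'
  proof -
    show "(\<lambda>p. t p \<oplus>\<^bsub>X\<^esub> t' p) \<in> ?Hom" using mod_hom_pointwise_add[OF X t] .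
    show "val (\<lambda>p. t p \<oplus>\<^bsub>X\<^esub> t' p) = val t \<oplus>\<^bsub>?Q\<^esub> val t'"
      using mod_hom_add[OF x] tX(1) t by (auto simp: val_def intro!: restrict_ext)
    have "\<beta> (t b \<oplus>\<^bsub>X\<^esub> t' b) (\<phi> b) = \<beta> (t b) (\<phi> b) \<oplus>\<^bsub>J\<^esub> \<beta> (t' b) (\<phi> b)" if "b \<in> B" for b
      using mod_hom_add[OF \<beta> tX(1)[OF t(1) that] tX(1)[OF t(2) that]] \<phi>[OF that]
      by (simp only: nakayama_simps(3) restrict_apply')
    then have "tr (\<lambda>p. t p \<oplus>\<^bsub>X\<^esub> t' p) = (\<Oplus>\<^bsub>J\<^esub>b\<in>B. \<beta> (t b) (\<phi> b) \<oplus>\<^bsub>J\<^esub> \<beta> (t' b) (\<phi> b))"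
      unfolding tr_def using \<beta>J t by (intro J.M.finsum_cong') auto
    then show "tr (\<lambda>p. t p \<oplus>\<^bsub>X\<^esub> t' p) = tr t \<oplus>\<^bsub>J\<^esub> tr t'"
      using \<beta>J t by (simp add: tr_def J.M.finsum_addf)
  qed
  \<comment> \<open>Scalars from \<open>R\<close> are central in \<Lambda>, so a scalar multiple of
    a \<Lambda>-homomorphism is again \<Lambda>-linear.\<close>
  have smult: "(\<lambda>p. scalar r \<odot>\<^bsub>X\<^esub> t p) \<in> ?Hom" "val (\<lambda>p. scalar r \<odot>\<^bsub>X\<^esub> t p) = r \<odot>\<^bsub>?Q\<^esub> val t"
    "tr (\<lambda>p. scalar r \<odot>\<^bsub>X\<^esub> t p) = r \<odot>\<^bsub>J\<^esub> tr t" if t: "t \<in> ?Hom" and r: "r \<in> carrier R" for t r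
  proof -
    note tt = mod_homD[OF t]
    show "(\<lambda>p. scalar r \<odot>\<^bsub>X\<^esub> t p) \<in> ?Hom"
    proof (rule mod_homI)
      show "scalar r \<odot>\<^bsub>X\<^esub> t (a \<odot>\<^bsub>P\<^esub> p) = a \<odot>\<^bsub>X\<^esub> (scalar r \<odot>\<^bsub>X\<^esub> t p)"
        if "a \<in> carrier \<Lambda>" "p \<in> carrier P" for a p
        using that r tt(1,3) scalar_mult[OF r that(1)] by (simp add: X.smult_assoc_right[symmetric])
    qed (use tt r in \<open>auto simp: X.smult_closed X.smult_distr_module\<close>)
    show "val (\<lambda>p. scalar r \<odot>\<^bsub>X\<^esub> t p) = r \<odot>\<^bsub>?Q\<^esub> val t"
      using mod_hom_smult[OF x] tX(1)[OF t] r by (auto simp: val_def intro!: restrict_ext)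
    have "\<beta> (scalar r \<odot>\<^bsub>X\<^esub> t b) (\<phi> b) = r \<odot>\<^bsub>J\<^esub> \<beta> (t b) (\<phi> b)" if "b \<in> B" for b
    proof -
      have "\<beta> (scalar r \<odot>\<^bsub>X\<^esub> t b) (\<phi> b) = \<beta> (t b) (scalar r \<odot>\<^bsub>H\<^esub> \<phi> b)"
        using mod_hom_smult[OF \<beta> scalar_closed[OF r] tX(1)[OF t that]] \<phi>[OF that]
        by (simp only: nakayama_simps(4) restrict_apply')
      then show ?thesis using nakayamaD(3)[OF tX(3)[OF t that] r \<phi>[OF that]] by simp
    qed
    then have "tr (\<lambda>p. scalar r \<odot>\<^bsub>X\<^esub> t p) = (\<Oplus>\<^bsub>J\<^esub>b\<in>B. r \<odot>\<^bsub>J\<^esub> \<beta> (t b) (\<phi> b))"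
      unfolding tr_def using \<beta>J[OF t] r by (intro J.M.finsum_cong') (auto simp: J.smult_closed)
    then show "tr (\<lambda>p. scalar r \<odot>\<^bsub>X\<^esub> t p) = r \<odot>\<^bsub>J\<^esub> tr t"
      using \<beta>J[OF t] r by (simp add: tr_def J.smult_finsum)
  qed
  have U: "submodule ?U R ?Q"
  proof (rule Q.submodule_intro)
    show "?U \<subseteq> carrier ?Q" using val_Q by blast
    have "val (\<lambda>_. \<zero>\<^bsub>X\<^esub>) = \<zero>\<^bsub>?Q\<^esub>"
      using mod_hom_zero[OF X YM x] by (auto simp: val_def intro!: restrict_ext)
    then show "\<zero>\<^bsub>?Q\<^esub> \<in> ?U" using mod_hom_zero_map[OF X, of P] by (metis imageI)
    show "z \<oplus>\<^bsub>?Q\<^esub> z' \<in> ?U" if z: "z \<in> ?U" "z' \<in> ?U" for z z'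
    proof -
      obtain t t' where "t \<in> ?Hom" "t' \<in> ?Hom" "z = val t" "z' = val t'" using z by blast
      then show ?thesis using add(1,2)[of t t'] by (metis imageI)
    qed
    show "r \<odot>\<^bsub>?Q\<^esub> z \<in> ?U" if r: "r \<in> carrier R" and z: "z \<in> ?U" for r z
    proof -
      obtain t where "t \<in> ?Hom" "z = val t" using z by blast
      then show ?thesis using smult(1,2)[of t r] r by (metis imageI)
    qed
  qed
  \<comment> \<open>By \<open>tr_cong\<close> the value does not depend on the chosen
    preimage.\<close>
  define F0 where "F0 z = tr (inv_into ?Hom val z)" for z
  have F0: "F0 (val t) = tr t" if "t \<in> ?Hom" for t
    unfolding F0_def
    using tr_cong[OF inv_into_into[of "val t" val ?Hom] that] f_inv_into_f[of "val t" val ?Hom] that by blast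
  have "F0 \<in> mod_hom R (?Q\<lparr>carrier := ?U\<rparr>) J"
  proof (rule mod_homI)
    show "F0 z \<in> carrier J" if z: "z \<in> carrier (?Q\<lparr>carrier := ?U\<rparr>)" for z
    proof -
      obtain t where "t \<in> ?Hom" "z = val t" using z by auto
      then show ?thesis using F0 \<beta>J by (simp add: tr_def J.M.finsum_closed)
    qed
    show "F0 (z \<oplus>\<^bsub>?Q\<lparr>carrier := ?U\<rparr>\<^esub> z') = F0 z \<oplus>\<^bsub>J\<^esub> F0 z'"
      if z: "z \<in> carrier (?Q\<lparr>carrier := ?U\<rparr>)" "z' \<in> carrier (?Q\<lparr>carrier := ?U\<rparr>)" for z z'
    proof -
      obtain t t' where t: "t \<in> ?Hom" "t' \<in> ?Hom" "z = val t" "z' = val t'" using z by auto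
      have "F0 (val t \<oplus>\<^bsub>?Q\<^esub> val t') = tr t \<oplus>\<^bsub>J\<^esub> tr t'"
        using F0[OF add(1)[OF t(1,2)]] add(2,3)[OF t(1,2)] by metis
      then show ?thesis using t F0 by simp
    qed
    show "F0 (r \<odot>\<^bsub>?Q\<lparr>carrier := ?U\<rparr>\<^esub> z) = r \<odot>\<^bsub>J\<^esub> F0 z"
      if r: "r \<in> carrier R" and z: "z \<in> carrier (?Q\<lparr>carrier := ?U\<rparr>)" for r z
    proof -
      have "z \<in> ?U" using z by simp
      then obtain t where t: "t \<in> ?Hom" "z = val t" by blast
      have "F0 (r \<odot>\<^bsub>?Q\<^esub> val t) = r \<odot>\<^bsub>J\<^esub> tr t"
        using F0[OF smult(1)[OF t(1) r]] smult(2,3)[OF t(1) r] by metis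
      then show ?thesis using t F0 by simp
    qed
  qed
  from injective_extend_embedded[OF inj Q c U this]
  obtain F where F: "F \<in> mod_hom R ?Q J" "\<And>z. z \<in> ?U \<Longrightarrow> F z = F0 z" by blast
  \<comment> \<open>\<open>row y \<eta>\<close> lists the values on \<open>B\<close> of the
    homomorphism from \<open>P\<close> to \<open>Y\<close> that sends \<open>p\<close> to the
    multiple of \<open>y\<close> by \<open>\<eta> p\<close>. Evaluating the extended functional at
    these rows turns it back into a homomorphism from \<open>Y\<close> to \<nu> P.\<close>
  define row where "row y \<eta> = (\<lambda>b\<in>B. \<eta> b \<odot>\<^bsub>Y\<^esub> y)" for y \<eta>
  have row: "row y \<eta> \<in> carrier ?Q" if "y \<in> carrier Y" "\<eta> \<in> carrier H" for y \<eta>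
    using that \<eta>A[OF that(2) BP] by (auto simp: row_def Y.smult_closed)
  define v where "v y = (\<lambda>\<eta>\<in>carrier H. F (row y \<eta>))" for y
  have v: "v \<in> mod_hom \<Lambda> Y N"
  proof (rule mod_homI)
    show "v y \<in> carrier N" if y: "y \<in> carrier Y" for y
      unfolding nakayama_simps(1)
    proof (intro IntI mod_homI; (unfold restrict_scalars_simps)?)
      show "v y \<in> extensional (carrier H)" by (simp only: v_def restrict_extensional)
      show "v y \<eta> \<in> carrier J" if \<eta>: "\<eta> \<in> carrier H" for \<eta>
        using mod_hom_closed[OF F(1) row[OF y \<eta>]] \<eta> by (simp only: v_def restrict_apply')
      show "v y (\<eta> \<oplus>\<^bsub>H\<^esub> \<eta>') = v y \<eta> \<oplus>\<^bsub>J\<^esub> v y \<eta>'" if \<eta>: "\<eta> \<in> carrier H" "\<eta>' \<in> carrier H" for \<eta> \<eta>'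
      proof -
        have "row y (\<eta> \<oplus>\<^bsub>H\<^esub> \<eta>') = row y \<eta> \<oplus>\<^bsub>?Q\<^esub> row y \<eta>'"
          using \<eta>A[OF \<eta>(1) BP] \<eta>A[OF \<eta>(2) BP] BP y
          by (auto simp: row_def Y.smult_distr_ring intro!: restrict_ext)
        then show ?thesis
          using mod_hom_add[OF F(1) row[OF y \<eta>(1)] row[OF y \<eta>(2)]] \<eta> hom_to_ring_closed(1)[OF P \<eta>]
          by (simp only: v_def restrict_apply')
      qed
      show "v y (scalar r \<odot>\<^bsub>H\<^esub> \<eta>) = r \<odot>\<^bsub>J\<^esub> v y \<eta>" if r: "r \<in> carrier R" and \<eta>: "\<eta> \<in> carrier H" for r \<eta>
      proof -
        have "row y (scalar r \<odot>\<^bsub>H\<^esub> \<eta>) = r \<odot>\<^bsub>?Q\<^esub> row y \<eta>"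
          using \<eta>A[OF \<eta> BP] BP y r scalar_mult[OF r]
          by (auto simp: row_def Y.smult_assoc_right[symmetric] intro!: restrict_ext)
        then show ?thesis
          using mod_hom_smult[OF F(1) r row[OF y \<eta>]] \<eta> hom_to_ring_closed(2)[OF P \<eta> scalar_closed[OF r]]
          by (simp only: v_def restrict_apply')
      qed
    qed
    show "v (y \<oplus>\<^bsub>Y\<^esub> y') = v y \<oplus>\<^bsub>N\<^esub> v y'" if y: "y \<in> carrier Y" "y' \<in> carrier Y" for y y'
      unfolding nakayama_simps(3) v_def
    proof (rule restrict_ext)
      fix \<eta> assume \<eta>: "\<eta> \<in> carrier H"
      have "row (y \<oplus>\<^bsub>Y\<^esub> y') \<eta> = row y \<eta> \<oplus>\<^bsub>?Q\<^esub> row y' \<eta>"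
        using \<eta>A[OF \<eta> BP] y by (auto simp: row_def Y.smult_distr_module intro!: restrict_ext)
      then show "F (row (y \<oplus>\<^bsub>Y\<^esub> y') \<eta>)
        = (\<lambda>\<eta>\<in>carrier H. F (row y \<eta>)) \<eta> \<oplus>\<^bsub>J\<^esub> (\<lambda>\<eta>\<in>carrier H. F (row y' \<eta>)) \<eta>"
        using mod_hom_add[OF F(1) row[OF y(1) \<eta>] row[OF y(2) \<eta>]] \<eta> by (simp only: restrict_apply')
    qed
    show "v (a \<odot>\<^bsub>Y\<^esub> y) = a \<odot>\<^bsub>N\<^esub> v y" if a: "a \<in> carrier \<Lambda>" and y: "y \<in> carrier Y" for a y
      unfolding nakayama_simps(4) v_def
    proof (rule restrict_ext)
      fix \<eta> assume \<eta>: "\<eta> \<in> carrier H"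
      \<comment> \<open>The action on \<open>Y\<close> moves into the argument \<eta>, which is how
        \<Lambda> acts on the dual.\<close>
      have "row (a \<odot>\<^bsub>Y\<^esub> y) \<eta> = row y (a \<odot>\<^bsub>H\<^esub> \<eta>)"
        using \<eta>A[OF \<eta> BP] BP y a
        by (auto simp: row_def Y.smult_assoc_right[symmetric] intro!: restrict_ext)
      then show "F (row (a \<odot>\<^bsub>Y\<^esub> y) \<eta>) = (\<lambda>\<eta>\<in>carrier H. F (row y \<eta>)) (a \<odot>\<^bsub>H\<^esub> \<eta>)"
        using hom_to_ring_closed(2)[OF P \<eta> a] by (simp only: restrict_apply')
    qed
  qed
  moreover have "v (x q) = \<beta> q" if q: "q \<in> carrier X" for q
  proof (rule extensionalityI[of _ "carrier H"])
    have xq: "x q \<in> carrier Y" and \<beta>q: "\<beta> q \<in> carrier N"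
      using mod_hom_closed[OF x q] mod_hom_closed[OF \<beta> q] by auto
    show "v (x q) \<in> extensional (carrier H)" by (simp only: v_def restrict_extensional)
    show "\<beta> q \<in> extensional (carrier H)" by (rule nakayamaD(4)[OF \<beta>q])
    fix \<eta> assume \<eta>: "\<eta> \<in> carrier H"
    then have \<eta>h: "\<eta> \<in> mod_hom \<Lambda> P (regular_module \<Lambda>)" and \<eta>e: "\<eta> \<in> extensional (carrier P)" by auto
    \<comment> \<open>For the element \<open>x q\<close> the row comes from a homomorphism to
      \<open>X\<close>, where the extension agrees with the original functional.\<close>
    let ?t = "\<lambda>p. \<eta> p \<odot>\<^bsub>X\<^esub> q"
    have t: "?t \<in> ?Hom"
      using mod_hom_add[OF \<eta>h] mod_hom_smult[OF \<eta>h] \<eta>A[OF \<eta>] q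
      by (intro mod_homI) (auto simp: X.smult_closed X.smult_distr_ring X.smult_assoc_right)
    have "row (x q) \<eta> = val ?t"
      using mod_hom_smult[OF x \<eta>A[OF \<eta> BP] q] by (auto simp: row_def val_def intro!: restrict_ext)
    then have "v (x q) \<eta> = tr ?t"
      using F(2)[OF imageI[OF t]] F0[OF t] \<eta> by (simp only: v_def restrict_apply')
    also have "\<dots> = (\<Oplus>\<^bsub>J\<^esub>b\<in>B. \<beta> q (\<eta> b \<odot>\<^bsub>H\<^esub> \<phi> b))"
      unfolding tr_def
    proof (rule J.M.finsum_cong'[OF refl])
      show "(\<lambda>b. \<beta> q (\<eta> b \<odot>\<^bsub>H\<^esub> \<phi> b)) \<in> B \<rightarrow> carrier J"
        using nakayamaD(1)[OF \<beta>q hom_to_ring_closed(2)[OF P \<phi> \<eta>A[OF \<eta> BP]]] by blast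
      \<comment> \<open>Linearity of \<beta> over \<Lambda> shifts the coefficient
        \<open>\<eta> b\<close> into the argument \<open>\<phi> b\<close>.\<close>
      show "\<beta> (\<eta> b \<odot>\<^bsub>X\<^esub> q) (\<phi> b) = \<beta> q (\<eta> b \<odot>\<^bsub>H\<^esub> \<phi> b)" if "b \<in> B" for b
        using mod_hom_smult[OF \<beta> \<eta>A[OF \<eta> BP[OF that]] q] \<phi>[OF that]
        by (simp only: nakayama_simps(4) restrict_apply')
    qed
    also have "\<dots> = \<beta> q (\<lambda>p\<in>carrier P. \<Oplus>\<^bsub>regular_module \<Lambda>\<^esub>b\<in>B. \<eta> b \<otimes>\<^bsub>\<Lambda>\<^esub> \<phi> b p)"
      using nakayama_finsum[OF \<beta>q B(1), of \<eta> \<phi>] \<eta>A[OF \<eta> BP] \<phi> by metis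
    \<comment> \<open>Expanding \<open>p\<close> in the dual basis and applying \<eta> gives \<eta>
      back.\<close>
    also have "(\<lambda>p\<in>carrier P. \<Oplus>\<^bsub>regular_module \<Lambda>\<^esub>b\<in>B. \<eta> b \<otimes>\<^bsub>\<Lambda>\<^esub> \<phi> b p) = \<eta>"
    proof (rule extensionalityI[OF restrict_extensional \<eta>e])
      fix p assume p: "p \<in> carrier P"
      have c: "\<phi>0 b p \<in> carrier \<Lambda>" if "b \<in> B" for b using mod_hom_closed[OF \<phi>0[OF that] p] by simp
      have "\<eta> p = \<eta> (\<Oplus>\<^bsub>P\<^esub>b\<in>B. \<phi>0 b p \<odot>\<^bsub>P\<^esub> b)" using basis[OF p] by simp
      also have "\<dots> = (\<Oplus>\<^bsub>regular_module \<Lambda>\<^esub>b\<in>B. \<eta> (\<phi>0 b p \<odot>\<^bsub>P\<^esub> b))"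
        using c BP by (intro mod_hom_finsum[OF P reg.right_module_axioms \<eta>h]) (auto simp: P.smult_closed)
      also have "\<dots> = (\<Oplus>\<^bsub>regular_module \<Lambda>\<^esub>b\<in>B. \<eta> b \<otimes>\<^bsub>\<Lambda>\<^esub> \<phi> b p)"
        using mod_hom_smult[OF \<eta>h c BP] c \<eta>A[OF \<eta> BP] p
        by (intro reg.M.finsum_cong') (auto simp: \<phi>_def)
      finally show "(\<lambda>p\<in>carrier P. \<Oplus>\<^bsub>regular_module \<Lambda>\<^esub>b\<in>B. \<eta> b \<otimes>\<^bsub>\<Lambda>\<^esub> \<phi> b p) p = \<eta> p" using p by simp
    qed
    finally show "v (x q) \<eta> = \<beta> q \<eta>" .
  qed
  ultimately show ?thesis by blast
qed

end

section \<open>The almost split sequence\<close>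

lemma mod_hom_factor_surj:
  assumes M: "right_module A M" and N: "right_module A N" and L: "right_module A L"
    and p: "p \<in> mod_hom A M N" "p ` carrier M = carrier N" and f: "f \<in> mod_hom A M L"
    and ker: "mod_ker M N p \<subseteq> mod_ker M L f"
  shows "\<exists>h\<in>mod_hom A N L. \<forall>x\<in>carrier M. h (p x) = f x"
proof -
  interpret M: right_module A M by fact
  interpret N: right_module A N by fact
  interpret L: right_module A L by fact
  let ?i = "inv_into (carrier M) p"
  have h: "f (?i (p x)) = f x" if x: "x \<in> carrier M" for x
  proof -
    have i: "?i (p x) \<in> carrier M" "p (?i (p x)) = p x"
      using x inv_into_into[of "p x" p "carrier M"] f_inv_into_f[of "p x" p "carrier M"] by auto
    have "p (?i (p x) \<ominus>\<^bsub>M\<^esub> x) = \<zero>\<^bsub>N\<^esub>"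
      using mod_hom_minus[OF M N p(1) i(1) x] i(2) mod_hom_closed[OF p(1) x] by (simp add: N.add_minus_cancel)
    then have "f (?i (p x) \<ominus>\<^bsub>M\<^esub> x) = \<zero>\<^bsub>L\<^esub>" using ker i x by (auto simp: mod_ker_def)
    then show ?thesis
      using mod_hom_minus[OF M L f i(1) x] L.minus_eq_zero_iff mod_hom_closed[OF f] i(1) x by simp
  qed
  have hom: "(\<lambda>y. f (?i y)) \<in> mod_hom A N L"
  proof (rule mod_homI)
    show "f (?i y) \<in> carrier L" if "y \<in> carrier N" for y
      using that p(2) inv_into_into[of y p "carrier M"] mod_hom_closed[OF f] by simp
    show "f (?i (y \<oplus>\<^bsub>N\<^esub> y')) = f (?i y) \<oplus>\<^bsub>L\<^esub> f (?i y')" if y: "y \<in> carrier N" "y' \<in> carrier N" for y y'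
    proof -
      obtain x x' where x: "x \<in> carrier M" "x' \<in> carrier M" "y = p x" "y' = p x'" using y p(2) by blast
      have "y \<oplus>\<^bsub>N\<^esub> y' = p (x \<oplus>\<^bsub>M\<^esub> x')" using mod_hom_add[OF p(1)] x by simp
      then show ?thesis using h mod_hom_add[OF f] x by simp
    qed
    show "f (?i (a \<odot>\<^bsub>N\<^esub> y)) = a \<odot>\<^bsub>L\<^esub> f (?i y)" if a: "a \<in> carrier A" and y: "y \<in> carrier N" for a y
    proof -
      obtain x where x: "x \<in> carrier M" "y = p x" using y p(2) by blast
      have "a \<odot>\<^bsub>N\<^esub> y = p (a \<odot>\<^bsub>M\<^esub> x)" using mod_hom_smult[OF p(1) a] x by simp
      then show ?thesis using h mod_hom_smult[OF f a] x a by (simp add: M.smult_closed)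
    qed
  qed
  show ?thesis by (rule bexI[OF _ hom]) (simp add: h)
qed

lemma fg_module_image:
  assumes "fg_module A M" "right_module A N" "f \<in> mod_hom A M N" "f ` carrier M = carrier N"
  shows "fg_module A N"
proof -
  obtain B where B: "right_module A M" "finite B" "generates A M B" using fg_moduleE[OF assms(1)] .
  interpret N: right_module A N by fact
  have "generates A N (f ` B)"
    unfolding generates_def
  proof (intro conjI allI impI)
    have BM: "B \<subseteq> carrier M" using B(3) by (simp add: generates_def)
    then show "f ` B \<subseteq> carrier N" using assms(4) by blast
    fix U assume U: "submodule U A N \<and> f ` B \<subseteq> U"
    then have "{x \<in> carrier M. f x \<in> U} = carrier M"
      using submodule_vimage[OF B(1) assms(2,3)] BM by (intro generatesD[OF B(3)]) auto
    then have "f x \<in> U" if "x \<in> carrier M" for x using that by blast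
    then have "f ` carrier M \<subseteq> U" by blast
    then have "carrier N \<subseteq> U" using assms(4) by simp
    then show "U = carrier N" using N.submodule_dest(1) U by blast
  qed
  then show ?thesis using fg_moduleI[OF assms(2)] B(2) by blast
qed

section \<open>The map \<alpha> and a minimal presentation of \<nu> P\<close>

locale nakayama_presentation = nakayama_functor R \<Lambda> J P
  for R :: "('r, 's) ring_scheme" and \<Lambda> :: "('r, 'l) module" and J :: "('r, 'j) module"
    and P :: "('l, 'p) module" +
  fixes P\<^sub>0 :: "('l, 'p0) module" and P\<^sub>1 :: "('l, 'p1) module"
    and \<alpha> :: "'p \<Rightarrow> ('p \<Rightarrow> 'l) \<Rightarrow> 'j" and \<sigma> :: "'p0 \<Rightarrow> ('p \<Rightarrow> 'l) \<Rightarrow> 'j"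
    and g :: "'p1 \<Rightarrow> 'p0" and e :: "'p \<Rightarrow> 'p0"
  assumes dualizing: "dualizing_module R J"
    and fgP: "fg_module \<Lambda> P" and prP: "projective_module \<Lambda> P" and indP: "indecomposable_module \<Lambda> P"
    and top_soc: "top_to_socle_map \<Lambda> P (nakayama R J \<Lambda> P) \<alpha>"
    and minimal: "minimal_projective_presentation \<Lambda> P\<^sub>1 g P\<^sub>0 \<sigma> (nakayama R J \<Lambda> P)"
    and e_hom: "e \<in> mod_hom \<Lambda> P P\<^sub>0" and lift: "\<And>x. x \<in> carrier P \<Longrightarrow> \<sigma> (e x) = \<alpha> x"
begin

abbreviation (input) "K \<equiv> P\<^sub>0\<lparr>carrier := mod_ker P\<^sub>0 N \<sigma>\<rparr>"

lemma injective_J: "injective_module R J"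
  using dualizing by (simp add: dualizing_module_def injective_envelope_def)

lemma covers: "projective_cover \<Lambda> P\<^sub>0 \<sigma> N" "projective_cover \<Lambda> P\<^sub>1 g K"
  using minimal by (simp_all add: minimal_projective_presentation_def)

lemma P0: "fg_module \<Lambda> P\<^sub>0" "projective_module \<Lambda> P\<^sub>0" "\<sigma> \<in> mod_hom \<Lambda> P\<^sub>0 N" "\<sigma> ` carrier P\<^sub>0 = carrier N"
  and P1: "fg_module \<Lambda> P\<^sub>1" "projective_module \<Lambda> P\<^sub>1" "g \<in> mod_hom \<Lambda> P\<^sub>1 K" "g ` carrier P\<^sub>1 = mod_ker P\<^sub>0 N \<sigma>"
  using covers by (simp_all add: projective_cover_def)

sublocale P0: right_module \<Lambda> P\<^sub>0 using P0 by (simp add: fg_module_def)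
sublocale P1: right_module \<Lambda> P\<^sub>1 using P1 by (simp add: fg_module_def)

lemma NM: "right_module \<Lambda> N"
  by (rule right_module_nakayama[OF P0.right_module_axioms P0(3,4)])

sublocale N: right_module \<Lambda> N by (rule NM)

lemma g_hom: "g \<in> mod_hom \<Lambda> P\<^sub>1 P\<^sub>0"
  using P1(3) by (auto simp: mod_hom_def mod_ker_def)

lemma \<sigma>_g: "z \<in> carrier P\<^sub>1 \<Longrightarrow> \<sigma> (g z) = \<zero>\<^bsub>N\<^esub>"
  using P1(4) by (auto simp: mod_ker_def)

lemma \<alpha>_hom: "\<alpha> \<in> mod_hom \<Lambda> P N"
  by (rule mod_hom_cong[OF P.right_module_axioms mod_hom_comp[OF e_hom P0(3)]]) (rule lift)

lemma dccP: "dcc \<Lambda> P"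
  by (rule fg_module_dcc[OF fgP])

lemmas rad = indecomposable_projective_rad[OF fgP prP indP dccP]

text \<open>The coset map kills exactly rad P and \<open>h\<close> is injective, so \<alpha>
  vanishes exactly on rad P and is nonzero because rad P is proper. Its image is the socle because
  \<open>h\<close> is onto.\<close>

lemma \<alpha>_props:
  shows \<alpha>_rad: "x \<in> module_rad \<Lambda> P \<Longrightarrow> \<alpha> x = \<zero>\<^bsub>N\<^esub>"
    and \<alpha>_nonzero: "\<exists>x\<in>carrier P. \<alpha> x \<noteq> \<zero>\<^bsub>N\<^esub>"
    and \<alpha>_image: "module_soc \<Lambda> N = \<alpha> ` carrier P"
proof -
  let ?r = "module_rad \<Lambda> P"
  obtain h where h: "bij_betw h (carrier (module_top \<Lambda> P)) (module_soc \<Lambda> N)"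
    "\<And>x. x \<in> carrier P \<Longrightarrow> \<alpha> x = h (?r +>\<^bsub>P\<^esub> x)"
    using top_soc unfolding top_to_socle_map_def by blast
  note r = P.submodule_dest[OF rad(1)]
  have sub: "subgroup ?r (add_monoid P)" using rad(1) by (rule submodule.axioms(1))
  have top: "carrier (module_top \<Lambda> P) = (\<lambda>x. ?r +>\<^bsub>P\<^esub> x) ` carrier P"
    by (auto simp: module_top_def quotient_module_def A_RCOSETS_def')
  have zero: "\<alpha> \<zero>\<^bsub>P\<^esub> = \<zero>\<^bsub>N\<^esub>" by (rule mod_hom_zero[OF P.right_module_axioms NM \<alpha>_hom])
  have r0: "?r +>\<^bsub>P\<^esub> \<zero>\<^bsub>P\<^esub> = ?r" using P.M.a_coset_add_zero[OF r(1)] .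
  show "\<alpha> x = \<zero>\<^bsub>N\<^esub>" if x: "x \<in> ?r" for x
  proof -
    have xP: "x \<in> carrier P" using x r(1) by blast
    have "?r +>\<^bsub>P\<^esub> x = ?r" using P.M.a_coset_join2[OF xP sub x] .
    then show ?thesis using h(2)[OF xP] h(2)[OF P.M.zero_closed] zero r0 by simp
  qed
  obtain x where x: "x \<in> carrier P" "x \<notin> ?r" using rad(2) r(1) by blast
  have "\<alpha> x \<noteq> \<zero>\<^bsub>N\<^esub>"
  proof
    assume "\<alpha> x = \<zero>\<^bsub>N\<^esub>"
    then have "h (?r +>\<^bsub>P\<^esub> x) = h (?r +>\<^bsub>P\<^esub> \<zero>\<^bsub>P\<^esub>)" using h(2) x zero by simp
    then have "?r +>\<^bsub>P\<^esub> x = ?r"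
      using h(1) x r0 top unfolding bij_betw_def by (metis inj_onD imageI P.M.zero_closed)
    then show False using P.M.a_coset_join1[OF _ x(1) sub] x(2) by simp
  qed
  then show "\<exists>x\<in>carrier P. \<alpha> x \<noteq> \<zero>\<^bsub>N\<^esub>" using x(1) by blast
  have "module_soc \<Lambda> N = h ` (\<lambda>x. ?r +>\<^bsub>P\<^esub> x) ` carrier P"
    using h(1) top by (simp add: bij_betw_def)
  also have "\<dots> = \<alpha> ` carrier P" using h(2) by (simp add: image_image)
  finally show "module_soc \<Lambda> N = \<alpha> ` carrier P" .
qed

text \<open>The image is a proper submodule, hence contained in rad P. This plays the part of
  locality of the endomorphism ring of \<open>P\<close>.\<close>

lemma \<alpha>_nonsurj:
  assumes "t \<in> mod_hom \<Lambda> P P" "t ` carrier P \<noteq> carrier P" "p \<in> carrier P"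
  shows "\<alpha> (t p) = \<zero>\<^bsub>N\<^esub>"
  using rad(3)[OF submodule_image[OF P.right_module_axioms P.right_module_axioms assms(1) P.submodule_carrier] assms(2)]
    assms(3) by (intro \<alpha>_rad) blast

text \<open>As \<sigma> vanishes on the image of \<open>g\<close>, having all values of
  \<open>e\<close> there would make \<alpha> zero. A retraction of the first map of the sequence
  would put them there.\<close>

lemma e_not_through_g: "\<not> (\<forall>p\<in>carrier P. e p \<in> g ` carrier P\<^sub>1)"
proof
  assume *: "\<forall>p\<in>carrier P. e p \<in> g ` carrier P\<^sub>1"
  have "\<alpha> p = \<zero>\<^bsub>N\<^esub>" if "p \<in> carrier P" for p
    using * that \<sigma>_g lift[OF that] by (metis imageE)
  then show False using \<alpha>_nonzero by blast
qed

text \<open>The right almost split property in terms of modules: \<open>nosplit\<close> says that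
  \<open>(u, 0)\<close> is not a split epimorphism onto \<open>P \<rightarrow> 0\<close>, and
  \<open>s\<close>, \<open>u\<close>, \<open>w\<close> are the components of a morphism to the
  middle term of the sequence.\<close>

lemma right_factor:
  assumes X: "fg_module \<Lambda> X" "projective_module \<Lambda> X" and Y: "fg_module \<Lambda> Y" "projective_module \<Lambda> Y"
    and x: "x \<in> mod_hom \<Lambda> X Y" and u: "u \<in> mod_hom \<Lambda> X P"
    and nosplit: "\<not> (\<exists>s\<in>mod_hom \<Lambda> P X. \<forall>p\<in>carrier P. x (s p) = \<zero>\<^bsub>Y\<^esub> \<and> u (s p) = p)"
  shows "\<exists>w\<in>mod_hom \<Lambda> Y P\<^sub>0. \<exists>s\<in>mod_hom \<Lambda> X P\<^sub>1. \<forall>y\<in>carrier X. w (x y) = g (s y) \<oplus>\<^bsub>P\<^sub>0\<^esub> e (u y)"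
proof -
  have XM: "right_module \<Lambda> X" and YM: "right_module \<Lambda> Y" using X Y by (auto simp: fg_module_def)
  interpret X: right_module \<Lambda> X by fact
  interpret Y: right_module \<Lambda> Y by fact
  have van: "\<alpha> (u (t p)) = \<zero>\<^bsub>N\<^esub>"
    if t: "t \<in> mod_hom \<Lambda> P X" and xt: "\<And>p. p \<in> carrier P \<Longrightarrow> x (t p) = \<zero>\<^bsub>Y\<^esub>" and p: "p \<in> carrier P" for t p
  proof -
    have ut: "(\<lambda>p. u (t p)) \<in> mod_hom \<Lambda> P P" using mod_hom_comp[OF t u] .
    \<comment> \<open>If \<open>u t\<close> were onto it would split by projectivity, and
      \<open>t\<close> composed with a section would contradict \<open>nosplit\<close>.\<close>
    have "(\<lambda>p. u (t p)) ` carrier P \<noteq> carrier P"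
    proof
      assume "(\<lambda>p. u (t p)) ` carrier P = carrier P"
      then obtain j where j: "j \<in> mod_hom \<Lambda> P P" "\<And>p. p \<in> carrier P \<Longrightarrow> u (t (j p)) = p"
        using projective_lift[OF fgP prP P.right_module_axioms P.right_module_axioms ut mod_hom_id] by auto
      have "\<forall>p\<in>carrier P. x (t (j p)) = \<zero>\<^bsub>Y\<^esub> \<and> u (t (j p)) = p"
        using xt mod_hom_closed[OF j(1)] j(2) by simp
      then show False using nosplit bexI[OF _ mod_hom_comp[OF j(1) t]] by simp
    qed
    then show ?thesis using \<alpha>_nonsurj[OF ut _ p] by simp
  qed
  have "\<exists>v\<in>mod_hom \<Lambda> Y N. \<forall>y\<in>carrier X. v (x y) = \<alpha> (u y)"
    by (rule nakayama_factor[OF injective_J fgP prP NM XM Y(1) x mod_hom_comp[OF u \<alpha>_hom]]) (rule van)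
  then obtain v where v: "v \<in> mod_hom \<Lambda> Y N" "\<And>y. y \<in> carrier X \<Longrightarrow> v (x y) = \<alpha> (u y)" by blast
  have "v ` carrier Y \<subseteq> \<sigma> ` carrier P\<^sub>0" using mod_hom_closed[OF v(1)] P0(4) by blast
  from projective_lift[OF Y P0.right_module_axioms NM P0(3) v(1) this]
  obtain w where w: "w \<in> mod_hom \<Lambda> Y P\<^sub>0" "\<And>y. y \<in> carrier Y \<Longrightarrow> \<sigma> (w y) = v y" by blast
  \<comment> \<open>After applying \<sigma> the two terms agree, so their difference lies in the
    image of \<open>g\<close> and lifts to \<open>P\<^sub>1\<close>.\<close>
  let ?d = "\<lambda>y. w (x y) \<ominus>\<^bsub>P\<^sub>0\<^esub> e (u y)"
  note wx = mod_hom_comp[OF x w(1)] and eu = mod_hom_comp[OF u e_hom]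
  have d: "?d \<in> mod_hom \<Lambda> X P\<^sub>0"
    by (rule mod_hom_pointwise_minus[OF XM P0.right_module_axioms wx eu])
  have "?d y \<in> g ` carrier P\<^sub>1" if y: "y \<in> carrier X" for y
  proof -
    have "\<sigma> (?d y) = \<alpha> (u y) \<ominus>\<^bsub>N\<^esub> \<alpha> (u y)"
      using mod_hom_minus[OF P0.right_module_axioms NM P0(3) mod_hom_closed[OF wx y] mod_hom_closed[OF eu y]]
        w(2)[OF mod_hom_closed[OF x y]] v(2)[OF y] lift[OF mod_hom_closed[OF u y]] by simp
    also have "\<dots> = \<zero>\<^bsub>N\<^esub>"
      using N.add_minus_cancel(3) mod_hom_closed[OF \<alpha>_hom mod_hom_closed[OF u y]] by blast
    finally show ?thesis using mod_hom_closed[OF d y] P1(4) by (simp add: mod_ker_def)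
  qed
  then have "?d ` carrier X \<subseteq> g ` carrier P\<^sub>1" by blast
  from projective_lift[OF X P1.right_module_axioms P0.right_module_axioms g_hom d this]
  obtain s where s: "s \<in> mod_hom \<Lambda> X P\<^sub>1" "\<And>y. y \<in> carrier X \<Longrightarrow> g (s y) = ?d y" by blast
  have "w (x y) = g (s y) \<oplus>\<^bsub>P\<^sub>0\<^esub> e (u y)" if y: "y \<in> carrier X" for y
    using s(2)[OF y] P0.add_minus_cancel(2)[OF mod_hom_closed[OF eu y] mod_hom_closed[OF wx y]] by simp
  then show ?thesis by (intro bexI[OF _ w(1)] bexI[OF _ s(1)] ballI)
qed

text \<open>
  An endomorphism \<open>c\<close> of \<open>P\<^sub>0\<close> with \<open>\<sigma> c e = \<alpha>\<close> that comes from an endomorphism of \<open>g\<close> induces an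
  endomorphism of \<open>\<nu> P\<close> which is the identity on the socle, hence an automorphism.
\<close>

lemma endo_bij:
  assumes a: "a \<in> mod_hom \<Lambda> P\<^sub>1 P\<^sub>1" and c: "c \<in> mod_hom \<Lambda> P\<^sub>0 P\<^sub>0"
    and comm: "\<And>z. z \<in> carrier P\<^sub>1 \<Longrightarrow> g (a z) = c (g z)"
    and ce: "\<And>p. p \<in> carrier P \<Longrightarrow> \<sigma> (c (e p)) = \<alpha> p"
  shows "bij_betw a (carrier P\<^sub>1) (carrier P\<^sub>1)" "bij_betw c (carrier P\<^sub>0) (carrier P\<^sub>0)"
proof -
  have \<sigma>c: "(\<lambda>y. \<sigma> (c y)) \<in> mod_hom \<Lambda> P\<^sub>0 N" using mod_hom_comp[OF c P0(3)] .
  \<comment> \<open>On the image of \<open>g\<close> one has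
    \<open>\<sigma> c g = \<sigma> g a = 0\<close>, so \<open>\<sigma> c\<close> factors through
    \<sigma>; the factor is \<eta>.\<close>
  have "y \<in> mod_ker P\<^sub>0 N (\<lambda>y. \<sigma> (c y))" if y: "y \<in> mod_ker P\<^sub>0 N \<sigma>" for y
  proof -
    obtain z where z: "z \<in> carrier P\<^sub>1" "y = g z" using y P1(4) by auto
    then show ?thesis
      using y \<sigma>_g[OF mod_hom_closed[OF a z(1)]] comm[OF z(1)] by (simp add: mod_ker_def)
  qed
  then obtain \<eta> where \<eta>: "\<eta> \<in> mod_hom \<Lambda> N N" "\<And>y. y \<in> carrier P\<^sub>0 \<Longrightarrow> \<eta> (\<sigma> y) = \<sigma> (c y)"
    using mod_hom_factor_surj[OF P0.right_module_axioms NM NM P0(3,4) \<sigma>c] by (auto simp: subset_iff)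
  have \<eta>soc: "\<eta> n = n" if n: "n \<in> module_soc \<Lambda> N" for n
  proof -
    obtain p where p: "p \<in> carrier P" "n = \<alpha> p" using n \<alpha>_image by auto
    then show ?thesis using \<eta>(2)[OF mod_hom_closed[OF e_hom p(1)]] lift[OF p(1)] ce[OF p(1)] by simp
  qed
  \<comment> \<open>The chain condition for \<nu> P comes from its cover \<open>P\<^sub>0\<close>.
    It makes the socle essential, so that \<eta> is injective, and then makes the injective \<eta>
    onto.\<close>
  have dccN: "dcc \<Lambda> N" using fg_module_dcc[OF fg_module_image[OF P0(1) NM P0(3,4)]] .
  have inj: "inj_on \<eta> (carrier N)"
    by (rule dcc_inj_on_socle[OF NM NM dccN \<eta>(1)]) (use \<eta>soc in metis)
  have \<eta>bij: "bij_betw \<eta> (carrier N) (carrier N)"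
    using dcc_injective_endo[OF NM dccN \<eta>(1) inj] inj by (simp add: bij_betw_def)
  show cbij: "bij_betw c (carrier P\<^sub>0) (carrier P\<^sub>0)"
    by (rule projective_cover_lift_bij[OF covers(1) NM c \<eta>bij]) (simp add: \<eta>(2))
  let ?K = "mod_ker P\<^sub>0 N \<sigma>"
  have K: "submodule ?K \<Lambda> P\<^sub>0" by (rule submodule_mod_ker[OF P0.right_module_axioms NM P0(3)])
  have \<eta>0: "\<eta> \<zero>\<^bsub>N\<^esub> = \<zero>\<^bsub>N\<^esub>" by (rule mod_hom_zero[OF NM NM \<eta>(1)])
  \<comment> \<open>The map \<open>a\<close> covers the restriction of \<open>c\<close> to the
    kernel of \<sigma>, so this restriction must be bijective too. It is onto because \<eta> is
    injective.\<close>
  have "c ` ?K = ?K"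
  proof
    show "c ` ?K \<subseteq> ?K"
    proof
      fix y assume "y \<in> c ` ?K"
      then obtain z where z: "z \<in> carrier P\<^sub>0" "\<sigma> z = \<zero>\<^bsub>N\<^esub>" "y = c z" by (auto simp: mod_ker_def)
      then show "y \<in> ?K" using \<eta>(2)[OF z(1)] \<eta>0 mod_hom_closed[OF c z(1)] by (simp add: mod_ker_def)
    qed
    show "?K \<subseteq> c ` ?K"
    proof
      fix y assume y: "y \<in> ?K"
      then have yK: "y \<in> carrier P\<^sub>0" "\<sigma> y = \<zero>\<^bsub>N\<^esub>" by (simp_all add: mod_ker_def)
      then obtain z where z: "z \<in> carrier P\<^sub>0" "y = c z" using cbij unfolding bij_betw_def by blast
      have "\<eta> (\<sigma> z) = \<eta> \<zero>\<^bsub>N\<^esub>" using \<eta>(2)[OF z(1)] z yK \<eta>0 by simp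
      then have "\<sigma> z = \<zero>\<^bsub>N\<^esub>" using inj_onD[OF inj] mod_hom_closed[OF P0(3) z(1)] N.M.zero_closed by blast
      then show "y \<in> c ` ?K" using z by (auto simp: mod_ker_def)
    qed
  qed
  then have "bij_betw c (carrier K) (carrier K)"
    using inj_on_subset[of c "carrier P\<^sub>0" ?K] cbij by (auto simp: bij_betw_def mod_ker_def)
  then show "bij_betw a (carrier P\<^sub>1) (carrier P\<^sub>1)"
    by (rule projective_cover_lift_bij[OF covers(2) P0.right_module_submodule[OF K] a]) (simp add: comm)
qed

text \<open>
  The second alternative is a retraction of \<open>(a, b)\<close>. It arises from the right almost split property
  applied to the pushout of the sequence along \<open>(a, b)\<close>.
\<close>

lemma left_factor:
  assumes X: "fg_module \<Lambda> X" "projective_module \<Lambda> X" and Y: "fg_module \<Lambda> Y" "projective_module \<Lambda> Y"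
    and x: "x \<in> mod_hom \<Lambda> X Y" and a: "a \<in> mod_hom \<Lambda> P\<^sub>1 X" and b: "b \<in> mod_hom \<Lambda> P\<^sub>0 Y"
    and comm: "\<And>z. z \<in> carrier P\<^sub>1 \<Longrightarrow> b (g z) = x (a z)"
  shows "(\<exists>c\<in>mod_hom \<Lambda> P X. \<forall>p\<in>carrier P. x (c p) = b (e p))
    \<or> (\<exists>r\<in>mod_hom \<Lambda> X P\<^sub>1. \<exists>q\<in>mod_hom \<Lambda> Y P\<^sub>0. (\<forall>y\<in>carrier X. q (x y) = g (r y))
        \<and> (\<forall>z\<in>carrier P\<^sub>1. r (a z) = z) \<and> (\<forall>z\<in>carrier P\<^sub>0. q (b z) = z))"
proof -
  have XM: "right_module \<Lambda> X" and YM: "right_module \<Lambda> Y" using X Y by (auto simp: fg_module_def)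
  interpret X: right_module \<Lambda> X by fact
  interpret Y: right_module \<Lambda> Y by fact
  \<comment> \<open>The pushout along \<open>(a, b)\<close>: its source is the direct sum of
    \<open>X\<close> and \<open>P\<close>, its target is still \<open>Y\<close>, and its arrow is
    \<open>x\<close> on \<open>X\<close> and \<open>b e\<close> on \<open>P\<close>.\<close>
  let ?Z = "direct_sum X P" and ?x = "\<lambda>(y, p). x y \<oplus>\<^bsub>Y\<^esub> b (e p)"
  note PM = P.right_module_axioms and be = mod_hom_comp[OF e_hom b]
  note Z = fg_module_direct_sum[OF X(1) fgP] projective_module_direct_sum[OF X(2) prP]
  note ij = direct_sum_homs[OF XM PM]
  have x': "?x \<in> mod_hom \<Lambda> ?Z Y" using mod_hom_copair[OF XM PM YM x be] .
  show ?thesis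
  proof (cases "\<exists>s\<in>mod_hom \<Lambda> P ?Z. \<forall>p\<in>carrier P. ?x (s p) = \<zero>\<^bsub>Y\<^esub> \<and> snd (s p) = p")
    case True
    then obtain s where s: "s \<in> mod_hom \<Lambda> P ?Z" "\<And>p. p \<in> carrier P \<Longrightarrow> ?x (s p) = \<zero>\<^bsub>Y\<^esub>"
      "\<And>p. p \<in> carrier P \<Longrightarrow> snd (s p) = p" by blast
    have f: "(\<lambda>p. fst (s p)) \<in> mod_hom \<Lambda> P X" using mod_hom_comp[OF s(1) ij(3)] .
    \<comment> \<open>The second component of the section is the identity, so \<open>x\<close>
      applied to the first one cancels \<open>b e\<close>; the negative of the first component is
      the required map.\<close>
    let ?c = "\<lambda>p. \<zero>\<^bsub>X\<^esub> \<ominus>\<^bsub>X\<^esub> fst (s p)"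
    have c: "?c \<in> mod_hom \<Lambda> P X"
      using mod_hom_pointwise_minus[OF PM XM mod_hom_zero_map[OF XM] f] .
    have "x (?c p) = b (e p)" if p: "p \<in> carrier P" for p
    proof -
      have fp: "fst (s p) \<in> carrier X" using mod_hom_closed[OF f p] .
      have sum: "x (fst (s p)) \<oplus>\<^bsub>Y\<^esub> b (e p) = \<zero>\<^bsub>Y\<^esub>" using s(2,3)[OF p] by (simp add: split_beta)
      have "x (?c p) = \<zero>\<^bsub>Y\<^esub> \<ominus>\<^bsub>Y\<^esub> x (fst (s p))"
        using mod_hom_minus[OF XM YM x X.M.zero_closed fp] mod_hom_zero[OF XM YM x] by simp
      then show ?thesis
        using Y.add_diff_cancel(2)[OF mod_hom_closed[OF x fp] mod_hom_closed[OF be p]] sum by simp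
    qed
    then show ?thesis by (intro disjI1 bexI[OF _ c] ballI)
  next
    case False
    from right_factor[OF Z Y x' ij(4) False]
    obtain w s where w: "w \<in> mod_hom \<Lambda> Y P\<^sub>0" and s: "s \<in> mod_hom \<Lambda> ?Z P\<^sub>1"
      and ws: "\<And>z. z \<in> carrier ?Z \<Longrightarrow> w (?x z) = g (s z) \<oplus>\<^bsub>P\<^sub>0\<^esub> e (snd z)" by blast
    \<comment> \<open>Restricted to \<open>X\<close>, the maps \<open>s\<close> and \<open>w\<close>
      form a morphism to \<open>P\<^sub>1 \<rightarrow> P\<^sub>0\<close>. Composed with
      \<open>(a, b)\<close> it is the endomorphism to which \<open>endo_bij\<close> applies.\<close>
    let ?s = "\<lambda>y. s (y, \<zero>\<^bsub>P\<^esub>)"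
    have s1: "?s \<in> mod_hom \<Lambda> X P\<^sub>1" using mod_hom_comp[OF ij(1) s] .
    have wx: "w (x y) = g (?s y)" if y: "y \<in> carrier X" for y
      using ws[of "(y, \<zero>\<^bsub>P\<^esub>)"] y mod_hom_zero[OF PM YM be] mod_hom_zero[OF PM P0.right_module_axioms e_hom]
        mod_hom_closed[OF x y] mod_hom_closed[OF g_hom mod_hom_closed[OF s1 y]] by simp
    \<comment> \<open>On the summand \<open>P\<close> the relation \<open>ws\<close> says that
      \<open>w b e\<close> is \<open>e\<close> plus a value of \<open>g\<close>, which \<sigma>
      kills.\<close>
    have wbe: "\<sigma> (w (b (e p))) = \<alpha> p" if p: "p \<in> carrier P" for p
    proof -
      have z: "(\<zero>\<^bsub>X\<^esub>, p) \<in> carrier ?Z" using p by simp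
      have gs: "g (s (\<zero>\<^bsub>X\<^esub>, p)) \<in> carrier P\<^sub>0" using mod_hom_closed[OF g_hom mod_hom_closed[OF s z]] .
      have "w (b (e p)) = g (s (\<zero>\<^bsub>X\<^esub>, p)) \<oplus>\<^bsub>P\<^sub>0\<^esub> e p"
        using ws[OF z] mod_hom_zero[OF XM YM x] mod_hom_closed[OF be p] by simp
      then have "\<sigma> (w (b (e p))) = \<zero>\<^bsub>N\<^esub> \<oplus>\<^bsub>N\<^esub> \<alpha> p"
        using mod_hom_add[OF P0(3) gs mod_hom_closed[OF e_hom p]] \<sigma>_g[OF mod_hom_closed[OF s z]] lift[OF p]
        by simp
      then show ?thesis using N.M.l_zero[OF mod_hom_closed[OF \<alpha>_hom p]] by simp
    qed
    let ?a = "\<lambda>z. ?s (a z)" and ?c = "\<lambda>z. w (b z)"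
    have ac: "?a \<in> mod_hom \<Lambda> P\<^sub>1 P\<^sub>1" "?c \<in> mod_hom \<Lambda> P\<^sub>0 P\<^sub>0"
      using mod_hom_comp[OF a s1] mod_hom_comp[OF b w] .
    have gac: "g (?a z) = ?c (g z)" if "z \<in> carrier P\<^sub>1" for z
      using wx[OF mod_hom_closed[OF a that]] comm[OF that] by simp
    note bij = endo_bij[OF ac gac wbe]
    let ?ia = "the_inv_into (carrier P\<^sub>1) ?a" and ?ic = "the_inv_into (carrier P\<^sub>0) ?c"
    note inv = mod_hom_inverse[OF ac(1) bij(1) P1.right_module_axioms]
      mod_hom_inverse[OF ac(2) bij(2) P0.right_module_axioms]
    have ia: "?ia (?a z) = z" if "z \<in> carrier P\<^sub>1" for z
      using the_inv_into_f_f[OF _ that, of ?a] bij(1) by (simp add: bij_betw_def)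
    have ic: "?ic (?c z) = z" if "z \<in> carrier P\<^sub>0" for z
      using the_inv_into_f_f[OF _ that, of ?c] bij(2) by (simp add: bij_betw_def)
    \<comment> \<open>As \<open>?a\<close> is onto, \<open>?s y\<close> is some \<open>?a z\<close>,
      and both sides reduce to \<open>g z\<close>.\<close>
    have "?ic (w (x y)) = g (?ia (?s y))" if y: "y \<in> carrier X" for y
    proof -
      have "?s y \<in> ?a ` carrier P\<^sub>1" using mod_hom_closed[OF s1 y] bij(1) by (simp add: bij_betw_def)
      then obtain z where z: "z \<in> carrier P\<^sub>1" "?s y = ?a z" by blast
      have "?ic (w (x y)) = ?ic (?c (g z))" using wx[OF y] z gac[OF z(1)] by simp
      also have "\<dots> = g z" by (rule ic[OF mod_hom_closed[OF g_hom z(1)]])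
      also have "\<dots> = g (?ia (?s y))" using ia[OF z(1)] z(2) by simp
      finally show ?thesis .
    qed
    then show ?thesis
      using ia ic
      by (intro disjI2 bexI[OF _ mod_hom_comp[OF s1 inv(1)]] bexI[OF _ mod_hom_comp[OF w inv(2)]] conjI ballI)
  qed
qed

section \<open>The sequence in the morphism category\<close>

abbreviation (input) "F_obj \<equiv> \<lparr>src = P\<^sub>1, tgt = P\<^sub>0, arr = g\<rparr>"
abbreviation (input) "G_obj \<equiv> \<lparr>src = direct_sum P\<^sub>1 P, tgt = P\<^sub>0, arr = \<lambda>(x, p). g x \<oplus>\<^bsub>P\<^sub>0\<^esub> e p\<rparr>"
abbreviation (input) "K_obj \<equiv> \<lparr>src = P, tgt = zero_module :: ('l, unit) module, arr = \<lambda>p. ()\<rparr>"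
abbreviation (input) "incl \<equiv> (\<lambda>x :: 'p1. (x, \<zero>\<^bsub>P\<^esub>), \<lambda>y :: 'p0. y)"
abbreviation (input) "proj \<equiv> (\<lambda>(x :: 'p1, p :: 'p). p, \<lambda>y :: 'p0. ())"

lemma arr_G: "(\<lambda>(x, p). g x \<oplus>\<^bsub>P\<^sub>0\<^esub> e p) \<in> mod_hom \<Lambda> (direct_sum P\<^sub>1 P) P\<^sub>0"
  by (rule mod_hom_copair[OF P1.right_module_axioms P.right_module_axioms P0.right_module_axioms g_hom e_hom])

lemma zero_module_hom: "(\<lambda>_. ()) \<in> mod_hom A M zero_module"
  by (rule mod_homI) auto

lemma objects: "P_obj \<Lambda> F_obj" "P_obj \<Lambda> G_obj" "P_obj \<Lambda> K_obj"
  using P0 P1 g_hom fgP prP arr_G fg_module_direct_sum[OF P1(1) fgP] projective_module_direct_sum[OF P1(2) prP]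
    zero_module_props[OF L.ring_axioms] zero_module_hom[of \<Lambda> P]
  by (simp_all add: P_obj_def H_obj_def)

lemma seq_homs: "incl \<in> H_hom \<Lambda> F_obj G_obj" "proj \<in> H_hom \<Lambda> G_obj K_obj"
proof -
  note ij = direct_sum_homs[OF P1.right_module_axioms P.right_module_axioms]
  have "g x \<oplus>\<^bsub>P\<^sub>0\<^esub> e \<zero>\<^bsub>P\<^esub> = g x" if "x \<in> carrier P\<^sub>1" for x
    using mod_hom_closed[OF g_hom that] mod_hom_zero[OF P.right_module_axioms P0.right_module_axioms e_hom] by simp
  then show "incl \<in> H_hom \<Lambda> F_obj G_obj"
    using ij(1) mod_hom_id by (simp add: H_hom_def)
  have "(\<lambda>(x :: 'p1, p :: 'p). p) = snd" by auto
  then show "proj \<in> H_hom \<Lambda> G_obj K_obj"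
    using ij(4) zero_module_hom by (simp add: H_hom_def)
qed

lemma exact: "H_short_exact \<Lambda> F_obj incl G_obj proj K_obj"
proof -
  have "short_exact \<Lambda> P\<^sub>1 (\<lambda>x. (x, \<zero>\<^bsub>P\<^esub>)) (direct_sum P\<^sub>1 P) (\<lambda>(x, p). p) P"
    unfolding short_exact_def
  proof (intro conjI)
    show "(\<lambda>x. (x, \<zero>\<^bsub>P\<^esub>)) ` carrier P\<^sub>1 = mod_ker (direct_sum P\<^sub>1 P) P (\<lambda>(x, p). p)"
      by (auto simp: mod_ker_def)
    show "(\<lambda>(x, p). p) ` carrier (direct_sum P\<^sub>1 P) = carrier P"
      using P1.M.zero_closed by (force simp: image_iff)
  qed (use seq_homs in \<open>auto simp: H_hom_def inj_on_def\<close>)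
  moreover have "short_exact \<Lambda> P\<^sub>0 (\<lambda>y. y) P\<^sub>0 (\<lambda>y. ()) zero_module"
    unfolding short_exact_def using mod_hom_id zero_module_hom P0.M.zero_closed by (auto simp: mod_ker_def)
  ultimately show ?thesis
    using objects seq_homs by (simp add: H_short_exact_def P_obj_def)
qed

lemma right_almost_split: "P_right_almost_split TYPE('u \<times> 'v) \<Lambda> G_obj K_obj proj"
  unfolding P_right_almost_split_def
proof (intro conjI allI impI; (rule objects seq_homs)?)
  show "\<not> H_split_epi \<Lambda> G_obj K_obj proj"
  proof
    assume "H_split_epi \<Lambda> G_obj K_obj proj"
    then obtain \<rho>1 \<rho>2 where \<rho>: "(\<rho>1, \<rho>2) \<in> H_hom \<Lambda> K_obj G_obj"
      and eq: "H_eq K_obj (H_comp proj (\<rho>1, \<rho>2)) (id, id)"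
      unfolding H_split_epi_def by auto
    have \<rho>1: "\<rho>1 \<in> mod_hom \<Lambda> P (direct_sum P\<^sub>1 P)" and \<rho>2: "\<rho>2 \<in> mod_hom \<Lambda> zero_module P\<^sub>0"
      and comm: "\<And>p. p \<in> carrier P \<Longrightarrow> \<rho>2 () = g (fst (\<rho>1 p)) \<oplus>\<^bsub>P\<^sub>0\<^esub> e (snd (\<rho>1 p))"
      using \<rho> by (auto simp: H_hom_def split_beta)
    have snd: "snd (\<rho>1 p) = p" if "p \<in> carrier P" for p
      using eq that by (simp add: H_eq_def H_comp_def split_beta)
    \<comment> \<open>A homomorphism out of \<open>zero_module\<close> vanishes, so the square of a
      section says that \<open>e p\<close> cancels a value of \<open>g\<close>; applying \<sigma>
      gives \<open>\<alpha> p = 0\<close>.\<close>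
    have "\<rho>2 () = \<zero>\<^bsub>P\<^sub>0\<^esub>"
      using mod_hom_zero[OF zero_module_props(1)[OF L.ring_axioms] P0.right_module_axioms \<rho>2] by simp
    have "\<alpha> p = \<zero>\<^bsub>N\<^esub>" if p: "p \<in> carrier P" for p
    proof -
      have f: "fst (\<rho>1 p) \<in> carrier P\<^sub>1" using mod_hom_closed[OF \<rho>1 p] by auto
      have "\<sigma> (g (fst (\<rho>1 p)) \<oplus>\<^bsub>P\<^sub>0\<^esub> e p) = \<zero>\<^bsub>N\<^esub>"
        using comm[OF p] snd[OF p] \<open>\<rho>2 () = \<zero>\<^bsub>P\<^sub>0\<^esub>\<close> mod_hom_zero[OF P0.right_module_axioms NM P0(3)] by simp
      moreover have "\<sigma> (g (fst (\<rho>1 p)) \<oplus>\<^bsub>P\<^sub>0\<^esub> e p) = \<zero>\<^bsub>N\<^esub> \<oplus>\<^bsub>N\<^esub> \<alpha> p"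
        using mod_hom_add[OF P0(3) mod_hom_closed[OF g_hom f] mod_hom_closed[OF e_hom p]] \<sigma>_g[OF f] lift[OF p]
        by simp
      ultimately show ?thesis using N.M.l_zero[OF mod_hom_closed[OF \<alpha>_hom p]] by simp
    qed
    then show False using \<alpha>_nonzero by blast
  qed
next
  fix X :: "('l, 'u, 'v) arrow" and \<theta> assume *: "P_obj \<Lambda> X \<and> \<theta> \<in> H_hom \<Lambda> X K_obj \<and> \<not> H_split_epi \<Lambda> X K_obj \<theta>"
  obtain u u' where \<theta>: "\<theta> = (u, u')" by (cases \<theta>)
  have X: "fg_module \<Lambda> (src X)" "projective_module \<Lambda> (src X)" "fg_module \<Lambda> (tgt X)" "projective_module \<Lambda> (tgt X)"
    and x: "arr X \<in> mod_hom \<Lambda> (src X) (tgt X)" and u: "u \<in> mod_hom \<Lambda> (src X) P"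
    using * \<theta> by (auto simp: P_obj_def H_obj_def H_hom_def)
  have TM: "right_module \<Lambda> (tgt X)" using X by (simp add: fg_module_def)
  have "\<not> (\<exists>s\<in>mod_hom \<Lambda> P (src X). \<forall>p\<in>carrier P. arr X (s p) = \<zero>\<^bsub>tgt X\<^esub> \<and> u (s p) = p)"
  proof
    assume "\<exists>s\<in>mod_hom \<Lambda> P (src X). \<forall>p\<in>carrier P. arr X (s p) = \<zero>\<^bsub>tgt X\<^esub> \<and> u (s p) = p"
    then obtain s where s: "s \<in> mod_hom \<Lambda> P (src X)" "\<forall>p\<in>carrier P. arr X (s p) = \<zero>\<^bsub>tgt X\<^esub> \<and> u (s p) = p" by blast
    \<comment> \<open>To be a morphism out of \<open>P \<rightarrow> 0\<close> means for
      \<open>s\<close> that its composite with \<open>arr X\<close> is zero, so \<open>s\<close>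
      with the zero map is a section of \<theta>.\<close>
    have "(s, \<lambda>_. \<zero>\<^bsub>tgt X\<^esub>) \<in> H_hom \<Lambda> K_obj X"
      using s mod_hom_zero_map[OF TM] by (simp add: H_hom_def)
    moreover have "H_eq K_obj (H_comp \<theta> (s, \<lambda>_. \<zero>\<^bsub>tgt X\<^esub>)) (id, id)"
      using s(2) \<theta> by (simp add: H_eq_def H_comp_def)
    ultimately show False using * unfolding H_split_epi_def by blast
  qed
  from right_factor[OF X x u this]
  obtain w s where w: "w \<in> mod_hom \<Lambda> (tgt X) P\<^sub>0" and s: "s \<in> mod_hom \<Lambda> (src X) P\<^sub>1"
    and ws: "\<And>y. y \<in> carrier (src X) \<Longrightarrow> w (arr X y) = g (s y) \<oplus>\<^bsub>P\<^sub>0\<^esub> e (u y)" by blast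
  have "(\<lambda>y. (s y, u y), w) \<in> H_hom \<Lambda> X G_obj"
    using mod_hom_pair[OF s u] w ws by (simp add: H_hom_def)
  moreover have "H_eq X (H_comp proj (\<lambda>y. (s y, u y), w)) \<theta>"
    using \<theta> by (simp add: H_eq_def H_comp_def)
  ultimately show "\<exists>\<theta>'\<in>H_hom \<Lambda> X G_obj. H_eq X (H_comp proj \<theta>') \<theta>" by blast
qed

lemma left_almost_split: "P_left_almost_split TYPE('u \<times> 'v) \<Lambda> F_obj G_obj incl"
  unfolding P_left_almost_split_def
proof (intro conjI allI impI; (rule objects seq_homs)?)
  show "\<not> H_split_mono \<Lambda> F_obj G_obj incl"
  proof
    assume "H_split_mono \<Lambda> F_obj G_obj incl"
    then obtain \<rho>1 \<rho>2 where \<rho>: "(\<rho>1, \<rho>2) \<in> H_hom \<Lambda> G_obj F_obj"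
      and eq: "H_eq F_obj (H_comp (\<rho>1, \<rho>2) incl) (id, id)"
      unfolding H_split_mono_def by auto
    have \<rho>1: "\<rho>1 \<in> mod_hom \<Lambda> (direct_sum P\<^sub>1 P) P\<^sub>1"
      and comm: "\<And>x p. \<lbrakk>x \<in> carrier P\<^sub>1; p \<in> carrier P\<rbrakk> \<Longrightarrow> \<rho>2 (g x \<oplus>\<^bsub>P\<^sub>0\<^esub> e p) = g (\<rho>1 (x, p))"
      using \<rho> by (auto simp: H_hom_def)
    have \<rho>2: "\<rho>2 y = y" if "y \<in> carrier P\<^sub>0" for y
      using eq that by (simp add: H_eq_def H_comp_def)
    \<comment> \<open>The second component of a retraction is the identity on
      \<open>P\<^sub>0\<close>, so its commuting square at \<open>(0, p)\<close> reads
      \<open>e p = g (\<rho>1 (0, p))\<close>.\<close>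
    have "e p \<in> g ` carrier P\<^sub>1" if p: "p \<in> carrier P" for p
    proof -
      have "g \<zero>\<^bsub>P\<^sub>1\<^esub> \<oplus>\<^bsub>P\<^sub>0\<^esub> e p = e p"
        using mod_hom_zero[OF P1.right_module_axioms P0.right_module_axioms g_hom] mod_hom_closed[OF e_hom p] by simp
      then have "e p = g (\<rho>1 (\<zero>\<^bsub>P\<^sub>1\<^esub>, p))"
        using comm[OF P1.M.zero_closed p] \<rho>2[OF mod_hom_closed[OF e_hom p]] by simp
      then show ?thesis using mod_hom_closed[OF \<rho>1, of "(\<zero>\<^bsub>P\<^sub>1\<^esub>, p)"] p by simp
    qed
    then show False using e_not_through_g by blast
  qed
next
  fix X :: "('l, 'u, 'v) arrow" and \<theta> assume *: "P_obj \<Lambda> X \<and> \<theta> \<in> H_hom \<Lambda> F_obj X \<and> \<not> H_split_mono \<Lambda> F_obj X \<theta>"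
  obtain a b where \<theta>: "\<theta> = (a, b)" by (cases \<theta>)
  have X: "fg_module \<Lambda> (src X)" "projective_module \<Lambda> (src X)" "fg_module \<Lambda> (tgt X)" "projective_module \<Lambda> (tgt X)"
    and x: "arr X \<in> mod_hom \<Lambda> (src X) (tgt X)"
    and a: "a \<in> mod_hom \<Lambda> P\<^sub>1 (src X)" and b: "b \<in> mod_hom \<Lambda> P\<^sub>0 (tgt X)"
    and comm: "\<And>z. z \<in> carrier P\<^sub>1 \<Longrightarrow> b (g z) = arr X (a z)"
    using * \<theta> by (auto simp: P_obj_def H_obj_def H_hom_def)
  have SM: "right_module \<Lambda> (src X)" and TM: "right_module \<Lambda> (tgt X)" using X by (simp_all add: fg_module_def)
  interpret S: right_module \<Lambda> "src X" by (rule SM)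
  have "\<not> (\<exists>r\<in>mod_hom \<Lambda> (src X) P\<^sub>1. \<exists>q\<in>mod_hom \<Lambda> (tgt X) P\<^sub>0. (\<forall>y\<in>carrier (src X). q (arr X y) = g (r y))
        \<and> (\<forall>z\<in>carrier P\<^sub>1. r (a z) = z) \<and> (\<forall>z\<in>carrier P\<^sub>0. q (b z) = z))"
  proof
    assume "\<exists>r\<in>mod_hom \<Lambda> (src X) P\<^sub>1. \<exists>q\<in>mod_hom \<Lambda> (tgt X) P\<^sub>0. (\<forall>y\<in>carrier (src X). q (arr X y) = g (r y))
        \<and> (\<forall>z\<in>carrier P\<^sub>1. r (a z) = z) \<and> (\<forall>z\<in>carrier P\<^sub>0. q (b z) = z)"
    then obtain r q where rq: "r \<in> mod_hom \<Lambda> (src X) P\<^sub>1" "q \<in> mod_hom \<Lambda> (tgt X) P\<^sub>0"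
      "\<forall>y\<in>carrier (src X). q (arr X y) = g (r y)" "\<forall>z\<in>carrier P\<^sub>1. r (a z) = z" "\<forall>z\<in>carrier P\<^sub>0. q (b z) = z"
      by blast
    have "(r, q) \<in> H_hom \<Lambda> X F_obj" using rq(1-3) by (simp add: H_hom_def)
    moreover have "H_eq F_obj (H_comp (r, q) \<theta>) (id, id)"
      using rq(4,5) \<theta> by (simp add: H_eq_def H_comp_def)
    ultimately show False using * unfolding H_split_mono_def by blast
  qed
  then obtain c where c: "c \<in> mod_hom \<Lambda> P (src X)" "\<And>p. p \<in> carrier P \<Longrightarrow> arr X (c p) = b (e p)"
    using left_factor[OF X x a b comm] by blast
  \<comment> \<open>The component on \<open>P\<^sub>1\<close> has to be \<open>a\<close>; on
    \<open>P\<close> it is \<open>c\<close>, where the equality of \<open>arr X (c p)\<close> with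
    \<open>b (e p)\<close> makes the square commute.\<close>
  let ?\<theta> = "(\<lambda>(z, p). a z \<oplus>\<^bsub>src X\<^esub> c p, b)"
  have "?\<theta> \<in> H_hom \<Lambda> G_obj X"
    using mod_hom_copair[OF P1.right_module_axioms P.right_module_axioms SM a c(1)] b
      mod_hom_add[OF x] mod_hom_add[OF b] mod_hom_closed[OF a] mod_hom_closed[OF c(1)]
      mod_hom_closed[OF g_hom] mod_hom_closed[OF e_hom] comm c(2)
    by (auto simp: H_hom_def)
  moreover have "H_eq F_obj (H_comp ?\<theta> incl) \<theta>"
    using \<theta> mod_hom_zero[OF P.right_module_axioms SM c(1)] mod_hom_closed[OF a]
    by (simp add: H_eq_def H_comp_def)
  ultimately show "\<exists>\<theta>'\<in>H_hom \<Lambda> G_obj X. H_eq F_obj (H_comp \<theta>' incl) \<theta>" by blast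
qed

end

theorem proposition5p2:
  fixes R :: "('r, 's) ring_scheme" and \<Lambda> :: "('r, 'l) module" and J :: "('r, 'j) module"
    and P :: "('l, 'p) module" and P\<^sub>0 :: "('l, 'p0) module" and P\<^sub>1 :: "('l, 'p1) module"
    and \<alpha> :: "'p \<Rightarrow> ('p \<Rightarrow> 'l) \<Rightarrow> 'j" and \<sigma> :: "'p0 \<Rightarrow> ('p \<Rightarrow> 'l) \<Rightarrow> 'j"
    and g :: "'p1 \<Rightarrow> 'p0" and e :: "'p \<Rightarrow> 'p0"
  assumes "artin_algebra R \<Lambda>"
    and "dualizing_module R J"
    and "fg_module \<Lambda> P" and "projective_module \<Lambda> P" and "indecomposable_module \<Lambda> P"
    and "top_to_socle_map \<Lambda> P (nakayama R J \<Lambda> P) \<alpha>"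
    and "minimal_projective_presentation \<Lambda> P\<^sub>1 g P\<^sub>0 \<sigma> (nakayama R J \<Lambda> P)"
    and "e \<in> mod_hom \<Lambda> P P\<^sub>0" and "\<forall>x\<in>carrier P. \<sigma> (e x) = \<alpha> x"
  shows "P_almost_split_sequence TYPE('u \<times> 'v) \<Lambda>
      \<lparr>src = P\<^sub>1, tgt = P\<^sub>0, arr = g\<rparr>
      (\<lambda>x. (x, \<zero>\<^bsub>P\<^esub>), \<lambda>y. y)
      \<lparr>src = direct_sum P\<^sub>1 P, tgt = P\<^sub>0, arr = \<lambda>(x, p). g x \<oplus>\<^bsub>P\<^sub>0\<^esub> e p\<rparr>
      (\<lambda>(x, p). p, \<lambda>y. ())
      \<lparr>src = P, tgt = zero_module, arr = \<lambda>p. ()\<rparr>"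
proof -
  have "right_module R J" "right_module \<Lambda> P"
    using assms(2,3) by (simp_all add: dualizing_module_def injective_envelope_def injective_module_def fg_module_def)
  then interpret nakayama_presentation R \<Lambda> J P P\<^sub>0 P\<^sub>1 \<alpha> \<sigma> g e
    using assms
    by (intro nakayama_presentation.intro nakayama_functor.intro artin_alg.intro
        nakayama_functor_axioms.intro nakayama_presentation_axioms.intro) simp_all
  show ?thesis
    unfolding P_almost_split_sequence_def
    using objects exact left_almost_split right_almost_split by blast
qed

end
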